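(* Let $K:[0,\infty)\to[0,\infty)$ be a right-continuous increasing function satisfying $$\int_0^1\frac{\varphi_K(s)}{s}\,ds<\infty \quad\text{and}\quad \int_1^\infty\frac{\varphi_K(s)}{s^2}\,ds<\infty,$$ where $\varphi_K(s)=\sup_{0<t\le 1}K(st)/K(t)$. Let $f\in L^2(\partial\mathbb{D})$ and let $\widehat f(z)=\int_{\partial\mathbb{D}}f(\zeta)\,d\mu_z(\zeta)$ be its Poisson extension, where $d\mu_z(\zeta)=\frac{1-|z|^2}{2\pi|\zeta-z|^2}|d\zeta|$. Then $f\in\mathcal{Q}_K(\partial\mathbb{D})$ if and only if $$\sup_{a\in\mathbb{D}}\int_{\mathbb{D}}\left(\int_{\partial\mathbb{D}}|f(\zeta)|^2\,d\mu_z(\zeta)-|\widehat f(z)|^2\right)\frac{K(1-|\sigma_a(z)|^2)}{(1-|z|^2)^2}\,dA(z)<\infty.$$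
   Context: $\mathbb{D}$ is the open unit disk, $\partial\mathbb{D}$ its boundary, $dA$ area measure, $|d\zeta|$ arc length, $\sigma_a(z)=\frac{a-z}{1-\overline a z}$. $\mathcal{Q}_K(\partial\mathbb{D})$ is the space of $f\in L^2(\partial\mathbb{D})$ with $\sup_{I\subset\partial\mathbb{D}}\int_I\int_I\frac{|f(\zeta)-f(\eta)|^2}{|\zeta-\eta|^2}K\left(\frac{|\zeta-\eta|}{|I|}\right)|d\zeta||d\eta|<\infty$, the supremum over arcs $I\subset\partial\mathbb{D}$ with arc length $|I|$. *)

theory Defs
  imports "HOL-Analysis.Analysis"
begin

text \<open>The unit circle is parametrised by \<open>cis \<theta>\<close>, \<open>\<theta> \<in> [0, 2\<pi>]\<close>, so that arc length
  \<open>|d\<zeta>|\<close> becomes \<open>d\<theta>\<close> (Lebesgue measure on the parameter interval).\<close>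

definition circle_L2 :: "(complex \<Rightarrow> complex) \<Rightarrow> bool" where
  "circle_L2 f \<longleftrightarrow>
     set_borel_measurable lborel {0..2*pi} (\<lambda>\<theta>. f (cis \<theta>)) \<and>
     set_integrable lborel {0..2*pi} (\<lambda>\<theta>. (cmod (f (cis \<theta>)))\<^sup>2)"

text \<open>phi_K(s) = sup over 0<t<=1 of K(st)/K(t), computed in [0,\<infinity>]
  (a positive number divided by 0 is \<infinity>, 0/0 = 0).\<close>
definition phiK :: "(real \<Rightarrow> real) \<Rightarrow> real \<Rightarrow> ennreal" where
  "phiK K s = (SUP t\<in>{0<..1}. ennreal (K (s * t)) / ennreal (K t))"

definition QK_arc_integral ::
  "(real \<Rightarrow> real) \<Rightarrow> (complex \<Rightarrow> complex) \<Rightarrow> real \<Rightarrow> real \<Rightarrow> ennreal" where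
  "QK_arc_integral K f \<alpha> L =
     (\<integral>\<^sup>+ \<theta>. \<integral>\<^sup>+ \<eta>. indicator {\<alpha>..\<alpha>+L} \<theta> * indicator {\<alpha>..\<alpha>+L} \<eta> *
        ennreal ((cmod (f (cis \<theta>) - f (cis \<eta>)))\<^sup>2 / (cmod (cis \<theta> - cis \<eta>))\<^sup>2
                 * K (cmod (cis \<theta> - cis \<eta>) / L)) \<partial>lborel \<partial>lborel)"

definition in_QK :: "(real \<Rightarrow> real) \<Rightarrow> (complex \<Rightarrow> complex) \<Rightarrow> bool" where
  "in_QK K f \<longleftrightarrow> circle_L2 f \<and>
     (SUP p\<in>(UNIV :: real set) \<times> {0<..2*pi}. QK_arc_integral K f (fst p) (snd p)) < \<infinity>"

definition poisson_kernel :: "complex \<Rightarrow> real \<Rightarrow> real" where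
  "poisson_kernel z \<theta> = (1 - (cmod z)\<^sup>2) / (2 * pi * (cmod (cis \<theta> - z))\<^sup>2)"

definition poisson_ext :: "(complex \<Rightarrow> complex) \<Rightarrow> complex \<Rightarrow> complex" where
  "poisson_ext f z = (\<integral>\<theta>\<in>{0..2*pi}. poisson_kernel z \<theta> *\<^sub>R f (cis \<theta>) \<partial>lborel)"

definition poisson_sq :: "(complex \<Rightarrow> complex) \<Rightarrow> complex \<Rightarrow> real" where
  "poisson_sq f z = (\<integral>\<theta>\<in>{0..2*pi}. poisson_kernel z \<theta> * (cmod (f (cis \<theta>)))\<^sup>2 \<partial>lborel)"

definition mobius :: "complex \<Rightarrow> complex \<Rightarrow> complex" where
  "mobius a z = (a - z) / (1 - cnj a * z)"

end

theory Submission
  imports Defs "HOL-Complex_Analysis.Cauchy_Integral_Formula"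
begin

text \<open>Writing the variance of \<open>f\<close> under \<open>\<mu>\<^sub>z\<close> as half the double integral of \<open>|f(\<zeta>) - f(\<eta>)|\<^sup>2\<close> cancels the factor
  \<open>(1 - |z|\<^sup>2)\<^sup>2\<close>, and Tonelli turns the area integral into the double integral of
  \<open>|f(\<zeta>) - f(\<eta>)|\<^sup>2\<close> against \<open>G\<^sub>a(\<zeta>,\<eta>)\<close>, the integral over the disk of
  \<open>K(1 - |\<sigma>\<^sub>a(z)|\<^sup>2) / (|\<zeta> - z|\<^sup>2 |\<eta> - z|\<^sup>2)\<close>. The substitution \<open>z = \<sigma>\<^sub>a(w)\<close> reduces \<open>G\<^sub>a\<close> to \<open>a = 0\<close>, and
  the two conditions on \<open>\<phi>\<^sub>K\<close> show that \<open>G\<^sub>a(\<zeta>,\<eta>)\<close> is comparable to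
  \<open>K(|\<sigma>\<^sub>a(\<zeta>) - \<sigma>\<^sub>a(\<eta>)| / 2) / |\<zeta> - \<eta>|\<^sup>2\<close>. It remains to compare this energy with the arc integrals. An arc of
  length \<open>L\<close> is dominated by the point \<open>a\<close> above its centre with \<open>1 - |a| = L / (4\<pi>)\<close>. Conversely the
  circle is cut into dyadic rings around \<open>a / |a|\<close>: pairs in comparable rings at scale \<open>2^j (1 - |a|)\<close>
  contribute \<open>\<phi>\<^sub>K(C 2^(-j))\<close> times an arc integral, while pairs in distant rings are controlled by the mean
  oscillation of \<open>f\<close>, because \<open>K(t) \<ge> c t\<^sup>2\<close> makes the arc integrals dominate it. Both sums converge by the
  condition at 0.\<close>

section \<open>Area integrals in the complex plane\<close>

text \<open>The delicate point is the pairing of distant rings. Take \<open>x\<close> in the outer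
  ring \<open>k\<close> and \<open>y\<close> in a much deeper ring \<open>l\<close>. The weight
  there is at most a multiple of \<open>4^k * p (128 * (1/2)^(N - l))\<close>, and the rectangle of
  arcs has area of order \<open>2^-k * 2^-l\<close>. Their product decays like
  \<open>2^-(l - k)\<close>, so for fixed \<open>l\<close> the sum over \<open>k\<close> is
  geometric as long as the mean oscillation between the two arcs grows more slowly than
  \<open>2^(l - k)\<close>. What remains is a sum of \<open>p\<close> over dyadic points, with no
  dependence on \<open>a\<close>. The condition at infinity acts twice: since \<open>phiK\<close> is
  increasing, it forces linear growth and hence a lower bound for \<open>K\<close> near 0, and it
  makes the part of the disk far from the boundary, compared with |\<zeta> - \<eta>|, harmless in
  the kernel estimate. Since \<open>phiK\<close> compares \<open>K (s * t)\<close> with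
  \<open>K t\<close> only for \<open>t \<le> 1\<close>, arguments of \<open>K\<close> have to be
  normalised: chords of the circle by the diameter, which is where the division by 2 comes from, and
  chords of an arc by its length.\<close>

definition complex_of_vec :: "real^2 \<Rightarrow> complex" where
  "complex_of_vec v = Complex (v $ 1) (v $ 2)"

definition vec_of_complex :: "complex \<Rightarrow> real^2" where
  "vec_of_complex z = (\<chi> i. if i = 1 then Re z else Im z)"

lemma complex_of_vec_inverse [simp]:
  "complex_of_vec (vec_of_complex z) = z" "vec_of_complex (complex_of_vec v) = v"
  by (auto simp: complex_of_vec_def vec_of_complex_def vec_eq_iff forall_2)

lemma bounded_linear_complex_of_vec: "bounded_linear complex_of_vec"
proof (rule linear_conv_bounded_linear[THEN iffD1], rule linearI)
qed (auto simp: complex_of_vec_def complex_eq_iff)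

lemma bounded_linear_vec_of_complex: "bounded_linear vec_of_complex"
proof (rule linear_conv_bounded_linear[THEN iffD1], rule linearI)
qed (auto simp: vec_of_complex_def vec_eq_iff)

lemma measurable_complex_of_vec [measurable]: "complex_of_vec \<in> borel_measurable borel"
  using bounded_linear_complex_of_vec
  by (intro borel_measurable_continuous_onI) (simp add: linear_continuous_on)

text \<open>Lebesgue measure is determined by boxes, and boxes correspond to boxes of equal volume.
  The transfer is made because the Jacobian change of variables below is formulated for
  \<open>real^'n\<close>.\<close>

lemma distr_complex_of_vec: "distr lborel borel complex_of_vec = lborel"
proof (rule lborel_eqI[symmetric])
  fix l u :: complex assume le: "\<And>b. b \<in> Basis \<Longrightarrow> l \<bullet> b \<le> u \<bullet> b"
  have le': "Re l \<le> Re u" "Im l \<le> Im u"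
    using le[of 1] le[of \<i>] by (auto simp: Basis_complex_def inner_complex_def)
  have "complex_of_vec -` box l u = box (vec_of_complex l) (vec_of_complex u)"
    by (auto simp: box_def Basis_complex_def inner_complex_def complex_of_vec_def vec_of_complex_def
        Basis_vec_def inner_axis forall_2)
  moreover have "b \<in> Basis \<Longrightarrow> vec_of_complex l \<bullet> b \<le> vec_of_complex u \<bullet> b" for b
    using le' by (auto simp: Basis_vec_def inner_axis vec_of_complex_def)
  ultimately have "emeasure (distr lborel borel complex_of_vec) (box l u)
      = ennreal (\<Prod>b\<in>Basis. (vec_of_complex u - vec_of_complex l) \<bullet> b)"
    by (simp add: emeasure_distr emeasure_lborel_box)
  also have "(\<Prod>b\<in>Basis. (vec_of_complex u - vec_of_complex l) \<bullet> b) = (Re u - Re l) * (Im u - Im l)"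
  proof -
    have B: "(Basis :: (real^2) set) = {axis 1 1, axis 2 1}"
      by (auto simp: Basis_vec_def UNIV_2)
    have ne: "axis 1 1 \<noteq> (axis 2 1 :: real^2)"
      by (simp add: axis_eq_axis)
    show ?thesis
      unfolding B using ne by (simp add: inner_axis vec_of_complex_def)
  qed
  also have "\<dots> = (\<Prod>b\<in>Basis. (u - l) \<bullet> b)"
    by (simp add: Basis_complex_def inner_complex_def)
  finally show "emeasure (distr lborel borel complex_of_vec) (box l u) = (\<Prod>b\<in>Basis. (u - l) \<bullet> b)" .
qed simp

lemma nn_integral_complex_of_vec:
  assumes [measurable]: "F \<in> borel_measurable borel"
  shows "(\<integral>\<^sup>+z. F z \<partial>lborel) = (\<integral>\<^sup>+v. F (complex_of_vec v) \<partial>lborel)"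
  by (subst distr_complex_of_vec[symmetric], subst nn_integral_distr) auto

text \<open>The same comparison of boxes, now with a product of two lines; it serves to integrate
  over the disk along vertical slices.\<close>

lemma distr_Complex: "distr lborel borel (\<lambda>p. Complex (fst p) (snd p)) = lborel"
proof (rule lborel_eqI[symmetric])
  fix l u :: complex assume le: "\<And>b. b \<in> Basis \<Longrightarrow> l \<bullet> b \<le> u \<bullet> b"
  have le': "Re l \<le> Re u" "Im l \<le> Im u"
    using le[of 1] le[of \<i>] by (auto simp: Basis_complex_def inner_complex_def)
  have [measurable]: "(\<lambda>p. Complex (fst p) (snd p)) \<in> borel_measurable borel"
    by (intro borel_measurable_continuous_onI) (auto intro!: continuous_intros simp: Complex_eq)
  have "(\<lambda>p. Complex (fst p) (snd p)) -` box l u = box (Re l, Im l) (Re u, Im u)"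
    by (auto simp: box_def Basis_complex_def inner_complex_def Basis_prod_def)
  then have "emeasure (distr lborel borel (\<lambda>p. Complex (fst p) (snd p))) (box l u)
      = ennreal ((Re u - Re l) * (Im u - Im l))"
    using le'
    by (simp add: emeasure_distr)
       (subst emeasure_lborel_box, auto simp: Basis_prod_def)
  also have "(Re u - Re l) * (Im u - Im l) = (\<Prod>b\<in>Basis. (u - l) \<bullet> b)"
    by (simp add: Basis_complex_def inner_complex_def)
  finally show "emeasure (distr lborel borel (\<lambda>p. Complex (fst p) (snd p))) (box l u) = (\<Prod>b\<in>Basis. (u - l) \<bullet> b)" .
qed simp

lemma nn_integral_Complex:
  assumes [measurable]: "F \<in> borel_measurable borel"
  shows "(\<integral>\<^sup>+z. F z \<partial>lborel) = (\<integral>\<^sup>+x. \<integral>\<^sup>+y. F (Complex x y) \<partial>lborel \<partial>lborel)"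
proof -
  have [measurable]: "(\<lambda>p. Complex (fst p) (snd p)) \<in> borel_measurable borel"
    by (intro borel_measurable_continuous_onI) (auto intro!: continuous_intros simp: Complex_eq)
  have "(\<integral>\<^sup>+z. F z \<partial>lborel) = (\<integral>\<^sup>+p. F (Complex (fst p) (snd p)) \<partial>(lborel \<Otimes>\<^sub>M lborel))"
    by (subst distr_Complex[symmetric], subst nn_integral_distr) (auto simp: lborel_prod)
  also have "\<dots> = (\<integral>\<^sup>+x. \<integral>\<^sup>+y. F (Complex x y) \<partial>lborel \<partial>lborel)"
    by (subst lborel.nn_integral_fst[symmetric]) (auto simp: lborel_prod)
  finally show ?thesis .
qed

text \<open>Links two notions of integral: the change of variables speaks of absolute integrability
  and \<open>integral\<close>, everything else of Borel integrals with values in [0,\<infinity>].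
  The equivalence is what transports the value \<infinity>.\<close>

lemma nn_integral_lebesgue_absolutely_integrable:
  fixes h :: "'a::euclidean_space \<Rightarrow> real"
  assumes [measurable]: "h \<in> borel_measurable lborel" "S \<in> sets borel"
    and "\<And>x. 0 \<le> h x"
  shows "h absolutely_integrable_on S \<longleftrightarrow> (\<integral>\<^sup>+x\<in>S. ennreal (h x) \<partial>lborel) < \<infinity>"
    and "h absolutely_integrable_on S \<Longrightarrow>
      (\<integral>\<^sup>+x\<in>S. ennreal (h x) \<partial>lborel) = ennreal (integral S h)"
proof -
  have eq: "ennreal (norm (indicator S x *\<^sub>R h x)) = ennreal (h x) * indicator S x" for x
    using assms(3) by (auto simp: indicator_def)
  have m: "(\<lambda>x. indicator S x *\<^sub>R h x) \<in> borel_measurable lborel" by measurable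
  have "h absolutely_integrable_on S \<longleftrightarrow> integrable lborel (\<lambda>x. indicator S x *\<^sub>R h x)"
    unfolding set_integrable_def using m by (rule integrable_completion)
  also have "\<dots> \<longleftrightarrow> (\<integral>\<^sup>+x\<in>S. ennreal (h x) \<partial>lborel) < \<infinity>"
    using m unfolding integrable_iff_bounded eq by simp
  finally show iff: "h absolutely_integrable_on S \<longleftrightarrow> (\<integral>\<^sup>+x\<in>S. ennreal (h x) \<partial>lborel) < \<infinity>" .
  assume ai: "h absolutely_integrable_on S"
  then have int: "integrable lborel (\<lambda>x. indicator S x *\<^sub>R h x)"
    unfolding set_integrable_def using integrable_completion[OF m] by simp
  have "(\<integral>\<^sup>+x\<in>S. ennreal (h x) \<partial>lborel) = (\<integral>\<^sup>+x. ennreal (indicator S x *\<^sub>R h x) \<partial>lborel)"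
    by (intro nn_integral_cong) (auto simp: indicator_def)
  also have "\<dots> = ennreal (\<integral>x. indicator S x *\<^sub>R h x \<partial>lborel)"
    using assms(3) by (intro nn_integral_eq_integral int) (auto simp: indicator_def)
  also have "(\<integral>x. indicator S x *\<^sub>R h x \<partial>lborel) = (\<integral>x. indicator S x *\<^sub>R h x \<partial>lebesgue)"
    using m by (simp add: integral_completion)
  also have "\<dots> = integral S h"
    using set_lebesgue_integral_eq_integral(2)[OF ai] by (simp add: set_lebesgue_integral_def)
  finally show "(\<integral>\<^sup>+x\<in>S. ennreal (h x) \<partial>lborel) = ennreal (integral S h)" .
qed

lemma det_matrix_complex_mult:
  "det (matrix (\<lambda>v. vec_of_complex (c * complex_of_vec v))) = (cmod c)\<^sup>2"
  by (simp add: det_2 matrix_def vec_of_complex_def complex_of_vec_def axis_def cmod_power2)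
     (simp add: power2_eq_square)

text \<open>The real Jacobian determinant of a holomorphic map \<open>g\<close> is \<open>|g'|\<^sup>2\<close>.\<close>

lemma nn_integral_holomorphic_substitution:
  fixes g g' :: "complex \<Rightarrow> complex" and F :: "complex \<Rightarrow> real"
  assumes S: "open S" and gS: "open (g ` S)"
    and der: "\<And>z. z \<in> S \<Longrightarrow> (g has_field_derivative g' z) (at z)"
    and inj: "inj_on g S"
    and [measurable]: "F \<in> borel_measurable borel" "g \<in> borel_measurable borel" "g' \<in> borel_measurable borel"
    and F0: "\<And>z. 0 \<le> F z"
  shows "(\<integral>\<^sup>+z\<in>g ` S. ennreal (F z) \<partial>lborel) = (\<integral>\<^sup>+z\<in>S. ennreal (F (g z) * (cmod (g' z))\<^sup>2) \<partial>lborel)"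
proof -
  let ?T = complex_of_vec and ?U = vec_of_complex
  define S2 where "S2 = ?U ` S"
  define g2 where "g2 = (\<lambda>v. ?U (g (?T v)))"
  define g2' where "g2' = (\<lambda>v w. ?U (g' (?T v) * ?T w))"
  define f2 where "f2 = (\<lambda>v. F (?T v))"
  define h2 where "h2 = (\<lambda>v. F (g (?T v)) * (cmod (g' (?T v)))\<^sup>2)"
  have S2: "S2 = ?T -` S"
    unfolding S2_def by (auto simp: image_iff) (metis complex_of_vec_inverse(2))
  have contT: "continuous_on UNIV ?T"
    using bounded_linear_complex_of_vec by (simp add: linear_continuous_on)
  have openS2: "open S2"
    unfolding S2 using S contT by (simp add: open_vimage)
  have g2S2: "g2 ` S2 = ?T -` (g ` S)"
    unfolding S2_def g2_def by (auto simp: image_iff) (metis complex_of_vec_inverse(2))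
  have openg2S2: "open (g2 ` S2)"
    unfolding g2S2 using gS contT by (simp add: open_vimage)
  have der2: "(g2 has_derivative g2' v) (at v within S2)" if "v \<in> S2" for v
  proof -
    have "?T v \<in> S" using that S2 by auto
    from der[OF this] have "(g has_derivative (*) (g' (?T v))) (at (?T v))"
      by (simp add: has_field_derivative_def)
    from has_derivative_compose[OF bounded_linear.has_derivative[OF bounded_linear_complex_of_vec has_derivative_ident] this]
    have "((\<lambda>v. g (?T v)) has_derivative (\<lambda>w. g' (?T v) * ?T w)) (at v within S2)"
      by simp
    from bounded_linear.has_derivative[OF bounded_linear_vec_of_complex this]
    show ?thesis unfolding g2_def g2'_def .
  qed
  have inj2: "inj_on g2 S2"
    using inj unfolding S2 g2_def inj_on_def by (metis complex_of_vec_inverse vimageE)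
  have det2: "\<bar>det (matrix (g2' v))\<bar> = (cmod (g' (?T v)))\<^sup>2" for v
    unfolding g2'_def det_matrix_complex_mult by simp
  have "S2 \<in> sets lebesgue" using openS2 by simp
  \<comment> \<open>The integrand is vector valued in this theorem, hence the wrapping into
    \<open>real^1\<close>. Keeping \<open>b\<close> arbitrary yields both the equivalence of
    integrability and the equality of the values.\<close>
  note cov = has_absolute_integral_change_of_variables[OF this der2 inj2, of "\<lambda>v. vec (f2 v) :: real^1" "vec b" for b]
  have "h2 absolutely_integrable_on S2 \<and> integral S2 h2 = b \<longleftrightarrow>
        f2 absolutely_integrable_on (g2 ` S2) \<and> integral (g2 ` S2) f2 = b" for b
    using cov[of b] unfolding det2 
    by (simp add: absolutely_integrable_on_1_iff integral_on_1_eq h2_def f2_def g2_def mult.commute)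
  then have cov': "h2 absolutely_integrable_on S2 \<longleftrightarrow> f2 absolutely_integrable_on (g2 ` S2)"
    "h2 absolutely_integrable_on S2 \<Longrightarrow> integral S2 h2 = integral (g2 ` S2) f2"
    by auto
  have m: "f2 \<in> borel_measurable lborel" "h2 \<in> borel_measurable lborel"
    unfolding f2_def h2_def by measurable
  have pos: "0 \<le> f2 x" "0 \<le> h2 x" for x
    unfolding f2_def h2_def using F0 by auto
  have sets: "S2 \<in> sets borel" "g2 ` S2 \<in> sets borel" "S \<in> sets borel" "g ` S \<in> sets borel"
    using openS2 openg2S2 S gS by auto
  note [measurable] = sets
  note 1 = nn_integral_lebesgue_absolutely_integrable[OF m(1) sets(2) pos(1)]
  note 2 = nn_integral_lebesgue_absolutely_integrable[OF m(2) sets(1) pos(2)]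
  have eq: "(\<integral>\<^sup>+x\<in>g2 ` S2. ennreal (f2 x) \<partial>lborel) = (\<integral>\<^sup>+x\<in>S2. ennreal (h2 x) \<partial>lborel)"
  proof (cases "h2 absolutely_integrable_on S2")
    case True
    then show ?thesis using 1(2) 2(2) cov' by metis
  next
    \<comment> \<open>Neither function is integrable, so both integrals are \<infinity>.\<close>
    case False
    then show ?thesis using 1(1) 2(1) cov' by (metis infinity_ennreal_def top.not_eq_extremum)
  qed
  have "(\<integral>\<^sup>+z\<in>g ` S. ennreal (F z) \<partial>lborel) = (\<integral>\<^sup>+x\<in>g2 ` S2. ennreal (f2 x) \<partial>lborel)"
    by (subst nn_integral_complex_of_vec) (auto simp: g2S2 f2_def indicator_def intro!: nn_integral_cong)
  also note eq
  also have "(\<integral>\<^sup>+x\<in>S2. ennreal (h2 x) \<partial>lborel) = (\<integral>\<^sup>+z\<in>S. ennreal (F (g z) * (cmod (g' z))\<^sup>2) \<partial>lborel)"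
    by (subst nn_integral_complex_of_vec) (auto simp: S2 h2_def indicator_def intro!: nn_integral_cong)
  finally show ?thesis .
qed

section \<open>Variance with respect to Poisson measures\<close>

lemma poisson_kernel_nonneg: "cmod z < 1 \<Longrightarrow> 0 \<le> poisson_kernel z \<theta>"
  by (auto simp: poisson_kernel_def abs_square_le_1 intro!: divide_nonneg_nonneg)

lemma cis_diff_pos: "cmod z < 1 \<Longrightarrow> 0 < cmod (cis \<theta> - z)"
  by (metis norm_cis less_irrefl right_minus_eq zero_less_norm_iff)

lemma poisson_kernel_upper:
  assumes "cmod z < 1"
  shows "poisson_kernel z \<theta> \<le> 1 / (2 * pi * (1 - cmod z)\<^sup>2)"
proof -
  have "1 - cmod z \<le> cmod (cis \<theta> - z)"
    using norm_triangle_ineq2[of "cis \<theta>" z] by simp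
  then have "(1 - cmod z)\<^sup>2 \<le> (cmod (cis \<theta> - z))\<^sup>2"
    using assms by (intro power_mono) auto
  moreover have "0 < (1 - cmod z)\<^sup>2" using assms by simp
  ultimately show ?thesis
    unfolding poisson_kernel_def using assms by (intro frac_le mult_left_mono mult_pos_pos) auto
qed

lemma measurable_cis [measurable]: "cis \<in> borel_measurable borel"
  by (intro borel_measurable_continuous_onI continuous_intros)

lemma measurable_poisson_kernel [measurable]:
  assumes [measurable]: "g \<in> borel_measurable M" "h \<in> borel_measurable M"
  shows "(\<lambda>x. poisson_kernel (g x) (h x)) \<in> borel_measurable M"
  unfolding poisson_kernel_def by measurable

text \<open>Cauchy's formula at \<open>z\<close> for \<open>u \<mapsto> (1 - |z|\<^sup>2) / (1 - cnj z * u)\<close>, whose value at \<open>z\<close> is 1.\<close>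

lemma poisson_kernel_has_integral:
  assumes z: "cmod z < 1"
  shows "(poisson_kernel z has_integral 1) {0..2*pi}"
proof -
  define f where "f u = of_real (1 - (cmod z)\<^sup>2) / (1 - cnj z * u)" for u :: complex
  have ne: "1 - cnj z * u \<noteq> 0" if "cmod u \<le> 1" for u
  proof
    assume "1 - cnj z * u = 0"
    then have "cnj z * u = 1" by simp
    then have "cmod z * cmod u = 1" by (metis complex_mod_cnj norm_mult norm_one)
    moreover have "cmod z * cmod u \<le> cmod z" using that by (simp add: mult_left_le)
    ultimately show False using z by simp
  qed
  have "f holomorphic_on cball 0 1"
    unfolding f_def using ne by (intro holomorphic_intros) auto
  then have "((\<lambda>u. f u / (u - z)) has_contour_integral (2 * of_real pi * \<i> * f z)) (circlepath 0 1)"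
    using z by (intro Cauchy_integral_circlepath_simple) auto
  moreover have "f z = 1"
    using ne[of z] z by (simp add: f_def complex_norm_square[symmetric] mult.commute)
  ultimately have "((\<lambda>u. f u / (u - z)) has_contour_integral (2 * of_real pi * \<i>)) (circlepath 0 1)"
    by simp
  then have "((\<lambda>t. f (cis t) / (cis t - z) * \<i> * cis t) has_integral (2 * of_real pi * \<i>)) {0..2*pi}"
    unfolding circlepath_def by (subst (asm) has_contour_integral_part_circlepath_iff) auto
  from has_integral_divide[OF this, of "2 * of_real pi * \<i>"]
  have "((\<lambda>t. (f (cis t) / (cis t - z) * \<i> * cis t) / (2 * of_real pi * \<i>)) has_integral 1) {0..2*pi}"
    by simp
  moreover have "(f (cis t) / (cis t - z) * \<i> * cis t) / (2 * of_real pi * \<i>) = of_real (poisson_kernel z t)" for t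
  proof -
    have nz: "cis t - z \<noteq> 0" using cis_diff_pos[OF z, of t] by auto
    \<comment> \<open>On the circle the conjugate is the inverse. This turns the denominator of
      \<open>f\<close> into the conjugate of \<open>cis t - z\<close>, so that the Cauchy kernel
      becomes the Poisson kernel.\<close>
    have "cis t * (cis (-t) - cnj z) = 1 - cnj z * cis t"
      by (simp add: algebra_simps cis_mult)
    moreover have "cnj (cis t - z) = cis (-t) - cnj z"
      by (simp add: cis_cnj)
    ultimately have 1: "1 - cnj z * cis t = cis t * cnj (cis t - z)" by simp
    have "f (cis t) / (cis t - z) * cis t = of_real (1 - (cmod z)\<^sup>2) / ((cis t - z) * cnj (cis t - z))"
    proof -
      have "c / (w * cv) / v * w = c / (v * cv)" if "w \<noteq> 0" for c w v cv :: complex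
        using that by (simp add: field_simps)
      from this[OF cis_neq_zero] show ?thesis unfolding f_def 1 .
    qed
    then have 2: "f (cis t) / (cis t - z) * cis t = of_real (1 - (cmod z)\<^sup>2) / of_real ((cmod (cis t - z))\<^sup>2)"
      by (simp only: complex_norm_square)
    have "(f (cis t) / (cis t - z) * \<i> * cis t) / (2 * of_real pi * \<i>) = (f (cis t) / (cis t - z) * cis t) / (2 * of_real pi)"
      by simp
    then show ?thesis unfolding 2 poisson_kernel_def by simp
  qed
  ultimately have "((\<lambda>t. complex_of_real (poisson_kernel z t)) has_integral of_real 1) {0..2*pi}"
    by simp
  from has_integral_linear[OF this bounded_linear_Re] show ?thesis by (simp add: o_def)
qed

text \<open>Expand the square with the real inner product of the plane. Total mass 1 gives two
  copies of the second moment, and each variable of the cross term integrates to the mean. The left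
  side lives in [0,\<infinity>], ready for Tonelli.\<close>

lemma nn_integral_pair_variance:
  fixes F :: "'a \<Rightarrow> complex"
  assumes M1: "emeasure M (space M) = 1"
    and [measurable]: "F \<in> borel_measurable M"
    and int2: "integrable M (\<lambda>x. (cmod (F x))\<^sup>2)"
  shows "(\<integral>\<^sup>+x. \<integral>\<^sup>+y. ennreal ((cmod (F x - F y))\<^sup>2) \<partial>M \<partial>M)
    = ennreal (2 * ((\<integral>x. (cmod (F x))\<^sup>2 \<partial>M) - (cmod (\<integral>x. F x \<partial>M))\<^sup>2))"
proof -
  interpret finite_measure M by (rule finite_measureI) (simp add: M1)
  have prob_space: "measure M (space M) = 1" by (simp add: measure_def M1)
  define S where "S = (\<integral>x. (cmod (F x))\<^sup>2 \<partial>M)"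
  define m where "m = (\<integral>x. F x \<partial>M)"
  have intF: "integrable M F"
  proof (rule Bochner_Integration.integrable_bound)
    show "integrable M (\<lambda>x. 1 + (cmod (F x))\<^sup>2)" using int2 by simp
    have "cmod w \<le> 1 + (cmod w)\<^sup>2" for w
    proof -
      have "0 \<le> (cmod w - 1)\<^sup>2" by simp
      moreover have "0 \<le> (cmod w)" by simp
      ultimately show ?thesis by (simp add: power2_diff) (use \<open>0 \<le> cmod w\<close> in linarith)
    qed
    then show "AE x in M. cmod (F x) \<le> norm (1 + (cmod (F x))\<^sup>2)"
      by (intro AE_I2) (simp add: abs_of_nonneg add_nonneg_nonneg)
  qed simp
  have expand: "(cmod (a - b))\<^sup>2 = (cmod a)\<^sup>2 - 2 * (a \<bullet> b) + (cmod b)\<^sup>2" for a b :: complex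
    by (simp add: power2_norm_eq_inner algebra_simps inner_commute)
  have inner_int: "integrable M (\<lambda>y. w \<bullet> F y)" "integrable M (\<lambda>y. F y \<bullet> w)" for w
    using intF by (auto intro: integrable_inner_right integrable_inner_left)
  have 1: "(\<integral>\<^sup>+y. ennreal ((cmod (w - F y))\<^sup>2) \<partial>M) = ennreal ((cmod w)\<^sup>2 - 2 * (w \<bullet> m) + S)" for w
  proof -
    have "(\<integral>\<^sup>+y. ennreal ((cmod (w - F y))\<^sup>2) \<partial>M) = ennreal (\<integral>y. (cmod (w - F y))\<^sup>2 \<partial>M)"
    proof (intro nn_integral_eq_integral)
      show "integrable M (\<lambda>y. (cmod (w - F y))\<^sup>2)"
        unfolding expand using int2 inner_int by simp
    qed simp
    also have "(\<integral>y. (cmod (w - F y))\<^sup>2 \<partial>M) = (cmod w)\<^sup>2 - 2 * (w \<bullet> m) + S"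
      unfolding expand using int2 inner_int intF by (simp add: prob_space S_def m_def)
    finally show ?thesis .
  qed
  have nonneg: "0 \<le> (cmod w)\<^sup>2 - 2 * (w \<bullet> m) + S" for w
  proof -
    have "0 \<le> (\<integral>y. (cmod (w - F y))\<^sup>2 \<partial>M)" by simp
    also have "\<dots> = (cmod w)\<^sup>2 - 2 * (w \<bullet> m) + S"
      unfolding expand using int2 inner_int intF by (simp add: prob_space S_def m_def)
    finally show ?thesis .
  qed
  have "(\<integral>\<^sup>+x. \<integral>\<^sup>+y. ennreal ((cmod (F x - F y))\<^sup>2) \<partial>M \<partial>M)
      = ennreal (\<integral>x. (cmod (F x))\<^sup>2 - 2 * (F x \<bullet> m) + S \<partial>M)"
    unfolding 1 using int2 inner_int nonneg by (intro nn_integral_eq_integral) auto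
  also have "(\<integral>x. (cmod (F x))\<^sup>2 - 2 * (F x \<bullet> m) + S \<partial>M) = S - 2 * (m \<bullet> m) + S"
    using int2 inner_int intF by (simp add: prob_space S_def m_def)
  also have "\<dots> = 2 * (S - (cmod m)\<^sup>2)" by (simp add: power2_norm_eq_inner)
  finally show ?thesis unfolding S_def m_def .
qed

definition poisson_measure :: "complex \<Rightarrow> real measure" where
  "poisson_measure z = density lborel (\<lambda>\<theta>. ennreal (indicator {0..2*pi} \<theta> * poisson_kernel z \<theta>))"

text \<open>The integral 1 is known for the gauge integral; nonnegativity of the kernel makes it an
  absolutely convergent Lebesgue integral.\<close>

lemma emeasure_poisson_measure_space:
  assumes z: "cmod z < 1"
  shows "emeasure (poisson_measure z) (space (poisson_measure z)) = 1"
proof -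
  have 1: "poisson_kernel z absolutely_integrable_on {0..2*pi}"
    using poisson_kernel_has_integral[OF z] poisson_kernel_nonneg[OF z]
    by (intro nonnegative_absolutely_integrable_1) auto
  have "(\<integral>\<^sup>+\<theta>. ennreal (indicator {0..2*pi} \<theta> * poisson_kernel z \<theta>) \<partial>lborel)
     = ennreal (\<integral>\<theta>. indicator {0..2*pi} \<theta> * poisson_kernel z \<theta> \<partial>lebesgue)"
    using 1 poisson_kernel_nonneg[OF z] unfolding set_integrable_def
    by (subst nn_integral_completion[symmetric], intro nn_integral_eq_integral) auto
  also have "(\<integral>\<theta>. indicator {0..2*pi} \<theta> * poisson_kernel z \<theta> \<partial>lebesgue) = 1"
    using set_lebesgue_integral_eq_integral(2)[OF 1] poisson_kernel_has_integral[OF z]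
    by (simp add: set_lebesgue_integral_def integral_unique)
  finally show ?thesis
    by (simp add: poisson_measure_def emeasure_density cong: nn_integral_cong)
qed

text \<open>The pair variance for \<open>poisson_measure z\<close>. For fixed \<open>z\<close> the
  kernel is bounded, so a square integrable \<open>f\<close> has a finite second moment under this
  measure.\<close>

lemma poisson_variance:
  assumes z: "cmod z < 1" and L2: "circle_L2 f"
    and [measurable]: "(\<lambda>\<theta>. f (cis \<theta>)) \<in> borel_measurable borel"
  shows "ennreal (poisson_sq f z - (cmod (poisson_ext f z))\<^sup>2) = ennreal (1/2) *
    (\<integral>\<^sup>+\<theta>\<in>{0..2*pi}. \<integral>\<^sup>+\<eta>\<in>{0..2*pi}. ennreal (poisson_kernel z \<theta> * poisson_kernel z \<eta>
       * (cmod (f (cis \<theta>) - f (cis \<eta>)))\<^sup>2) \<partial>lborel \<partial>lborel)"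
proof -
  define F where "F = (\<lambda>\<theta>. f (cis \<theta>))"
  have [measurable]: "F \<in> borel_measurable borel" unfolding F_def by fact
  have L2': "integrable lborel (\<lambda>\<theta>. indicator {0..2*pi} \<theta> * (cmod (F \<theta>))\<^sup>2)"
    using L2 unfolding circle_L2_def set_integrable_def F_def by simp
  define C where "C = 1 / (2 * pi * (1 - cmod z)\<^sup>2)"
  have pos: "0 \<le> indicator {0..2*pi} \<theta> * poisson_kernel z \<theta>" for \<theta>
    using poisson_kernel_nonneg[OF z] by simp
  have "integrable lborel (\<lambda>\<theta>. (indicator {0..2*pi} \<theta> * poisson_kernel z \<theta>) * (cmod (F \<theta>))\<^sup>2)"
  proof (rule Bochner_Integration.integrable_bound)
    show "integrable lborel (\<lambda>\<theta>. C * (indicator {0..2*pi} \<theta> * (cmod (F \<theta>))\<^sup>2))"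
      using L2' by simp
    have "norm (indicator {0..2*pi} \<theta> * poisson_kernel z \<theta> * (cmod (F \<theta>))\<^sup>2)
        \<le> norm (C * (indicator {0..2*pi} \<theta> * (cmod (F \<theta>))\<^sup>2))" for \<theta>
    proof -
      have "poisson_kernel z \<theta> \<le> C" "0 \<le> poisson_kernel z \<theta>"
        using poisson_kernel_upper[OF z] poisson_kernel_nonneg[OF z] by (auto simp: C_def)
      then show ?thesis
        by (auto simp: indicator_def abs_mult intro!: mult_right_mono)
    qed
    then show "AE \<theta> in lborel. norm (indicator {0..2*pi} \<theta> * poisson_kernel z \<theta> * (cmod (F \<theta>))\<^sup>2)
        \<le> norm (C * (indicator {0..2*pi} \<theta> * (cmod (F \<theta>))\<^sup>2))" by simp
  qed measurable
  then have int: "integrable (poisson_measure z) (\<lambda>\<theta>. (cmod (F \<theta>))\<^sup>2)"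
    unfolding poisson_measure_def using pos
    by (subst integrable_density) auto
  have sq: "(\<integral>\<theta>. (cmod (F \<theta>))\<^sup>2 \<partial>poisson_measure z) = poisson_sq f z"
    unfolding poisson_measure_def poisson_sq_def set_lebesgue_integral_def F_def
    using pos by (subst integral_density) (auto simp: mult_ac)
  have ext: "(\<integral>\<theta>. F \<theta> \<partial>poisson_measure z) = poisson_ext f z"
    unfolding poisson_measure_def poisson_ext_def set_lebesgue_integral_def F_def
    using pos by (subst integral_density) auto
  have dens: "(\<integral>\<^sup>+\<theta>. h \<theta> \<partial>poisson_measure z)
     = (\<integral>\<^sup>+\<theta>. ennreal (indicator {0..2*pi} \<theta> * poisson_kernel z \<theta>) * h \<theta> \<partial>lborel)"
    if [measurable]: "h \<in> borel_measurable borel" for h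
    unfolding poisson_measure_def by (subst nn_integral_density) auto
  have "ennreal (2 * (poisson_sq f z - (cmod (poisson_ext f z))\<^sup>2))
    = (\<integral>\<^sup>+\<theta>. \<integral>\<^sup>+\<eta>. ennreal ((cmod (F \<theta> - F \<eta>))\<^sup>2) \<partial>poisson_measure z \<partial>poisson_measure z)"
    unfolding sq[symmetric] ext[symmetric]
    by (rule nn_integral_pair_variance[symmetric, OF emeasure_poisson_measure_space[OF z] _ int]) (simp add: poisson_measure_def)
  also have "\<dots> = (\<integral>\<^sup>+\<theta>. ennreal (indicator {0..2*pi} \<theta> * poisson_kernel z \<theta>) *
     (\<integral>\<^sup>+\<eta>. ennreal (indicator {0..2*pi} \<eta> * poisson_kernel z \<eta>) * ennreal ((cmod (F \<theta> - F \<eta>))\<^sup>2) \<partial>lborel) \<partial>lborel)"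
  proof (subst dens)
    show "(\<lambda>\<theta>. \<integral>\<^sup>+\<eta>. ennreal ((cmod (F \<theta> - F \<eta>))\<^sup>2) \<partial>poisson_measure z) \<in> borel_measurable borel"
      by (subst dens) simp_all
    show "(\<integral>\<^sup>+\<theta>. ennreal (indicator {0..2*pi} \<theta> * poisson_kernel z \<theta>) *
        (\<integral>\<^sup>+\<eta>. ennreal ((cmod (F \<theta> - F \<eta>))\<^sup>2) \<partial>poisson_measure z) \<partial>lborel) =
      (\<integral>\<^sup>+\<theta>. ennreal (indicator {0..2*pi} \<theta> * poisson_kernel z \<theta>) *
     (\<integral>\<^sup>+\<eta>. ennreal (indicator {0..2*pi} \<eta> * poisson_kernel z \<eta>) * ennreal ((cmod (F \<theta> - F \<eta>))\<^sup>2) \<partial>lborel) \<partial>lborel)"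
      by (intro nn_integral_cong arg_cong2[where f = "(*)"] dens refl) measurable
  qed
  also have "\<dots> = (\<integral>\<^sup>+\<theta>\<in>{0..2*pi}. \<integral>\<^sup>+\<eta>\<in>{0..2*pi}. ennreal (poisson_kernel z \<theta> * poisson_kernel z \<eta>
       * (cmod (F \<theta> - F \<eta>))\<^sup>2) \<partial>lborel \<partial>lborel)"
  proof (intro nn_integral_cong)
    fix \<theta>
    have "ennreal (indicator {0..2*pi} \<theta> * poisson_kernel z \<theta>) *
        (\<integral>\<^sup>+\<eta>. ennreal (indicator {0..2*pi} \<eta> * poisson_kernel z \<eta>) * ennreal ((cmod (F \<theta> - F \<eta>))\<^sup>2) \<partial>lborel)
      = (\<integral>\<^sup>+\<eta>. ennreal (indicator {0..2*pi} \<theta> * poisson_kernel z \<theta>) *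
        (ennreal (indicator {0..2*pi} \<eta> * poisson_kernel z \<eta>) * ennreal ((cmod (F \<theta> - F \<eta>))\<^sup>2)) \<partial>lborel)"
      by (rule nn_integral_cmult[symmetric]) measurable
    also have "\<dots> = (\<integral>\<^sup>+\<eta>. (ennreal (poisson_kernel z \<theta> * poisson_kernel z \<eta> * (cmod (F \<theta> - F \<eta>))\<^sup>2)
        * indicator {0..2*pi} \<eta>) * indicator {0..2*pi} \<theta> \<partial>lborel)"
      using poisson_kernel_nonneg[OF z]
      by (intro nn_integral_cong) (simp add: ennreal_mult mult.assoc split: split_indicator)
    also have "\<dots> = (\<integral>\<^sup>+\<eta>\<in>{0..2*pi}. ennreal (poisson_kernel z \<theta> * poisson_kernel z \<eta>
       * (cmod (F \<theta> - F \<eta>))\<^sup>2) \<partial>lborel) * indicator {0..2*pi} \<theta>"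
      by (rule nn_integral_multc) measurable
    finally show "ennreal (indicator {0..2*pi} \<theta> * poisson_kernel z \<theta>) *
        (\<integral>\<^sup>+\<eta>. ennreal (indicator {0..2*pi} \<eta> * poisson_kernel z \<eta>) * ennreal ((cmod (F \<theta> - F \<eta>))\<^sup>2) \<partial>lborel)
      = (\<integral>\<^sup>+\<eta>\<in>{0..2*pi}. ennreal (poisson_kernel z \<theta> * poisson_kernel z \<eta>
       * (cmod (F \<theta> - F \<eta>))\<^sup>2) \<partial>lborel) * indicator {0..2*pi} \<theta>" .
  qed
  finally have "ennreal (1/2) * ennreal (2 * (poisson_sq f z - (cmod (poisson_ext f z))\<^sup>2)) = ennreal (1/2) * \<dots>"
    by simp
  moreover have "ennreal (1/2) * ennreal (2 * x) = ennreal x" for x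
    by (subst ennreal_mult'[symmetric]) auto
  ultimately show ?thesis unfolding F_def by metis
qed

section \<open>Weights\<close>

text \<open>The normal form of the weight: increasing on the whole line, and positive at positive
  arguments so that the quotients in \<open>phiK\<close> have nonzero denominators. The theorem is
  reduced to it at the end.\<close>

locale QK_weight =
  fixes K :: "real \<Rightarrow> real"
  assumes mono: "mono K" and nonneg: "\<And>x. 0 \<le> K x" and pos: "\<And>x. 0 < x \<Longrightarrow> 0 < K x"
    and int0: "(\<integral>\<^sup>+ s\<in>{0<..1}. phiK K s / ennreal s \<partial>lborel) < \<infinity>"
    and int1: "(\<integral>\<^sup>+ s\<in>{1..}. phiK K s / ennreal (s\<^sup>2) \<partial>lborel) < \<infinity>"
begin

lemma measurable_K [measurable]: "K \<in> borel_measurable borel"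
  using mono by (rule borel_measurable_mono)

lemma phiK_mono: "s \<le> s' \<Longrightarrow> phiK K s \<le> phiK K s'"
  unfolding phiK_def
  by (intro SUP_subset_mono order_refl divide_right_mono_ennreal ennreal_leI monoD[OF mono] mult_right_mono) auto

text \<open>On \<open>{s..2 * s}\<close>, an interval of length \<open>s\<close>, monotonicity
  bounds the integrand from below by \<open>phiK K s / (2 * s)^2\<close>. The integral over this
  interval alone is therefore at least \<open>phiK K s / (4 * s)\<close>.\<close>

lemma phiK_le_linear:
  assumes "1 \<le> s"
  shows "phiK K s \<le> ennreal (4 * s) * (\<integral>\<^sup>+ s\<in>{1..}. phiK K s / ennreal (s\<^sup>2) \<partial>lborel)"
    (is "_ \<le> _ * ?I")
proof -
  have "phiK K s * ennreal (1 / (4 * s)) = (\<integral>\<^sup>+u\<in>{s..2 * s}. phiK K s * ennreal (1 / (2 * s)\<^sup>2) \<partial>lborel)"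
    using assms
    by (subst nn_integral_cmult_indicator) (auto simp: mult.assoc ennreal_mult'[symmetric] power2_eq_square)
  also have "\<dots> \<le> ?I"
  proof (intro nn_integral_mono)
    fix u
    show "phiK K s * ennreal (1 / (2 * s)\<^sup>2) * indicator {s..2 * s} u
        \<le> phiK K u / ennreal (u\<^sup>2) * indicator {1..} u"
    proof (cases "u \<in> {s..2 * s}")
      case True
      then have u: "s \<le> u" "u \<le> 2 * s" "1 \<le> u" using assms by auto
      then have "u\<^sup>2 \<le> (2 * s)\<^sup>2" by (intro power_mono) auto
      then have "1 / (2 * s)\<^sup>2 \<le> 1 / u\<^sup>2"
        using u by (intro divide_left_mono mult_pos_pos) auto
      then have "ennreal (1 / (2 * s)\<^sup>2) \<le> inverse (ennreal (u\<^sup>2))"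
        using u by (simp add: inverse_ennreal inverse_eq_divide ennreal_leI)
      then show ?thesis
        using u phiK_mono[OF u(1)]
        by (simp add: divide_ennreal_def mult_mono True)
    qed simp
  qed
  finally have "ennreal (4 * s) * (phiK K s * ennreal (1 / (4 * s))) \<le> ennreal (4 * s) * ?I"
    by (rule mult_left_mono) simp
  moreover have "ennreal (4 * s) * (phiK K s * ennreal (1 / (4 * s))) = phiK K s"
    using assms by (subst mult.left_commute, subst ennreal_mult'[symmetric]) auto
  ultimately show ?thesis by simp
qed

lemma phiK_finite: "phiK K s < \<infinity>"
proof -
  have "phiK K s \<le> phiK K (max 1 s)" by (rule phiK_mono) simp
  also have "\<dots> \<le> ennreal (4 * max 1 s) * (\<integral>\<^sup>+ s\<in>{1..}. phiK K s / ennreal (s\<^sup>2) \<partial>lborel)"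
    by (rule phiK_le_linear) simp
  also have "\<dots> < \<infinity>" using int1 by (simp add: ennreal_mult_less_top)
  finally show ?thesis .
qed

definition p :: "real \<Rightarrow> real" where "p s = enn2real (phiK K s)"

lemma phiK_eq: "phiK K s = ennreal (p s)"
  unfolding p_def using phiK_finite[of s] by (simp add: ennreal_enn2real)

lemma p_nonneg: "0 \<le> p s" by (simp add: p_def)

lemma p_mono: "s \<le> s' \<Longrightarrow> p s \<le> p s'"
  using phiK_mono[of s s'] p_nonneg by (simp add: phiK_eq)

lemma measurable_p [measurable]: "p \<in> borel_measurable borel"
  by (rule borel_measurable_mono) (simp add: mono_def p_mono)

text \<open>The basic comparison of \<open>K\<close> at two scales. The restriction on
  \<open>t\<close> is inherited from the supremum in \<open>phiK\<close>, and each later use has to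
  arrange for it.\<close>

lemma K_le_p:
  assumes "0 < t" "t \<le> 1" shows "K (s * t) \<le> p s * K t"
proof -
  have "ennreal (K (s * t)) / ennreal (K t) \<le> phiK K s"
    unfolding phiK_def using assms by (intro SUP_upper) auto
  then have "K (s * t) / K t \<le> p s"
    using nonneg[of "s * t"] pos[OF assms(1)] p_nonneg by (simp add: divide_ennreal phiK_eq)
  then show ?thesis using pos[OF assms(1)] by (simp add: field_simps)
qed

text \<open>For \<open>s \<le> 1\<close> the point \<open>s * t\<close> stays in the range of the
  supremum, so the comparison of scales can be applied twice.\<close>

lemma p_submult: assumes "0 < s" "s \<le> 1" shows "p (c * s) \<le> p c * p s"
proof -
  have "ennreal (K (c * s * t)) / ennreal (K t) \<le> ennreal (p c * p s)" if "0 < t" "t \<le> 1" for t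
  proof -
    have st: "0 < s * t" "s * t \<le> 1" using assms that by (auto intro: mult_le_one)
    have "K (c * (s * t)) \<le> p c * K (s * t)" using st by (rule K_le_p)
    also have "\<dots> \<le> p c * (p s * K t)" using K_le_p[OF that] p_nonneg by (intro mult_left_mono)
    finally have "K (c * s * t) / K t \<le> p c * p s"
      using pos[OF that(1)] by (simp add: field_simps)
    then show ?thesis
      using nonneg[of "c * s * t"] pos[OF that(1)] p_nonneg by (simp add: divide_ennreal)
  qed
  then have "phiK K (c * s) \<le> ennreal (p c * p s)"
    unfolding phiK_def by (intro SUP_least) auto
  then show ?thesis using p_nonneg by (simp add: phiK_eq)
qed

lemma p_int0: "(\<integral>\<^sup>+ s\<in>{0<..1}. ennreal (p s / s) \<partial>lborel) < \<infinity>"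
proof -
  have "(\<integral>\<^sup>+ s\<in>{0<..1}. ennreal (p s / s) \<partial>lborel) = (\<integral>\<^sup>+ s\<in>{0<..1}. phiK K s / ennreal s \<partial>lborel)"
    using p_nonneg by (intro nn_integral_cong) (auto simp: phiK_eq divide_ennreal split: split_indicator)
  then show ?thesis using int0 by simp
qed

lemma p_int1: "(\<integral>\<^sup>+ s\<in>{1..}. ennreal (p s / s\<^sup>2) \<partial>lborel) < \<infinity>"
proof -
  have "(\<integral>\<^sup>+ s\<in>{1..}. ennreal (p s / s\<^sup>2) \<partial>lborel) = (\<integral>\<^sup>+ s\<in>{1..}. phiK K s / ennreal (s\<^sup>2) \<partial>lborel)"
    using p_nonneg by (intro nn_integral_cong) (auto simp: phiK_eq divide_ennreal split: split_indicator)
  then show ?thesis using int1 by simp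
qed

lemma p_le_linear: "\<exists>C>0. \<forall>s\<ge>1. p s \<le> C * s"
proof -
  define C where "C = 4 * enn2real (\<integral>\<^sup>+ s\<in>{1..}. phiK K s / ennreal (s\<^sup>2) \<partial>lborel)"
  have "p s \<le> (C + 1) * s" if "1 \<le> s" for s
  proof -
    have "ennreal (p s) \<le> ennreal (C * s)"
      using phiK_le_linear[OF that] int1 that
      by (simp add: C_def phiK_eq ennreal_mult ennreal_enn2real mult_ac)
    then have "p s \<le> C * s" using that by (subst (asm) ennreal_le_iff) (auto simp: C_def)
    then show ?thesis using that by (simp add: algebra_simps)
  qed
  moreover have "0 < C + 1" by (simp add: C_def add_nonneg_pos)
  ultimately show ?thesis by blast
qed

text \<open>Compare \<open>K 1\<close> with \<open>K t\<close> through \<open>p (1 / t)\<close>,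
  which is at most a multiple of \<open>1 / t\<close>. This gives a linear lower bound; it is
  relaxed to a square, the power that cancels the squared chord in the arc integrals.\<close>

lemma K_ge_square: "\<exists>c>0. \<forall>t. 0 < t \<longrightarrow> t \<le> 1 \<longrightarrow> c * t\<^sup>2 \<le> K t"
proof -
  obtain C where C: "C > 0" "\<And>s. 1 \<le> s \<Longrightarrow> p s \<le> C * s" using p_le_linear by blast
  have "K 1 / C * t\<^sup>2 \<le> K t" if t: "0 < t" "t \<le> 1" for t
  proof -
    have "K 1 \<le> p (1 / t) * K t" using K_le_p[OF t, of "1 / t"] t by simp
    also have "\<dots> \<le> C * (1 / t) * K t"
      using C(2)[of "1 / t"] t nonneg by (intro mult_right_mono) auto
    finally have "K 1 / C * t \<le> K t" using t C(1) by (simp add: field_simps)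
    moreover have "K 1 / C * t\<^sup>2 \<le> K 1 / C * t"
      using t C(1) nonneg[of 1] by (intro mult_left_mono) (auto simp: power2_eq_square mult_left_le)
    ultimately show ?thesis by simp
  qed
  then show ?thesis using pos[of 1] C(1) by (intro exI[of _ "K 1 / C"]) auto
qed

text \<open>Since \<open>p\<close> is increasing, its value at \<open>(1/2)^j\<close> is at most
  twice the integral of \<open>p s / s\<close> over the dyadic interval to the right of that point.
  For \<open>j \<ge> 1\<close> these intervals are disjoint and lie in (0,1]. The term
  \<open>j = 0\<close> is added separately, and \<open>p_submult\<close> extracts
  \<open>c\<close>.\<close>

lemma p_dyadic_sum:
  "\<exists>B\<ge>0. \<forall>N. (\<Sum>j\<le>N. p (c * (1/2) ^ j)) \<le> B"
proof -
  define I where "I = (\<integral>\<^sup>+ s\<in>{0<..1}. ennreal (p s / s) \<partial>lborel)"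
  have "ennreal (\<Sum>j=1..N. p ((1/2) ^ j)) \<le> ennreal 2 * (\<integral>\<^sup>+ s\<in>{(1/2)^N<..1}. ennreal (p s / s) \<partial>lborel)" for N
  proof (induction N)
    case (Suc N)
    let ?a = "(1/2::real) ^ Suc N"
    have a: "0 < ?a" "2 * ?a = (1/2) ^ N" "2 * ?a \<le> 1" by (auto simp: power_le_one)
    have "ennreal (p ?a) = ennreal 2 * (\<integral>\<^sup>+ s\<in>{?a<..2 * ?a}. ennreal (p ?a / (2 * ?a)) \<partial>lborel)"
      using a(1) p_nonneg by (subst nn_integral_cmult_indicator) (auto simp: ennreal_mult'[symmetric] simp del: ennreal_numeral)
    also have "\<dots> \<le> ennreal 2 * (\<integral>\<^sup>+ s\<in>{?a<..2 * ?a}. ennreal (p s / s) \<partial>lborel)"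
      using a(1) p_nonneg
      by (intro mult_left_mono nn_integral_mono)
         (auto intro!: ennreal_leI frac_le p_mono split: split_indicator)
    finally have "ennreal (\<Sum>j=1..Suc N. p ((1/2) ^ j))
      \<le> ennreal 2 * (\<integral>\<^sup>+ s\<in>{(1/2)^N<..1}. ennreal (p s / s) \<partial>lborel)
        + ennreal 2 * (\<integral>\<^sup>+ s\<in>{?a<..2 * ?a}. ennreal (p s / s) \<partial>lborel)"
      using Suc by (simp add: sum_nonneg p_nonneg add_mono)
    also have "\<dots> = ennreal 2 * (\<integral>\<^sup>+ s. ennreal (p s / s) * indicator {(1/2)^N<..1} s
        + ennreal (p s / s) * indicator {?a<..2 * ?a} s \<partial>lborel)"
      by (subst nn_integral_add) (auto simp: distrib_left)
    also have "\<dots> = ennreal 2 * (\<integral>\<^sup>+ s\<in>{?a<..1}. ennreal (p s / s) \<partial>lborel)"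
    proof (intro arg_cong2[where f = "(*)"] nn_integral_cong refl)
      have "x * indicator {b<..1} s + x * indicator {a<..b} s = x * indicator {a<..1} s"
        if "a \<le> b" "b \<le> 1" for a b s :: real and x :: ennreal
        using that by (auto split: split_indicator)
      from this[of ?a "(1/2) ^ N"]
      show "ennreal (p s / s) * indicator {(1/2)^N<..1} s + ennreal (p s / s) * indicator {?a<..2 * ?a} s
          = ennreal (p s / s) * indicator {?a<..1} s" for s
        unfolding a(2) using a by simp
    qed
    finally show ?case .
  qed simp
  also have "\<dots> N \<le> ennreal 2 * I" for N
    unfolding I_def by (intro mult_left_mono nn_integral_mono) 
      (auto intro: order_less_trans[rotated] split: split_indicator)
  finally have 1: "ennreal (\<Sum>j=1..N. p ((1/2) ^ j)) \<le> ennreal 2 * I" for N .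
  have 2: "(\<Sum>j=1..N. p ((1/2) ^ j)) \<le> 2 * enn2real I" for N
  proof -
    have "ennreal 2 * I = ennreal (2 * enn2real I)"
      using p_int0 by (simp add: I_def ennreal_mult ennreal_enn2real)
    then show ?thesis using 1[of N] by (simp add: sum_nonneg p_nonneg)
  qed
  have "(\<Sum>j\<le>N. p (c * (1/2) ^ j)) \<le> p c * (p 1 + 2 * enn2real I)" for N
  proof -
    have "(\<Sum>j\<le>N. p (c * (1/2) ^ j)) \<le> (\<Sum>j\<le>N. p c * p ((1/2) ^ j))"
      by (intro sum_mono p_submult) (auto simp: power_le_one)
    also have "\<dots> = p c * (p 1 + (\<Sum>j=1..N. p ((1/2) ^ j)))"
      by (simp add: sum_distrib_left[symmetric] atMost_atLeast0 sum.atLeast_Suc_atMost)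
    also have "\<dots> \<le> p c * (p 1 + 2 * enn2real I)"
      using 2 p_nonneg by (intro mult_left_mono add_mono) auto
    finally show ?thesis .
  qed
  moreover have "0 \<le> p c * (p 1 + 2 * enn2real I)" using p_nonneg by (intro mult_nonneg_nonneg add_nonneg_nonneg) auto
  ultimately show ?thesis by blast
qed

end

section \<open>The disk kernel\<close>

lemma one_minus_cnj_mult_ne_0:
  assumes "cmod a < 1" "cmod z \<le> 1" shows "1 - cnj a * z \<noteq> 0"
proof
  assume "1 - cnj a * z = 0"
  then have "cmod a * cmod z = 1"
    by (metis complex_mod_cnj norm_mult norm_one eq_iff_diff_eq_0)
  moreover have "cmod a * cmod z \<le> cmod a" using assms by (simp add: mult_left_le)
  ultimately show False using assms by simp
qed

lemma one_minus_norm_sq_ne_0: "cmod a < 1 \<Longrightarrow> 1 - a * cnj a \<noteq> 0"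
  using one_minus_cnj_mult_ne_0[of a a] by (simp add: mult.commute)

lemma measurable_mobius [measurable]: "mobius a \<in> borel_measurable borel"
  unfolding mobius_def by measurable

lemma mobius_involution:
  assumes "cmod a < 1" "1 - cnj a * z \<noteq> 0" shows "mobius a (mobius a z) = z"
proof -
  have 1: "1 - cnj a * mobius a z = (1 - a * cnj a) / (1 - cnj a * z)"
    using assms(2) unfolding mobius_def by (simp add: field_simps)
  have 2: "a - mobius a z = z * (1 - a * cnj a) / (1 - cnj a * z)"
    using assms(2) unfolding mobius_def by (simp add: field_simps)
  have "mobius a (mobius a z) = (a - mobius a z) / (1 - cnj a * mobius a z)"
    by (simp add: mobius_def)
  then show ?thesis
    unfolding 1 2 using assms(2) one_minus_norm_sq_ne_0[OF assms(1)] by simp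
qed

lemma one_minus_norm_mobius_sq:
  assumes "1 - cnj a * z \<noteq> 0"
  shows "1 - (cmod (mobius a z))\<^sup>2 = (1 - (cmod a)\<^sup>2) * (1 - (cmod z)\<^sup>2) / (cmod (1 - cnj a * z))\<^sup>2"
proof -
  have "(cmod (1 - cnj a * z))\<^sup>2 - (cmod (a - z))\<^sup>2 = (1 - (cmod a)\<^sup>2) * (1 - (cmod z)\<^sup>2)"
    unfolding cmod_power2 by (simp add: power2_eq_square algebra_simps)
  then show ?thesis
    using assms unfolding mobius_def by (simp add: norm_divide power_divide field_simps)
qed

lemma cmod_mobius_less_1: "cmod a < 1 \<Longrightarrow> cmod z < 1 \<Longrightarrow> cmod (mobius a z) < 1"
proof -
  assume a: "cmod a < 1" "cmod z < 1"
  have "0 < 1 - (cmod (mobius a z))\<^sup>2"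
    using a one_minus_cnj_mult_ne_0[of a z]
    by (subst one_minus_norm_mobius_sq) (auto intro!: divide_pos_pos mult_pos_pos simp: abs_square_less_1)
  then show ?thesis by (simp add: abs_square_less_1)
qed

lemma cmod_mobius_eq_1: "cmod a < 1 \<Longrightarrow> cmod z = 1 \<Longrightarrow> cmod (mobius a z) = 1"
  using one_minus_norm_mobius_sq[of a z] one_minus_cnj_mult_ne_0[of a z]
  by (simp add: abs_square_eq_1)

text \<open>After clearing denominators the numerator factors as
  \<open>(1 - a * cnj a) * (w - z)\<close>. Distances, chords and the Jacobian are thus all
  expressed by the same quantities, which is why they cancel below.\<close>

lemma cmod_mobius_diff:
  assumes "1 - cnj a * z \<noteq> 0" "1 - cnj a * w \<noteq> 0" "cmod a < 1"
  shows "cmod (mobius a z - mobius a w)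
    = (1 - (cmod a)\<^sup>2) * cmod (z - w) / (cmod (1 - cnj a * z) * cmod (1 - cnj a * w))"
proof -
  have "mobius a z - mobius a w
    = ((a - z) * (1 - cnj a * w) - (a - w) * (1 - cnj a * z)) / ((1 - cnj a * z) * (1 - cnj a * w))"
    using assms unfolding mobius_def by (simp add: diff_frac_eq)
  also have "(a - z) * (1 - cnj a * w) - (a - w) * (1 - cnj a * z) = (1 - a * cnj a) * (w - z)"
    by (simp add: algebra_simps)
  also have "1 - a * cnj a = of_real (1 - (cmod a)\<^sup>2)"
    by (simp only: of_real_diff of_real_1 complex_norm_square)
  finally have "cmod (mobius a z - mobius a w)
    = \<bar>1 - (cmod a)\<^sup>2\<bar> * cmod (w - z) / (cmod (1 - cnj a * z) * cmod (1 - cnj a * w))"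
    by (simp only: norm_mult norm_divide norm_of_real)
  moreover have "0 \<le> 1 - (cmod a)\<^sup>2" using assms(3) by (simp add: abs_square_le_1)
  ultimately show ?thesis by (simp add: norm_minus_commute)
qed

lemma mobius_has_field_derivative:
  assumes "1 - cnj a * z \<noteq> 0"
  shows "(mobius a has_field_derivative (- (1 - a * cnj a) / (1 - cnj a * z)\<^sup>2)) (at z)"
proof -
  have "((\<lambda>z. (a - z) / (1 - cnj a * z)) has_field_derivative
     ((-1) * (1 - cnj a * z) - (a - z) * (- cnj a)) / ((1 - cnj a * z) * (1 - cnj a * z))) (at z)"
    using assms by (auto intro!: derivative_eq_intros)
  then show ?thesis
    unfolding mobius_def by (simp add: power2_eq_square algebra_simps)
qed

lemma mobius_image_ball:
  assumes a: "cmod a < 1" shows "mobius a ` ball 0 1 = ball 0 1"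
proof
  show "mobius a ` ball 0 1 \<subseteq> ball 0 1" using cmod_mobius_less_1[OF a] by auto
  show "ball 0 1 \<subseteq> mobius a ` ball 0 1"
  proof
    fix z :: complex assume "z \<in> ball 0 1"
    then have z: "cmod z < 1" by simp
    have "z = mobius a (mobius a z)"
      using z by (intro mobius_involution[symmetric] a one_minus_cnj_mult_ne_0) auto
    then show "z \<in> mobius a ` ball 0 1"
      using cmod_mobius_less_1[OF a z] by (intro image_eqI) auto
  qed
qed

lemma inj_on_mobius:
  assumes a: "cmod a < 1" shows "inj_on (mobius a) (ball 0 1)"
proof (rule inj_on_inverseI)
  fix z :: complex assume "z \<in> ball 0 1"
  then show "mobius a (mobius a z) = z"
    by (intro mobius_involution a one_minus_cnj_mult_ne_0) auto
qed

definition disk_kernel :: "(real \<Rightarrow> real) \<Rightarrow> complex \<Rightarrow> complex \<Rightarrow> complex \<Rightarrow> ennreal" where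
  "disk_kernel K a u v = (\<integral>\<^sup>+z\<in>ball 0 1. ennreal (K (1 - (cmod (mobius a z))\<^sup>2)
     / ((cmod (u - z))\<^sup>2 * (cmod (v - z))\<^sup>2)) \<partial>lborel)"

text \<open>Conformal invariance: the substitution \<open>z = mobius a w\<close> removes \<open>a\<close> from the kernel.\<close>

lemma disk_kernel_mobius:
  assumes a: "cmod a < 1" and u: "cmod u = 1" and v: "cmod v = 1" and uv: "u \<noteq> v"
    and [measurable]: "K \<in> borel_measurable borel" and K0: "\<And>x. 0 \<le> K x"
  shows "disk_kernel K a u v = ennreal ((cmod (mobius a u - mobius a v))\<^sup>2 / (cmod (u - v))\<^sup>2)
    * (\<integral>\<^sup>+w\<in>ball 0 1. ennreal (K (1 - (cmod w)\<^sup>2)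
     / ((cmod (mobius a u - w))\<^sup>2 * (cmod (mobius a v - w))\<^sup>2)) \<partial>lborel)"
proof -
  let ?h = "1 - (cmod a)\<^sup>2"
  have h: "?h > 0" using a by (simp add: abs_square_less_1)
  define F where "F z = K (1 - (cmod (mobius a z))\<^sup>2) / ((cmod (u - z))\<^sup>2 * (cmod (v - z))\<^sup>2)" for z
  define u' v' where "u' = mobius a u" and "v' = mobius a v"
  have u': "cmod u' = 1" "mobius a u' = u" and v': "cmod v' = 1" "mobius a v' = v"
    unfolding u'_def v'_def using u v
    by (simp_all only: cmod_mobius_eq_1[OF a] mobius_involution[OF a one_minus_cnj_mult_ne_0[OF a]] order_refl)
  have [measurable]: "F \<in> borel_measurable borel" unfolding F_def by measurable
  have [measurable]: "ball (0::complex) 1 \<in> sets borel" by simp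
  have ne: "1 - cnj a * w \<noteq> 0" if "cmod w \<le> 1" for w
    using one_minus_cnj_mult_ne_0[OF a that] .
  have "disk_kernel K a u v = (\<integral>\<^sup>+z\<in>mobius a ` ball 0 1. ennreal (F z) \<partial>lborel)"
    unfolding disk_kernel_def F_def mobius_image_ball[OF a] ..
  also have "\<dots> = (\<integral>\<^sup>+w\<in>ball 0 1. ennreal (F (mobius a w)
      * (cmod (- (1 - a * cnj a) / (1 - cnj a * w)\<^sup>2))\<^sup>2) \<partial>lborel)"
  proof (rule nn_integral_holomorphic_substitution)
    show "open (mobius a ` ball 0 1)" unfolding mobius_image_ball[OF a] by simp
    show "inj_on (mobius a) (ball 0 1)" by (rule inj_on_mobius[OF a])
    show "\<And>z. z \<in> ball 0 1 \<Longrightarrow> (mobius a has_field_derivative - (1 - a * cnj a) / (1 - cnj a * z)\<^sup>2) (at z)"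
      by (rule mobius_has_field_derivative[OF ne]) simp
    show "\<And>z. 0 \<le> F z" unfolding F_def using K0 by auto
  qed simp_all
  also have "\<dots> = (\<integral>\<^sup>+w\<in>ball 0 1. ennreal ((cmod (u' - v'))\<^sup>2 / (cmod (u - v))\<^sup>2
      * (K (1 - (cmod w)\<^sup>2) / ((cmod (u' - w))\<^sup>2 * (cmod (v' - w))\<^sup>2))) \<partial>lborel)"
  proof (intro nn_integral_cong)
    fix w :: complex
    have "F (mobius a w) * (cmod (- (1 - a * cnj a) / (1 - cnj a * w)\<^sup>2))\<^sup>2 =
      (cmod (u' - v'))\<^sup>2 / (cmod (u - v))\<^sup>2 * (K (1 - (cmod w)\<^sup>2) / ((cmod (u' - w))\<^sup>2 * (cmod (v' - w))\<^sup>2))"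
      if w: "w \<in> ball 0 1"
    proof -
      let ?A = "cmod (1 - cnj a * u')" and ?B = "cmod (1 - cnj a * v')" and ?C = "cmod (1 - cnj a * w)"
      have w: "cmod w < 1" using w by simp
      have pos: "?A > 0" "?B > 0" "?C > 0" using ne[of u'] ne[of v'] ne[of w] u' v' w by auto
      have ww: "mobius a (mobius a w) = w" using w ne by (intro mobius_involution[OF a]) auto
      \<comment> \<open>Since \<open>mobius a\<close> is an involution, \<open>u\<close> and
        \<open>v\<close> are the images of \<open>u'\<close> and \<open>v'\<close>, so all three
        distances are differences of images.\<close>
      have e1: "cmod (u - mobius a w) = ?h * cmod (u' - w) / (?A * ?C)"
        using cmod_mobius_diff[of a u' w] ne[of u'] ne[of w] u' w a by auto
      have e2: "cmod (v - mobius a w) = ?h * cmod (v' - w) / (?B * ?C)"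
        using cmod_mobius_diff[of a v' w] ne[of v'] ne[of w] v' w a by auto
      have e3: "cmod (u - v) = ?h * cmod (u' - v') / (?A * ?B)"
        using cmod_mobius_diff[of a u' v'] ne[of u'] ne[of v'] u' v' a by auto
      have "1 - a * cnj a = of_real ?h" by (simp only: of_real_diff of_real_1 complex_norm_square)
      then have "cmod (- (1 - a * cnj a)) = ?h"
        using h by (metis abs_of_pos norm_minus_cancel norm_of_real)
      then have e4: "cmod (- (1 - a * cnj a) / (1 - cnj a * w)\<^sup>2) = ?h / ?C\<^sup>2"
        by (simp only: norm_divide norm_power)
      have nz: "cmod (u' - v') > 0" "cmod (u' - w) > 0" "cmod (v' - w) > 0"
        using u' v' w uv by auto
      \<comment> \<open>The Jacobian cancels the powers of \<open>C\<close>. What remains is the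
        squared ratio of the chords after and before the transformation.\<close>
      have alg: "k / ((h * p / (A * C))\<^sup>2 * (h * q / (B * C))\<^sup>2) * (h / C\<^sup>2)\<^sup>2
          = d\<^sup>2 / (h * d / (A * B))\<^sup>2 * (k / (p\<^sup>2 * q\<^sup>2))"
        if "h > 0" "A > 0" "B > 0" "C > 0" "d > 0" "p > 0" "q > 0" for h A B C d p q k :: real
        using that by (simp add: field_simps power2_eq_square)
      show ?thesis
        unfolding F_def ww e1 e2 e3 e4 by (rule alg) (use pos nz h in auto)
    qed
    then show "ennreal (F (mobius a w) * (cmod (- (1 - a * cnj a) / (1 - cnj a * w)\<^sup>2))\<^sup>2) * indicator (ball 0 1) w =
      ennreal ((cmod (u' - v'))\<^sup>2 / (cmod (u - v))\<^sup>2 * (K (1 - (cmod w)\<^sup>2) / ((cmod (u' - w))\<^sup>2 * (cmod (v' - w))\<^sup>2))) * indicator (ball 0 1) w"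
      by (simp split: split_indicator)
  qed
  also have "\<dots> = ennreal ((cmod (u' - v'))\<^sup>2 / (cmod (u - v))\<^sup>2)
    * (\<integral>\<^sup>+w\<in>ball 0 1. ennreal (K (1 - (cmod w)\<^sup>2) / ((cmod (u' - w))\<^sup>2 * (cmod (v' - w))\<^sup>2)) \<partial>lborel)"
  proof (subst nn_integral_cmult[symmetric])
    show "(\<integral>\<^sup>+w\<in>ball 0 1. ennreal ((cmod (u' - v'))\<^sup>2 / (cmod (u - v))\<^sup>2
      * (K (1 - (cmod w)\<^sup>2) / ((cmod (u' - w))\<^sup>2 * (cmod (v' - w))\<^sup>2))) \<partial>lborel)
      = (\<integral>\<^sup>+w. ennreal ((cmod (u' - v'))\<^sup>2 / (cmod (u - v))\<^sup>2) *
        (ennreal (K (1 - (cmod w)\<^sup>2) / ((cmod (u' - w))\<^sup>2 * (cmod (v' - w))\<^sup>2)) * indicator (ball 0 1) w) \<partial>lborel)"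
      by (intro nn_integral_cong) (subst ennreal_mult, auto simp: K0 mult.assoc)
  qed measurable
  finally show ?thesis unfolding u'_def v'_def .
qed

section \<open>Two-sided bounds for the disk kernel\<close>

lemma nn_integral_inverse_add_square_le:
  fixes u :: real
  assumes u: "0 < u"
  shows "(\<integral>\<^sup>+y. ennreal (1 / (u\<^sup>2 + y\<^sup>2)) \<partial>lborel) \<le> ennreal (pi / u)"
proof -
  let ?f = "\<lambda>y. 1 / (u\<^sup>2 + y\<^sup>2)"
  have half: "(\<integral>\<^sup>+y. ennreal (?f y) * indicator {0..} y \<partial>lborel) = ennreal (pi / 2 / u)"
  proof -
    have "(\<integral>\<^sup>+y. ennreal (?f y) * indicator {0..} y \<partial>lborel) = ennreal (pi / 2 / u - arctan (0 / u) / u)"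
    proof (rule nn_integral_FTC_atLeast)
      fix y :: real
      have "((\<lambda>y. arctan (y / u) / u) has_real_derivative inverse (1 + (y / u)\<^sup>2) * (1 / u) / u) (at y)"
        using u by (auto intro!: derivative_eq_intros)
      moreover have "inverse (1 + (y / u)\<^sup>2) * (1 / u) / u = ?f y"
      proof -
        have "1 + (y / u)\<^sup>2 = (u\<^sup>2 + y\<^sup>2) / u\<^sup>2" using u by (simp add: power_divide add_divide_distrib)
        then show ?thesis using u by (simp add: power2_eq_square)
      qed
      ultimately show "((\<lambda>y. arctan (y / u) / u) has_real_derivative ?f y) (at y)" by simp
      have "filterlim (\<lambda>y. y / u) at_top at_top"
        using u by (auto simp: divide_inverse intro!: filterlim_at_top_mult_tendsto_pos filterlim_ident tendsto_const)
      then have "((\<lambda>y. arctan (y / u)) \<longlongrightarrow> pi / 2) at_top"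
        by (rule filterlim_compose[OF tendsto_arctan_at_top])
      then show "((\<lambda>y. arctan (y / u) / u) \<longlongrightarrow> pi / 2 / u) at_top"
        using u by (intro tendsto_divide tendsto_const) auto
    qed (use u in auto)
    then show ?thesis by simp
  qed
  \<comment> \<open>The closed half-lines share the point 0, hence an inequality; by evenness they
    contribute equally.\<close>
  have "(\<integral>\<^sup>+y. ennreal (?f y) \<partial>lborel)
      \<le> (\<integral>\<^sup>+y. ennreal (?f y) * indicator {0..} y + ennreal (?f y) * indicator {..0} y \<partial>lborel)"
    by (intro nn_integral_mono) (auto split: split_indicator)
  also have "\<dots> = (\<integral>\<^sup>+y. ennreal (?f y) * indicator {0..} y \<partial>lborel)
      + (\<integral>\<^sup>+y. ennreal (?f y) * indicator {..0} y \<partial>lborel)"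
    by (rule nn_integral_add) auto
  also have "(\<integral>\<^sup>+y. ennreal (?f y) * indicator {..0} y \<partial>lborel)
      = (\<integral>\<^sup>+y. ennreal (?f y) * indicator {0..} y \<partial>lborel)"
    by (subst nn_integral_real_affine[where c = "-1" and t = 0])
       (auto intro!: nn_integral_cong split: split_indicator)
  also have "(\<integral>\<^sup>+y. ennreal (?f y) * indicator {0..} y \<partial>lborel) +
      (\<integral>\<^sup>+y. ennreal (?f y) * indicator {0..} y \<partial>lborel) = ennreal (pi / u)"
    unfolding half using u by (subst ennreal_plus[symmetric]) auto
  finally show ?thesis .
qed

context QK_weight begin

text \<open>The profile left over when the kernel integral is rescaled by
  \<open>s = 4 * (1 - x) / d\<close>. It equals \<open>p s / s\<close> up to 1 and is at most
  \<open>16 * p s / s^2\<close> beyond, so each of the two conditions covers one range.\<close>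

lemma p_weighted_integral_finite:
  "(\<integral>\<^sup>+s\<in>{0<..}. ennreal (p s / (s * (max 1 (s / 4))\<^sup>2)) \<partial>lborel) < \<infinity>"
proof -
  have "(\<integral>\<^sup>+s\<in>{0<..}. ennreal (p s / (s * (max 1 (s / 4))\<^sup>2)) \<partial>lborel)
    \<le> (\<integral>\<^sup>+s. ennreal (p s / s) * indicator {0<..1} s
        + ennreal 16 * (ennreal (p s / s\<^sup>2) * indicator {1..} s) \<partial>lborel)"
  proof (intro nn_integral_mono)
    fix s :: real
    consider "s \<le> 0" | "0 < s" "s \<le> 1" | "1 < s" by linarith
    then show "ennreal (p s / (s * (max 1 (s / 4))\<^sup>2)) * indicator {0<..} s
      \<le> ennreal (p s / s) * indicator {0<..1} s + ennreal 16 * (ennreal (p s / s\<^sup>2) * indicator {1..} s)"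
    proof cases
      case 2
      then have "max 1 (s / 4) = 1" by (simp add: max_def)
      then show ?thesis using 2 by simp
    next
      case 3
      have "s\<^sup>2 / 16 \<le> (max 1 (s / 4))\<^sup>2"
        using 3 power_mono[of "s / 4" "max 1 (s / 4)" 2] by (simp add: power_divide)
      then have "s\<^sup>2 / 16 \<le> s * (max 1 (s / 4))\<^sup>2"
        using 3 by (smt (verit) mult_le_cancel_right1 zero_le_power2)
      then have "p s / (s * (max 1 (s / 4))\<^sup>2) \<le> p s / (s\<^sup>2 / 16)"
        using 3 p_nonneg[of s] by (intro divide_left_mono mult_pos_pos) auto
      then have "ennreal (p s / (s * (max 1 (s / 4))\<^sup>2)) \<le> ennreal (16 * (p s / s\<^sup>2))"
        by (intro ennreal_leI) (simp add: mult.commute)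
      also have "\<dots> = ennreal 16 * ennreal (p s / s\<^sup>2)"
        using p_nonneg[of s] by (intro ennreal_mult) auto
      finally show ?thesis using 3 by simp
    qed simp
  qed
  also have "\<dots> = (\<integral>\<^sup>+s\<in>{0<..1}. ennreal (p s / s) \<partial>lborel)
      + ennreal 16 * (\<integral>\<^sup>+s\<in>{1..}. ennreal (p s / s\<^sup>2) \<partial>lborel)"
    by (subst nn_integral_add) (auto simp: nn_integral_cmult simp del: ennreal_numeral)
  also have "\<dots> < \<infinity>" using p_int0 p_int1 by (simp add: ennreal_mult_less_top)
  finally show ?thesis .
qed

text \<open>For \<open>w = x + iy\<close> in the disk, \<open>1 - |w|^2 \<le> 2 * (1 - x)\<close>,
  so \<open>K\<close> is at most \<open>p (4 * (1 - x) / d) * K (d / 2)\<close>, which depends on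
  \<open>x\<close> alone. Replacing \<open>cmod (1 - w)\<close> by \<open>1 - x\<close> inside the
  maximum leaves a \<open>y\<close>-integral of at most \<open>pi / (1 - x)\<close>. The
  substitution \<open>x = 1 - d * s / 4\<close> then separates \<open>K (d / 2) / d^2\<close> from a
  convergent integral without \<open>d\<close>.\<close>

lemma disk_integral_at_1:
  "\<exists>C>0. \<forall>d. 0 < d \<longrightarrow> d \<le> 2 \<longrightarrow>
    (\<integral>\<^sup>+w\<in>ball 0 1. ennreal (K (1 - (cmod w)\<^sup>2) / ((cmod (1 - w))\<^sup>2 * (max d (cmod (1 - w)))\<^sup>2)) \<partial>lborel)
    \<le> ennreal (C * K (d / 2) / d\<^sup>2)"
proof -
  define I where "I = (\<integral>\<^sup>+s\<in>{0<..}. ennreal (p s / (s * (max 1 (s / 4))\<^sup>2)) \<partial>lborel)"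
  define C where "C = pi * enn2real I + 1"
  have "(\<integral>\<^sup>+w\<in>ball 0 1. ennreal (K (1 - (cmod w)\<^sup>2) / ((cmod (1 - w))\<^sup>2 * (max d (cmod (1 - w)))\<^sup>2)) \<partial>lborel)
    \<le> ennreal (C * K (d / 2) / d\<^sup>2)" (is "?L \<le> _") if d: "0 < d" "d \<le> 2" for d
  proof -
    define q where "q x = p (4 * (1 - x) / d) * K (d / 2) / (max d (1 - x))\<^sup>2" for x
    have q0: "0 \<le> q x" for x using p_nonneg nonneg by (simp add: q_def)
    have [measurable]: "q \<in> borel_measurable borel" unfolding q_def by measurable
    have [measurable]: "ball (0::complex) 1 \<in> sets borel" by simp
    have "?L = (\<integral>\<^sup>+x. \<integral>\<^sup>+y. ennreal (K (1 - (cmod (Complex x y))\<^sup>2) / ((cmod (1 - Complex x y))\<^sup>2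
        * (max d (cmod (1 - Complex x y)))\<^sup>2)) * indicator (ball 0 1) (Complex x y) \<partial>lborel \<partial>lborel)"
      by (rule nn_integral_Complex) measurable
    also have "\<dots> \<le> (\<integral>\<^sup>+x. \<integral>\<^sup>+y. (ennreal (q x) * indicator {..<1} x) * ennreal (1 / ((1 - x)\<^sup>2 + y\<^sup>2)) \<partial>lborel \<partial>lborel)"
    proof (intro nn_integral_mono)
      fix x y :: real
      show "ennreal (K (1 - (cmod (Complex x y))\<^sup>2) / ((cmod (1 - Complex x y))\<^sup>2
        * (max d (cmod (1 - Complex x y)))\<^sup>2)) * indicator (ball 0 1) (Complex x y)
        \<le> (ennreal (q x) * indicator {..<1} x) * ennreal (1 / ((1 - x)\<^sup>2 + y\<^sup>2))"
      proof (cases "Complex x y \<in> ball 0 1")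
        case True
        then have xy: "x\<^sup>2 + y\<^sup>2 < 1" by (simp add: cmod_def)
        then have "x\<^sup>2 < 1" by (smt (verit) zero_le_power2)
        then have x: "x < 1" "- 1 < x" by (auto simp: abs_square_less_1)
        have n1: "(cmod (1 - Complex x y))\<^sup>2 = (1 - x)\<^sup>2 + y\<^sup>2"
          by (simp add: cmod_power2)
        have le: "1 - x \<le> cmod (1 - Complex x y)"
          using complex_Re_le_cmod[of "1 - Complex x y"] by simp
        have "1 - (cmod (Complex x y))\<^sup>2 \<le> 4 * (1 - x) / d * (d / 2)"
        proof -
          have "0 \<le> 1 + x\<^sup>2 - 2 * x" using zero_le_power2[of "1 - x"] by (simp add: power2_diff)
          moreover have "0 \<le> y\<^sup>2" by simp
          ultimately have "1 - (x\<^sup>2 + y\<^sup>2) \<le> 2 - 2 * x"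
            by linarith
          moreover have "4 * (1 - x) / d * (d / 2) = 2 - 2 * x" using d by simp
          ultimately show ?thesis by (simp only: cmod_power2 complex.sel)
        qed
        then have "K (1 - (cmod (Complex x y))\<^sup>2) \<le> K (4 * (1 - x) / d * (d / 2))"
          by (rule monoD[OF mono])
        also have "\<dots> \<le> p (4 * (1 - x) / d) * K (d / 2)"
          using d by (intro K_le_p) auto
        finally have k: "K (1 - (cmod (Complex x y))\<^sup>2) \<le> p (4 * (1 - x) / d) * K (d / 2)" .
        have "(max d (1 - x))\<^sup>2 \<le> (max d (cmod (1 - Complex x y)))\<^sup>2"
          using d le by (intro power_mono) auto
        then have "K (1 - (cmod (Complex x y))\<^sup>2) / ((cmod (1 - Complex x y))\<^sup>2
          * (max d (cmod (1 - Complex x y)))\<^sup>2) \<le> p (4 * (1 - x) / d) * K (d / 2) / (((1 - x)\<^sup>2 + y\<^sup>2) * (max d (1 - x))\<^sup>2)"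
          unfolding n1 using k nonneg p_nonneg x d
          by (intro frac_le mult_left_mono mult_pos_pos mult_nonneg_nonneg) (auto simp: add_pos_nonneg less_max_iff_disj)
        also have "\<dots> = q x * (1 / ((1 - x)\<^sup>2 + y\<^sup>2))" by (simp add: q_def)
        finally show ?thesis
          using x q0[of x] True by (simp add: ennreal_mult'[symmetric] ennreal_leI)
      qed simp
    qed
    also have "\<dots> = (\<integral>\<^sup>+x. (ennreal (q x) * indicator {..<1} x) * (\<integral>\<^sup>+y. ennreal (1 / ((1 - x)\<^sup>2 + y\<^sup>2)) \<partial>lborel) \<partial>lborel)"
      by (intro nn_integral_cong nn_integral_cmult) measurable
    also have "\<dots> \<le> (\<integral>\<^sup>+x. (ennreal (q x) * indicator {..<1} x) * ennreal (pi / (1 - x)) \<partial>lborel)"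
      by (intro nn_integral_mono) (auto intro!: mult_left_mono nn_integral_inverse_add_square_le split: split_indicator)
    also have "\<dots> = ennreal (d / 4) * (\<integral>\<^sup>+s. (ennreal (q (1 + (- d / 4) * s)) * indicator {..<1} (1 + (- d / 4) * s))
        * ennreal (pi / (1 - (1 + (- d / 4) * s))) \<partial>lborel)"
      using d by (subst nn_integral_real_affine[where c = "- d / 4" and t = 1]) auto
    also have "\<dots> = ennreal (d / 4) * (\<integral>\<^sup>+s. ennreal (4 * K (d / 2) * pi / d ^ 3) *
        (ennreal (p s / (s * (max 1 (s / 4))\<^sup>2)) * indicator {0<..} s) \<partial>lborel)"
    proof (rule arg_cong[where f = "\<lambda>x. ennreal (d / 4) * x"], rule nn_integral_cong)
      fix s :: real
      show "(ennreal (q (1 + (- d / 4) * s)) * indicator {..<1} (1 + (- d / 4) * s))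
        * ennreal (pi / (1 - (1 + (- d / 4) * s))) = ennreal (4 * K (d / 2) * pi / d ^ 3) *
        (ennreal (p s / (s * (max 1 (s / 4))\<^sup>2)) * indicator {0<..} s)"
      proof (cases "0 < s")
        case True
        have "max d (d * s / 4) = d * max 1 (s / 4)" using d by (simp add: max_def)
        then have "q (1 + (- d / 4) * s) * (pi / (1 - (1 + (- d / 4) * s)))
          = p s * K (d / 2) / (d * max 1 (s / 4))\<^sup>2 * (pi / (d * s / 4))"
          using d by (simp add: q_def)
        also have "\<dots> = 4 * K (d / 2) * pi / d ^ 3 * (p s / (s * (max 1 (s / 4))\<^sup>2))"
          using d True by (simp add: field_simps power2_eq_square power3_eq_cube)
        finally have "ennreal (q (1 + (- d / 4) * s)) * ennreal (pi / (1 - (1 + (- d / 4) * s)))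
          = ennreal (4 * K (d / 2) * pi / d ^ 3) * ennreal (p s / (s * (max 1 (s / 4))\<^sup>2))"
          using q0 d nonneg[of "d / 2"] True by (simp only: ennreal_mult'[symmetric] ennreal_mult''[symmetric]
            divide_nonneg_pos pi_ge_zero mult_nonneg_nonneg zero_less_power zero_le_numeral)
        then show ?thesis using True d by simp
      next
        case False
        then have "d * s \<le> 0" using d by (simp add: mult_nonneg_nonpos)
        then show ?thesis using False by simp
      qed
    qed
    also have "\<dots> = ennreal (d / 4) * (ennreal (4 * K (d / 2) * pi / d ^ 3) * I)"
      unfolding I_def by (subst nn_integral_cmult) auto
    also have "I = ennreal (enn2real I)"
      using p_weighted_integral_finite by (simp add: I_def ennreal_enn2real)
    also have "ennreal (d / 4) * (ennreal (4 * K (d / 2) * pi / d ^ 3) * ennreal (enn2real I))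
      = ennreal (d / 4 * (4 * K (d / 2) * pi / d ^ 3 * enn2real I))"
    proof -
      have "ennreal a * (ennreal b * ennreal c) = ennreal (a * (b * c))" if "0 \<le> a" "0 \<le> b" "0 \<le> c" for a b c
        using that by (simp add: ennreal_mult)
      then show ?thesis using d nonneg[of "d / 2"] by simp
    qed
    also have "\<dots> \<le> ennreal (C * K (d / 2) / d\<^sup>2)"
    proof (rule ennreal_leI)
      have "d / 4 * (4 * K (d / 2) * pi / d ^ 3 * enn2real I) = (pi * enn2real I) * (K (d / 2) / d\<^sup>2)"
        using d by (simp add: field_simps power2_eq_square power3_eq_cube)
      also have "\<dots> \<le> C * (K (d / 2) / d\<^sup>2)"
        unfolding C_def using nonneg by (intro mult_right_mono) auto
      finally show "d / 4 * (4 * K (d / 2) * pi / d ^ 3 * enn2real I) \<le> C * K (d / 2) / d\<^sup>2" by simp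
    qed
    finally show ?thesis .
  qed
  moreover have "C > 0" by (simp add: C_def add_nonneg_pos)
  ultimately show ?thesis by blast
qed

end

context QK_weight begin

lemma disk_integral_rotate:
  assumes u: "cmod u = 1"
  shows "(\<integral>\<^sup>+w\<in>ball 0 1. ennreal (K (1 - (cmod w)\<^sup>2) / ((cmod (u - w))\<^sup>2 * (max d (cmod (u - w)))\<^sup>2)) \<partial>lborel)
    = (\<integral>\<^sup>+w\<in>ball 0 1. ennreal (K (1 - (cmod w)\<^sup>2) / ((cmod (1 - w))\<^sup>2 * (max d (cmod (1 - w)))\<^sup>2)) \<partial>lborel)"
proof -
  define F where "F w = K (1 - (cmod w)\<^sup>2) / ((cmod (u - w))\<^sup>2 * (max d (cmod (u - w)))\<^sup>2)" for w
  have [measurable]: "F \<in> borel_measurable borel" unfolding F_def by measurable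
  have im: "(*) u ` ball 0 1 = ball 0 1"
  proof
    show "ball 0 1 \<subseteq> (*) u ` ball 0 1"
    proof
      fix z :: complex assume "z \<in> ball 0 1"
      moreover have "z = u * (z / u)" using u by auto
      ultimately show "z \<in> (*) u ` ball 0 1" using u by (intro image_eqI[of _ _ "z / u"]) (auto simp: norm_divide)
    qed
  qed (use u in \<open>auto simp: norm_mult\<close>)
  have rot: "cmod (u - u * w) = cmod (1 - w)" for w
  proof -
    have "u - u * w = u * (1 - w)" by (simp add: algebra_simps)
    then show ?thesis using u by (simp add: norm_mult)
  qed
  have "(\<integral>\<^sup>+w\<in>(*) u ` ball 0 1. ennreal (F w) \<partial>lborel) = (\<integral>\<^sup>+w\<in>ball 0 1. ennreal (F (u * w) * (cmod u)\<^sup>2) \<partial>lborel)"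
  proof (rule nn_integral_holomorphic_substitution)
    show "open ((*) u ` ball 0 1)" unfolding im by simp
    show "inj_on ((*) u) (ball 0 1)" using u by (auto simp: inj_on_def)
    show "\<And>z. ((*) u has_field_derivative u) (at z)" by (auto intro!: derivative_eq_intros)
    show "\<And>z. 0 \<le> F z" unfolding F_def using nonneg by auto
  qed simp_all
  then show ?thesis unfolding im by (simp add: F_def u rot norm_mult)
qed

text \<open>Decouples the singularities at the two boundary points:
  \<open>1 / (x * y) = (1 / x + 1 / y) / (x + y)\<close>, and \<open>x + y\<close> dominates
  \<open>d\<close> as well as \<open>x\<close> and \<open>y\<close>. The factors 2 come from the
  square of a sum.\<close>

lemma inverse_product_split:
  fixes k x y d :: real
  assumes "0 \<le> k" "0 < x" "0 < y" "0 < d" "d \<le> x + y"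
  shows "k / (x\<^sup>2 * y\<^sup>2) \<le> 2 * (k / (x\<^sup>2 * (max d x)\<^sup>2)) + 2 * (k / (y\<^sup>2 * (max d y)\<^sup>2))"
proof -
  have "1 / (x\<^sup>2 * y\<^sup>2) = (1 / x + 1 / y)\<^sup>2 / (x + y)\<^sup>2"
  proof -
    have "1 / x + 1 / y = (x + y) / (x * y)" using assms by (simp add: field_simps)
    then show ?thesis using assms by (simp add: power_divide power_mult_distrib)
  qed
  also have "(1 / x + 1 / y)\<^sup>2 / (x + y)\<^sup>2 \<le> (2 * (1 / x)\<^sup>2 + 2 * (1 / y)\<^sup>2) / (x + y)\<^sup>2"
  proof (rule divide_right_mono)
    show "(1 / x + 1 / y)\<^sup>2 \<le> 2 * (1 / x)\<^sup>2 + 2 * (1 / y)\<^sup>2"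
      using sum_squares_bound[of "1 / x" "1 / y"] by (simp add: power2_sum)
  qed simp
  also have "\<dots> = 2 * ((1 / x)\<^sup>2 / (x + y)\<^sup>2) + 2 * ((1 / y)\<^sup>2 / (x + y)\<^sup>2)"
    by (simp add: add_divide_distrib)
  also have "\<dots> \<le> 2 * ((1 / x)\<^sup>2 / (max d x)\<^sup>2) + 2 * ((1 / y)\<^sup>2 / (max d y)\<^sup>2)"
    using assms by (intro add_mono mult_left_mono divide_left_mono power_mono mult_pos_pos) auto
  finally have "k * (1 / (x\<^sup>2 * y\<^sup>2)) \<le> k * (2 * ((1 / x)\<^sup>2 / (max d x)\<^sup>2) + 2 * ((1 / y)\<^sup>2 / (max d y)\<^sup>2))"
    using assms(1) by (rule mult_left_mono)
  then show ?thesis by (simp add: power_divide distrib_left mult.commute)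
qed

lemma disk_integral_upper:
  "\<exists>C>0. \<forall>u v. cmod u = 1 \<longrightarrow> cmod v = 1 \<longrightarrow> u \<noteq> v \<longrightarrow>
    (\<integral>\<^sup>+w\<in>ball 0 1. ennreal (K (1 - (cmod w)\<^sup>2) / ((cmod (u - w))\<^sup>2 * (cmod (v - w))\<^sup>2)) \<partial>lborel)
    \<le> ennreal (C * K (cmod (u - v) / 2) / (cmod (u - v))\<^sup>2)"
proof -
  obtain C where C: "C > 0" and bound: "\<And>d. 0 < d \<Longrightarrow> d \<le> 2 \<Longrightarrow>
    (\<integral>\<^sup>+w\<in>ball 0 1. ennreal (K (1 - (cmod w)\<^sup>2) / ((cmod (1 - w))\<^sup>2 * (max d (cmod (1 - w)))\<^sup>2)) \<partial>lborel)
    \<le> ennreal (C * K (d / 2) / d\<^sup>2)"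
    using disk_integral_at_1 by blast
  have [measurable]: "ball (0::complex) 1 \<in> sets borel" by simp
  have "(\<integral>\<^sup>+w\<in>ball 0 1. ennreal (K (1 - (cmod w)\<^sup>2) / ((cmod (u - w))\<^sup>2 * (cmod (v - w))\<^sup>2)) \<partial>lborel)
    \<le> ennreal (4 * C * K (cmod (u - v) / 2) / (cmod (u - v))\<^sup>2)" (is "?L \<le> _")
    if u: "cmod u = 1" and v: "cmod v = 1" and "u \<noteq> v" for u v
  proof -
    define d where "d = cmod (u - v)"
    define H where "H x w = ennreal (K (1 - (cmod w)\<^sup>2) / ((cmod (x - w))\<^sup>2 * (max d (cmod (x - w)))\<^sup>2)) * indicator (ball 0 1) w" for x w
    have [measurable]: "H x \<in> borel_measurable borel" for x unfolding H_def by measurable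
    have d: "0 < d" "d \<le> 2"
      using \<open>u \<noteq> v\<close> norm_triangle_ineq4[of u v] u v by (auto simp: d_def)
    have "?L \<le> (\<integral>\<^sup>+w. ennreal 2 * H u w + ennreal 2 * H v w \<partial>lborel)"
    proof (rule nn_integral_mono)
      fix w :: complex
      show "ennreal (K (1 - (cmod w)\<^sup>2) / ((cmod (u - w))\<^sup>2 * (cmod (v - w))\<^sup>2)) * indicator (ball 0 1) w
        \<le> ennreal 2 * H u w + ennreal 2 * H v w"
      proof (cases "w \<in> ball 0 1")
        case True
        then have w: "cmod w < 1" by simp
        have *: "0 < cmod (u - w)" "0 < cmod (v - w)" using u v w by auto
        have "d \<le> cmod (u - w) + cmod (v - w)"
          using norm_triangle_ineq4[of "u - w" "v - w"] by (simp add: d_def)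
        from inverse_product_split[OF nonneg * d(1) this, of "1 - (cmod w)\<^sup>2"]
        have "ennreal (K (1 - (cmod w)\<^sup>2) / ((cmod (u - w))\<^sup>2 * (cmod (v - w))\<^sup>2))
          \<le> ennreal (2 * (K (1 - (cmod w)\<^sup>2) / ((cmod (u - w))\<^sup>2 * (max d (cmod (u - w)))\<^sup>2))
             + 2 * (K (1 - (cmod w)\<^sup>2) / ((cmod (v - w))\<^sup>2 * (max d (cmod (v - w)))\<^sup>2)))"
          by (rule ennreal_leI)
        also have "\<dots> = ennreal 2 * H u w + ennreal 2 * H v w"
        proof -
          have *: "ennreal (2 * a + 2 * b) = ennreal 2 * ennreal a + ennreal 2 * ennreal b" if "0 \<le> a" "0 \<le> b" for a b
            using that by (simp add: ennreal_plus ennreal_mult)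
          then show ?thesis unfolding H_def using True nonneg by (subst *) auto
        qed
        finally show ?thesis using True by simp
      qed simp
    qed
    also have "\<dots> = ennreal 2 * (\<integral>\<^sup>+w. H u w \<partial>lborel) + ennreal 2 * (\<integral>\<^sup>+w. H v w \<partial>lborel)"
      by (subst nn_integral_add) (auto simp: nn_integral_cmult simp del: ennreal_numeral)
    also have "\<dots> \<le> ennreal 2 * ennreal (C * K (d / 2) / d\<^sup>2) + ennreal 2 * ennreal (C * K (d / 2) / d\<^sup>2)"
      unfolding H_def disk_integral_rotate[OF u] disk_integral_rotate[OF v]
      by (intro add_mono mult_left_mono bound d) auto
    also have "\<dots> = ennreal (4 * C * K (d / 2) / d\<^sup>2)"
    proof -
      have "ennreal 2 * ennreal x + ennreal 2 * ennreal x = ennreal (4 * x)" if "0 \<le> x" for x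
        using that by (simp add: ennreal_mult[symmetric] ennreal_plus[symmetric] del: ennreal_numeral ennreal_plus)
      from this[of "C * K (d / 2) / d\<^sup>2"] show ?thesis using C nonneg by (simp add: mult.assoc)
    qed
    finally show ?thesis unfolding d_def .
  qed
  then show ?thesis using C by (intro exI[of _ "4 * C"]) auto
qed

text \<open>Restrict to the ball of radius \<open>d / 8\<close> whose centre lies at depth
  \<open>d / 4\<close> below \<open>u\<close>. There \<open>1 - |w|^2 \<ge> d / 8\<close>, and both
  distances to the boundary points are at most a multiple of \<open>d\<close>, while the area is of
  order \<open>d^2\<close>.\<close>

lemma disk_integral_lower:
  "\<exists>c>0. \<forall>u v. cmod u = 1 \<longrightarrow> cmod v = 1 \<longrightarrow> u \<noteq> v \<longrightarrow>
    ennreal (c * K (cmod (u - v) / 2) / (cmod (u - v))\<^sup>2)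
    \<le> (\<integral>\<^sup>+w\<in>ball 0 1. ennreal (K (1 - (cmod w)\<^sup>2) / ((cmod (u - w))\<^sup>2 * (cmod (v - w))\<^sup>2)) \<partial>lborel)"
proof -
  \<comment> \<open>The bounds \<open>d / 2\<close> and \<open>3 * d / 2\<close> on the distances
    and the area \<open>pi * (d / 8)^2\<close> give \<open>pi / 36\<close>; \<open>p 4\<close> pays
    for passing from \<open>d / 8\<close> to \<open>d / 2\<close>, and adding 1 keeps the
    denominator positive.\<close>
  define c where "c = pi / (36 * (p 4 + 1))"
  have c: "c > 0" using p_nonneg[of 4] by (simp add: c_def add_nonneg_pos)
  have "ennreal (c * K (cmod (u - v) / 2) / (cmod (u - v))\<^sup>2)
    \<le> (\<integral>\<^sup>+w\<in>ball 0 1. ennreal (K (1 - (cmod w)\<^sup>2) / ((cmod (u - w))\<^sup>2 * (cmod (v - w))\<^sup>2)) \<partial>lborel)" (is "_ \<le> ?R")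
    if u: "cmod u = 1" and v: "cmod v = 1" and "u \<noteq> v" for u v
  proof -
    define d where "d = cmod (u - v)"
    have d: "0 < d" "d \<le> 2"
      using \<open>u \<noteq> v\<close> norm_triangle_ineq4[of u v] u v by (auto simp: d_def)
    define o' where "o' = (1 - d / 4) *\<^sub>R u"
    have [measurable]: "ball o' (d / 8) \<in> sets borel" by simp
    have no: "cmod o' = 1 - d / 4" using d u by (simp add: o'_def)
    have uo: "cmod (u - o') = d / 4"
    proof -
      have "u - o' = (d / 4) *\<^sub>R u" by (simp add: o'_def algebra_simps)
      then show ?thesis using d u by simp
    qed
    have "K (d / 2) \<le> p 4 * K (d / 8)" using K_le_p[of "d / 8" 4] d by simp
    also have "\<dots> \<le> (p 4 + 1) * K (d / 8)" using nonneg by (intro mult_right_mono) auto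
    finally have "c * K (d / 2) \<le> c * ((p 4 + 1) * K (d / 8))" using c by (intro mult_left_mono) auto
    also have "\<dots> = pi / 36 * K (d / 8)"
    proof -
      have "pi / (36 * q) * (q * k) = pi / 36 * k" if "q \<noteq> 0" for q k :: real using that by simp
      moreover have "p 4 + 1 \<noteq> 0" using p_nonneg[of 4] by linarith
      ultimately show ?thesis unfolding c_def by blast
    qed
    finally have "c * K (d / 2) / d\<^sup>2 \<le> pi / 36 * K (d / 8) / d\<^sup>2" by (rule divide_right_mono) simp
    also have "\<dots> = K (d / 8) / ((d / 2)\<^sup>2 * (3 * d / 2)\<^sup>2) * (pi * (d / 8)\<^sup>2)"
      using d by (simp add: field_simps power2_eq_square)
    finally have "ennreal (c * K (d / 2) / d\<^sup>2) \<le> ennreal (K (d / 8) / ((d / 2)\<^sup>2 * (3 * d / 2)\<^sup>2) * (pi * (d / 8)\<^sup>2))"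
      by (rule ennreal_leI)
    also have "\<dots> = ennreal (K (d / 8) / ((d / 2)\<^sup>2 * (3 * d / 2)\<^sup>2)) * emeasure lborel (ball o' (d / 8))"
      using d nonneg[of "d / 8"] by (subst ennreal_mult) (auto simp: emeasure_ball unit_ball_vol_2)
    also have "\<dots> = (\<integral>\<^sup>+w. ennreal (K (d / 8) / ((d / 2)\<^sup>2 * (3 * d / 2)\<^sup>2)) * indicator (ball o' (d / 8)) w \<partial>lborel)"
      by (subst nn_integral_cmult_indicator) auto
    also have "\<dots> \<le> ?R"
    proof (rule nn_integral_mono)
      fix w
      show "ennreal (K (d / 8) / ((d / 2)\<^sup>2 * (3 * d / 2)\<^sup>2)) * indicator (ball o' (d / 8)) w
        \<le> ennreal (K (1 - (cmod w)\<^sup>2) / ((cmod (u - w))\<^sup>2 * (cmod (v - w))\<^sup>2)) * indicator (ball 0 1) w"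
      proof (cases "w \<in> ball o' (d / 8)")
        case True
        then have ow: "cmod (o' - w) < d / 8" by (simp add: dist_norm)
        have w: "cmod w \<le> 1 - d / 8" using norm_triangle_ineq3[of o' w] ow no by linarith
        then have w1: "cmod w < 1" using d by simp
        have uw: "cmod (u - w) \<le> 3 * d / 8" using norm_triangle_ineq[of "u - o'" "o' - w"] ow uo by simp
        have "cmod (v - w) \<le> d + cmod (u - w)"
          using norm_triangle_ineq[of "v - u" "u - w"] by (simp add: d_def norm_minus_commute)
        then have vw: "cmod (v - w) \<le> 3 * d / 2" using uw d by simp
        have "(cmod w)\<^sup>2 \<le> cmod w * 1" unfolding power2_eq_square using w1 by (intro mult_left_mono) auto
        then have "K (d / 8) \<le> K (1 - (cmod w)\<^sup>2)" using w by (intro monoD[OF mono]) auto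
        moreover have "0 < cmod (u - w)" "0 < cmod (v - w)" using u v w1 by auto
        ultimately have "K (d / 8) / ((d / 2)\<^sup>2 * (3 * d / 2)\<^sup>2)
            \<le> K (1 - (cmod w)\<^sup>2) / ((cmod (u - w))\<^sup>2 * (cmod (v - w))\<^sup>2)"
          using uw vw d nonneg by (intro frac_le mult_mono power_mono mult_pos_pos) auto
        then show ?thesis using True w1 by (simp add: ennreal_leI)
      qed simp
    qed
    finally show ?thesis unfolding d_def .
  qed
  then show ?thesis using c by blast
qed

text \<open>The conformal factor in \<open>disk_kernel_mobius\<close> replaces the inverse squared
  chord between the transformed points by that between \<open>u\<close> and \<open>v\<close>; inside
  \<open>K\<close> the transformed chord survives.\<close>

lemma disk_kernel_bounds:
  obtains c C where "0 < c" "0 < C"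
    "\<And>a u v. cmod a < 1 \<Longrightarrow> cmod u = 1 \<Longrightarrow> cmod v = 1 \<Longrightarrow> u \<noteq> v \<Longrightarrow>
      ennreal (c * (K (cmod (mobius a u - mobius a v) / 2) / (cmod (u - v))\<^sup>2)) \<le> disk_kernel K a u v"
    "\<And>a u v. cmod a < 1 \<Longrightarrow> cmod u = 1 \<Longrightarrow> cmod v = 1 \<Longrightarrow> u \<noteq> v \<Longrightarrow>
      disk_kernel K a u v \<le> ennreal (C * (K (cmod (mobius a u - mobius a v) / 2) / (cmod (u - v))\<^sup>2))"
proof -
  obtain c where c: "c > 0" and lower: "\<And>u v. cmod u = 1 \<Longrightarrow> cmod v = 1 \<Longrightarrow> u \<noteq> v \<Longrightarrow>
    ennreal (c * K (cmod (u - v) / 2) / (cmod (u - v))\<^sup>2)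
    \<le> (\<integral>\<^sup>+w\<in>ball 0 1. ennreal (K (1 - (cmod w)\<^sup>2) / ((cmod (u - w))\<^sup>2 * (cmod (v - w))\<^sup>2)) \<partial>lborel)"
    using disk_integral_lower by blast
  obtain C where C: "C > 0" and upper: "\<And>u v. cmod u = 1 \<Longrightarrow> cmod v = 1 \<Longrightarrow> u \<noteq> v \<Longrightarrow>
    (\<integral>\<^sup>+w\<in>ball 0 1. ennreal (K (1 - (cmod w)\<^sup>2) / ((cmod (u - w))\<^sup>2 * (cmod (v - w))\<^sup>2)) \<partial>lborel)
    \<le> ennreal (C * K (cmod (u - v) / 2) / (cmod (u - v))\<^sup>2)"
    using disk_integral_upper by blast
  have *: "cmod (mobius a u) = 1 \<and> cmod (mobius a v) = 1 \<and> mobius a u \<noteq> mobius a v"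
    if "cmod a < 1" "cmod u = 1" "cmod v = 1" "u \<noteq> v" for a u v
  proof -
    have "mobius a (mobius a u) = u" "mobius a (mobius a v) = v"
      using that by (simp_all only: mobius_involution one_minus_cnj_mult_ne_0 order_refl not_False_eq_True)
    then show ?thesis using that cmod_mobius_eq_1 by metis
  qed
  have cancel: "ennreal (x\<^sup>2 / y\<^sup>2) * ennreal (k * K (x / 2) / x\<^sup>2) = ennreal (k * (K (x / 2) / y\<^sup>2))"
    if "x \<noteq> 0" "k > 0" for k x y
    using that nonneg[of "x / 2"] by (subst ennreal_mult[symmetric]) auto
  show ?thesis
  proof (rule that[OF c C])
    fix a u v assume a: "cmod a < 1" "cmod u = 1" "cmod v = 1" "u \<noteq> v"
    note m = *[OF a]
    let ?x = "cmod (mobius a u - mobius a v)"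
    have x: "?x \<noteq> 0" using m by simp
    note eq = disk_kernel_mobius[OF a measurable_K nonneg]
    show "ennreal (c * (K (?x / 2) / (cmod (u - v))\<^sup>2)) \<le> disk_kernel K a u v"
      unfolding cancel[OF x c, symmetric] eq using m by (intro mult_left_mono lower) auto
    show "disk_kernel K a u v \<le> ennreal (C * (K (?x / 2) / (cmod (u - v))\<^sup>2))"
      unfolding cancel[OF x C, symmetric] eq using m by (intro mult_left_mono upper) auto
  qed
qed

end

section \<open>Integrals over rectangles of arcs\<close>

text \<open>Jordan's inequality: a concave function lies above its secant.\<close>

lemma sin_ge_linear:
  assumes "0 \<le> t" "t \<le> pi / 2" shows "2 * t / pi \<le> sin t"
proof -
  have "concave_on {0..pi/2} sin"
    by (rule f''_le0_imp_concave[where f' = cos and f'' = "\<lambda>x. - sin x"])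
       (auto intro!: derivative_eq_intros sin_ge_zero)
  from concave_onD[OF this, of "2 * t / pi" 0 "pi / 2"] show ?thesis
    using assms by (simp add: divide_simps)
qed

lemma cmod_cis_diff: "cmod (cis x - cis y) = 2 * \<bar>sin ((x - y) / 2)\<bar>"
proof -
  have "cis x - cis y = cis y * (exp (\<i> * of_real (x - y)) - 1)"
    by (simp add: algebra_simps cis_conv_exp exp_add[symmetric] del: exp_diff)
  then have "cmod (cis x - cis y) = cmod (exp (\<i> * of_real (x - y)) - 1)"
    by (simp add: norm_mult)
  then show ?thesis by (simp only: dist_exp_i_1)
qed

lemma cmod_cis_diff_le: "cmod (cis x - cis y) \<le> \<bar>x - y\<bar>"
  using abs_sin_x_le_abs_x[of "(x - y) / 2"] by (simp add: cmod_cis_diff)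

lemma cmod_cis_diff_ge:
  assumes "\<bar>x - y\<bar> \<le> pi" shows "2 * \<bar>x - y\<bar> / pi \<le> cmod (cis x - cis y)"
proof -
  have "2 * (\<bar>x - y\<bar> / 2) / pi \<le> sin (\<bar>x - y\<bar> / 2)"
    using assms by (intro sin_ge_linear) auto
  also have "\<dots> \<le> \<bar>sin ((x - y) / 2)\<bar>"
    by (cases "x \<le> y") (simp_all, smt (verit) minus_divide_left sin_minus)
  finally show ?thesis by (simp add: cmod_cis_diff)
qed

lemma cis_add_2pi_int: "cis (x + 2 * pi * of_int k) = cis x"
  by (simp add: cis_mult[symmetric])

text \<open>A shift by whole periods moves the start of the window to some \<open>b\<close> in
  \<open>{0..2 * pi}\<close>; the overhang beyond \<open>2 * pi\<close> then fills the gap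
  \<open>{0..<b}\<close>. Half-open intervals make the pieces disjoint.\<close>

lemma nn_integral_periodic:
  fixes g :: "real \<Rightarrow> ennreal"
  assumes [measurable]: "g \<in> borel_measurable borel" and per: "\<And>x k. g (x + 2 * pi * of_int k) = g x"
  shows "(\<integral>\<^sup>+x\<in>{c..c + 2 * pi}. g x \<partial>lborel) = (\<integral>\<^sup>+x\<in>{0..2 * pi}. g x \<partial>lborel)"
proof -
  have half_open: "(\<integral>\<^sup>+x\<in>{a..b}. g x \<partial>lborel) = (\<integral>\<^sup>+x\<in>{a..<b}. g x \<partial>lborel)" for a b
    using AE_lborel_singleton[of b] by (intro nn_integral_cong_AE) (auto split: split_indicator)
  have shift: "(\<integral>\<^sup>+x\<in>{a..<b}. g x \<partial>lborel) = (\<integral>\<^sup>+x\<in>{a + 2 * pi * of_int k..<b + 2 * pi * of_int k}. g x \<partial>lborel)" for a b k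
    by (subst (2) nn_integral_real_affine[where c = 1 and t = "2 * pi * of_int k"])
       (auto simp: per add.commute[of "2 * pi * of_int k"] intro!: nn_integral_cong split: split_indicator)
  define k where "k = \<lfloor>c / (2 * pi)\<rfloor>"
  define b where "b = c - 2 * pi * of_int k"
  have "of_int k \<le> c / (2 * pi)" "c / (2 * pi) < of_int k + 1"
    unfolding k_def by linarith+
  then have b: "0 \<le> b" "b \<le> 2 * pi"
    by (simp_all add: b_def field_simps)
  have split: "(\<integral>\<^sup>+x\<in>{u..<w}. g x \<partial>lborel) = (\<integral>\<^sup>+x\<in>{u..<v}. g x \<partial>lborel) + (\<integral>\<^sup>+x\<in>{v..<w}. g x \<partial>lborel)"
    if "u \<le> v" "v \<le> w" for u v w
  proof -
    have "(\<integral>\<^sup>+x\<in>{u..<w}. g x \<partial>lborel) = (\<integral>\<^sup>+x. g x * indicator {u..<v} x + g x * indicator {v..<w} x \<partial>lborel)"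
      using that by (intro nn_integral_cong) (auto split: split_indicator)
    also have "\<dots> = (\<integral>\<^sup>+x\<in>{u..<v}. g x \<partial>lborel) + (\<integral>\<^sup>+x\<in>{v..<w}. g x \<partial>lborel)"
      by (rule nn_integral_add) auto
    finally show ?thesis .
  qed
  have "(\<integral>\<^sup>+x\<in>{c..c + 2 * pi}. g x \<partial>lborel) = (\<integral>\<^sup>+x\<in>{b..<b + 2 * pi}. g x \<partial>lborel)"
    unfolding half_open using shift[of b "b + 2 * pi" k] by (simp add: b_def algebra_simps)
  also have "\<dots> = (\<integral>\<^sup>+x\<in>{b..<2 * pi}. g x \<partial>lborel) + (\<integral>\<^sup>+x\<in>{2 * pi..<b + 2 * pi}. g x \<partial>lborel)"
    using b by (intro split) auto
  also have "(\<integral>\<^sup>+x\<in>{2 * pi..<b + 2 * pi}. g x \<partial>lborel) = (\<integral>\<^sup>+x\<in>{0..<b}. g x \<partial>lborel)"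
    using shift[of 0 b 1] by simp
  also have "(\<integral>\<^sup>+x\<in>{b..<2 * pi}. g x \<partial>lborel) + (\<integral>\<^sup>+x\<in>{0..<b}. g x \<partial>lborel) = (\<integral>\<^sup>+x\<in>{0..<2 * pi}. g x \<partial>lborel)"
    using split[of 0 b "2 * pi"] b by (simp add: add.commute)
  finally show ?thesis unfolding half_open .
qed

text \<open>Both indicators stay in the innermost integrand, as in \<open>QK_arc_integral\<close>;
  monotonicity in sets and integrand is then free of measurability conditions.\<close>

definition rect_integral :: "real set \<Rightarrow> real set \<Rightarrow> (real \<Rightarrow> real \<Rightarrow> ennreal) \<Rightarrow> ennreal" where
  "rect_integral A B w = (\<integral>\<^sup>+x. \<integral>\<^sup>+y. indicator A x * indicator B y * w x y \<partial>lborel \<partial>lborel)"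

lemma rect_integral_mono:
  assumes "\<And>x y. x \<in> A \<Longrightarrow> y \<in> B \<Longrightarrow> w x y \<le> w' x y"
  shows "rect_integral A B w \<le> rect_integral A B w'"
  unfolding rect_integral_def using assms
  by (intro nn_integral_mono) (auto split: split_indicator)

lemma rect_integral_cmult:
  assumes [measurable]: "case_prod w \<in> borel_measurable (borel \<Otimes>\<^sub>M borel)" "A \<in> sets borel" "B \<in> sets borel"
  shows "rect_integral A B (\<lambda>x y. c * w x y) = c * rect_integral A B w"
proof -
  have [measurable]: "(\<lambda>p. w (fst p) (snd p)) \<in> borel_measurable (borel \<Otimes>\<^sub>M borel)"
    using assms(1) by (simp add: split_beta')
  have "rect_integral A B (\<lambda>x y. c * w x y) = (\<integral>\<^sup>+x. c * (\<integral>\<^sup>+y. indicator A x * indicator B y * w x y \<partial>lborel) \<partial>lborel)"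
    unfolding rect_integral_def
    by (subst nn_integral_cmult[symmetric]) (auto simp: mult_ac)
  also have "\<dots> = c * rect_integral A B w"
    unfolding rect_integral_def by (rule nn_integral_cmult) measurable
  finally show ?thesis .
qed

lemma rect_integral_add:
  assumes [measurable]: "case_prod v \<in> borel_measurable (borel \<Otimes>\<^sub>M borel)" "case_prod w \<in> borel_measurable (borel \<Otimes>\<^sub>M borel)"
    "A \<in> sets borel" "B \<in> sets borel"
  shows "rect_integral A B (\<lambda>x y. v x y + w x y) = rect_integral A B v + rect_integral A B w"
proof -
  have "rect_integral A B (\<lambda>x y. v x y + w x y) = (\<integral>\<^sup>+x. (\<integral>\<^sup>+y. indicator A x * indicator B y * v x y \<partial>lborel)
     + (\<integral>\<^sup>+y. indicator A x * indicator B y * w x y \<partial>lborel) \<partial>lborel)"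
    unfolding rect_integral_def
    by (subst nn_integral_add[symmetric]) (auto simp: distrib_left)
  also have "\<dots> = rect_integral A B v + rect_integral A B w"
    unfolding rect_integral_def by (rule nn_integral_add) measurable
  finally show ?thesis .
qed

lemma rect_integral_sum:
  assumes "finite S" and [measurable]: "\<And>i. i \<in> S \<Longrightarrow> case_prod (w i) \<in> borel_measurable (borel \<Otimes>\<^sub>M borel)"
    "A \<in> sets borel" "B \<in> sets borel"
  shows "rect_integral A B (\<lambda>x y. \<Sum>i\<in>S. w i x y) = (\<Sum>i\<in>S. rect_integral A B (w i))"
  using assms(1,2)
proof (induction S)
  case (insert i S)
  have [measurable]: "case_prod (w i) \<in> borel_measurable (borel \<Otimes>\<^sub>M borel)"
    "\<And>j. j \<in> S \<Longrightarrow> case_prod (w j) \<in> borel_measurable (borel \<Otimes>\<^sub>M borel)" using insert by auto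
  have "(\<lambda>p. \<Sum>i\<in>S. case_prod (w i) p) \<in> borel_measurable (borel \<Otimes>\<^sub>M borel)" by measurable
  then have "case_prod (\<lambda>x y. \<Sum>i\<in>S. w i x y) \<in> borel_measurable (borel \<Otimes>\<^sub>M borel)"
    by (simp add: split_beta')
  then show ?case using insert by (simp add: rect_integral_add)
qed (simp add: rect_integral_def)

lemma rect_integral_swap:
  assumes [measurable]: "case_prod w \<in> borel_measurable (borel \<Otimes>\<^sub>M borel)" "A \<in> sets borel" "B \<in> sets borel"
  shows "rect_integral A B w = rect_integral B A (\<lambda>y x. w x y)"
  unfolding rect_integral_def
  by (subst lborel_pair.Fubini') (auto simp: mult_ac)

lemma rect_integral_subset:
  "A \<subseteq> A' \<Longrightarrow> B \<subseteq> B' \<Longrightarrow> rect_integral A B w \<le> rect_integral A' B' w"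
  unfolding rect_integral_def
  by (intro nn_integral_mono mult_right_mono mult_mono) (auto split: split_indicator)

lemma rect_integral_indicator:
  assumes "A \<subseteq> A'" "B \<subseteq> B'"
  shows "rect_integral A' B' (\<lambda>x y. indicator A x * indicator B y * w x y) = rect_integral A B w"
  unfolding rect_integral_def using assms
  by (intro nn_integral_cong) (auto split: split_indicator)

lemma rect_integral_periodic:
  assumes m[measurable]: "case_prod w \<in> borel_measurable (borel \<Otimes>\<^sub>M borel)"
    and per: "\<And>x y k. w (x + 2 * pi * of_int k) y = w x y" "\<And>x y k. w x (y + 2 * pi * of_int k) = w x y"
  shows "rect_integral {c..c + 2 * pi} {c..c + 2 * pi} w = rect_integral {0..2 * pi} {0..2 * pi} w"
proof -
  have [measurable]: "w x \<in> borel_measurable borel" for x using m by measurable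
  have *: "rect_integral A B w = (\<integral>\<^sup>+x\<in>A. (\<integral>\<^sup>+y\<in>B. w x y \<partial>lborel) \<partial>lborel)"
    if [measurable]: "A \<in> sets borel" "B \<in> sets borel" for A B
    unfolding rect_integral_def
    by (subst nn_integral_multc[symmetric]) (auto simp: mult_ac)
  have "(\<integral>\<^sup>+y\<in>{c..c + 2 * pi}. w x y \<partial>lborel) = (\<integral>\<^sup>+y\<in>{0..2 * pi}. w x y \<partial>lborel)" for x
    by (rule nn_integral_periodic) (simp_all add: per)
  then show ?thesis
    by (subst (1 2) *, simp_all) (rule nn_integral_periodic, simp_all add: per)
qed

section \<open>Arc integrals and the Moebius-invariant energy\<close>

text \<open>Measurability is asked for on the whole line because the parameter windows are centred
  at arbitrary angles.\<close>

locale QK_circle = QK_weight +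
  fixes f :: "complex \<Rightarrow> complex"
  assumes f_cis [measurable]: "(\<lambda>x. f (cis x)) \<in> borel_measurable borel"
begin

definition F :: "real \<Rightarrow> complex" where "F x = f (cis x)"

lemma measurable_F [measurable]: "F \<in> borel_measurable borel"
  unfolding F_def by (rule f_cis)

definition osc :: "real \<Rightarrow> real \<Rightarrow> real" where "osc x y = (cmod (F x - F y))\<^sup>2"

definition chord :: "real \<Rightarrow> real \<Rightarrow> real" where "chord x y = cmod (cis x - cis y)"

definition mchord :: "complex \<Rightarrow> real \<Rightarrow> real \<Rightarrow> real" where
  "mchord a x y = cmod (mobius a (cis x) - mobius a (cis y))"

text \<open>The middle term of the equivalence: the disk integral and the arc integrals are both
  compared with it.\<close>

definition circle_energy :: "complex \<Rightarrow> ennreal" where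
  "circle_energy a = rect_integral {0..2*pi} {0..2*pi}
     (\<lambda>x y. ennreal (osc x y * (K (mchord a x y / 2) / (chord x y)\<^sup>2)))"

lemma measurable_osc [measurable]:
  assumes [measurable]: "g \<in> borel_measurable M" "h \<in> borel_measurable M"
  shows "(\<lambda>x. osc (g x) (h x)) \<in> borel_measurable M"
  unfolding osc_def by measurable

lemma measurable_chord [measurable]:
  assumes [measurable]: "g \<in> borel_measurable M" "h \<in> borel_measurable M"
  shows "(\<lambda>x. chord (g x) (h x)) \<in> borel_measurable M"
  unfolding chord_def by measurable

lemma measurable_mchord [measurable]:
  assumes [measurable]: "g \<in> borel_measurable M" "h \<in> borel_measurable M"
  shows "(\<lambda>x. mchord a (g x) (h x)) \<in> borel_measurable M"
  unfolding mchord_def by measurable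

lemma osc_nonneg [simp]: "0 \<le> osc x y" by (simp add: osc_def)
lemma chord_nonneg [simp]: "0 \<le> chord x y" by (simp add: chord_def)
lemma mchord_nonneg [simp]: "0 \<le> mchord a x y" by (simp add: mchord_def)
lemma osc_commute: "osc x y = osc y x" by (simp add: osc_def norm_minus_commute)
lemma chord_commute: "chord x y = chord y x" by (simp add: chord_def norm_minus_commute)
lemma mchord_commute: "mchord a x y = mchord a y x" by (simp add: mchord_def norm_minus_commute)
text \<open>Parameters with chord 0 describe the same point of the circle. This makes division by a
  vanishing chord harmless, also at the two ends of a full window.\<close>

lemma osc_eq_0: "chord x y = 0 \<Longrightarrow> osc x y = 0" by (simp add: osc_def chord_def F_def)

text \<open>The constant \<open>3/2 < 2\<close> matters: iterating the inequality over dyadic arcs costs \<open>(3/2)^(l - k)\<close>, which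
  is still summable against the gain \<open>2^(k - l)\<close>.\<close>

lemma osc_triangle: "osc x y \<le> 3/2 * osc x t + 3 * osc t y"
proof -
  have "cmod (F x - F y) \<le> cmod (F x - F t) + cmod (F t - F y)"
    using norm_triangle_ineq[of "F x - F t" "F t - F y"] by simp
  then have "osc x y \<le> (cmod (F x - F t) + cmod (F t - F y))\<^sup>2"
    unfolding osc_def by (intro power_mono) auto
  also have "\<dots> \<le> 3/2 * osc x t + 3 * osc t y"
  proof -
    have "(A + B)\<^sup>2 \<le> 3/2 * A\<^sup>2 + 3 * B\<^sup>2" for A B :: real
    proof -
      \<comment> \<open>Young's inequality with unequal weights:
        \<open>2 * A * B \<le> A^2 / 2 + 2 * B^2\<close>.\<close>
      have "0 \<le> (A - 2 * B)\<^sup>2" by simp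
      then have "0 \<le> A\<^sup>2 / 2 - 2 * A * B + 2 * B\<^sup>2" by (simp add: power2_eq_square algebra_simps)
      then show ?thesis by (simp add: power2_sum)
    qed
    then show ?thesis unfolding osc_def .
  qed
  finally show ?thesis .
qed

lemma QK_arc_integral_eq:
  "QK_arc_integral K f \<alpha> L = rect_integral {\<alpha>..\<alpha>+L} {\<alpha>..\<alpha>+L}
     (\<lambda>x y. ennreal (osc x y / (chord x y)\<^sup>2 * K (chord x y / L)))"
  unfolding QK_arc_integral_def rect_integral_def osc_def chord_def F_def ..

lemma circle_energy_eq:
  "circle_energy a = rect_integral {c..c + 2 * pi} {c..c + 2 * pi}
     (\<lambda>x y. ennreal (osc x y * (K (mchord a x y / 2) / (chord x y)\<^sup>2)))"
  unfolding circle_energy_def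
  by (rule rect_integral_periodic[symmetric]) (simp_all add: osc_def chord_def mchord_def F_def cis_add_2pi_int)

text \<open>On the circle \<open>1 - cnj a * cis x\<close> and \<open>cis x - a\<close> have equal
  modulus, so lower and upper bounds of the Moebius chord become bounds of the distances to
  \<open>a\<close>.\<close>

lemma mchord_eq:
  assumes "cmod a < 1"
  shows "mchord a x y = (1 - (cmod a)\<^sup>2) * chord x y / (cmod (cis x - a) * cmod (cis y - a))"
proof -
  have "cmod (1 - cnj a * cis x) = cmod (cis x - a)" for x
  proof -
    have "1 - cnj a * cis x = cis x * cnj (cis x - a)"
      by (simp add: algebra_simps cis_cnj cis_mult)
    then show ?thesis by (simp add: norm_mult del: complex_cnj_diff)
  qed
  then show ?thesis
    using cmod_mobius_diff[of a "cis x" "cis y"] one_minus_cnj_mult_ne_0[OF assms] assms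
    by (simp add: mchord_def chord_def)
qed

text \<open>Every point of the arc is within \<open>L\<close> of \<open>a\<close>, while
  \<open>1 - |a|^2 \<ge> L / (4 * pi)\<close>. Hence the Moebius chord is at least
  \<open>chord x y / (4 * pi * L)\<close>, and halving it produces the \<open>8 * pi\<close> that
  \<open>p\<close> absorbs.\<close>

lemma arc_le_energy:
  fixes \<alpha> L :: real
  assumes L: "0 < L" "L \<le> 2 * pi"
  defines "a \<equiv> (1 - L / (4 * pi)) *\<^sub>R cis (\<alpha> + L / 2)"
  shows "cmod a < 1" "QK_arc_integral K f \<alpha> L \<le> ennreal (p (8 * pi)) * circle_energy a"
proof -
  have Lpi: "L / (4 * pi) \<le> 1 / 2" using L by (simp add: field_simps)
  then have "0 \<le> 1 - L / (4 * pi)" by linarith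
  then have na: "cmod a = 1 - L / (4 * pi)"
    by (simp only: a_def norm_scaleR norm_cis mult_1_right abs_of_nonneg)
  show a: "cmod a < 1" unfolding na using L by simp
  have h: "L / (4 * pi) \<le> 1 - (cmod a)\<^sup>2"
  proof -
    have "(cmod a)\<^sup>2 \<le> cmod a * 1" unfolding power2_eq_square using a by (intro mult_left_mono) auto
    then show ?thesis using na by simp
  qed
  have h0: "0 \<le> 1 - (cmod a)\<^sup>2" using a by (simp add: abs_square_le_1)
  have near: "cmod (cis x - a) \<le> L" if "x \<in> {\<alpha>..\<alpha>+L}" for x
  proof -
    have "cis (\<alpha> + L / 2) - a = (L / (4 * pi)) *\<^sub>R cis (\<alpha> + L / 2)"
      by (simp add: a_def algebra_simps)
    then have "cmod (cis (\<alpha> + L / 2) - a) = L / (4 * pi)" using L by simp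
    moreover have "L / (4 * pi) \<le> L / 2"
      using L pi_ge_two by (intro divide_left_mono mult_pos_pos) auto
    moreover have "cmod (cis x - cis (\<alpha> + L / 2)) \<le> L / 2"
      using cmod_cis_diff_le[of x "\<alpha> + L / 2"] that by (auto simp: abs_le_iff)
    ultimately show ?thesis
      using norm_triangle_ineq[of "cis x - cis (\<alpha> + L / 2)" "cis (\<alpha> + L / 2) - a"] by simp
  qed
  have "QK_arc_integral K f \<alpha> L \<le> rect_integral {\<alpha>..\<alpha>+L} {\<alpha>..\<alpha>+L}
     (\<lambda>x y. ennreal (p (8 * pi)) * ennreal (osc x y * (K (mchord a x y / 2) / (chord x y)\<^sup>2)))"
    unfolding QK_arc_integral_eq
  proof (rule rect_integral_mono)
    fix x y assume xy: "x \<in> {\<alpha>..\<alpha>+L}" "y \<in> {\<alpha>..\<alpha>+L}"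
    show "ennreal (osc x y / (chord x y)\<^sup>2 * K (chord x y / L))
      \<le> ennreal (p (8 * pi)) * ennreal (osc x y * (K (mchord a x y / 2) / (chord x y)\<^sup>2))"
    proof (cases "chord x y = 0")
      case True then show ?thesis by (simp add: osc_eq_0)
    next
      case False
      then have ch: "0 < chord x y" by (simp add: order_less_le)
      define A B where "A = cmod (cis x - a)" and "B = cmod (cis y - a)"
      have AB: "0 < A" "A \<le> L" "0 < B" "B \<le> L"
        using near[OF xy(1)] near[OF xy(2)] cis_diff_pos[OF a] by (auto simp: A_def B_def)
      have "chord x y / (4 * pi * L) = L / (4 * pi) * chord x y / (L * L)"
        using L by simp
      also have "\<dots> \<le> (1 - (cmod a)\<^sup>2) * chord x y / (A * B)"
        using AB h h0 L by (intro frac_le mult_mono mult_pos_pos mult_nonneg_nonneg) auto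
      also have "\<dots> = mchord a x y" unfolding mchord_eq[OF a] A_def B_def ..
      finally have t: "chord x y / (8 * pi * L) \<le> mchord a x y / 2" by (simp add: mult_ac)
      \<comment> \<open>Puts \<open>chord x y / (8 * pi * L)\<close> into (0,1], as
        \<open>K_le_p\<close> demands.\<close>
      have "chord x y \<le> L" using cmod_cis_diff_le[of x y] xy by (auto simp: chord_def abs_le_iff)
      moreover have "1 \<le> 8 * pi" using pi_ge_two by simp
      then have "1 * L \<le> 8 * pi * L" using L by (intro mult_right_mono) auto
      ultimately have "chord x y \<le> 8 * pi * L" by simp
      then have "K (8 * pi * (chord x y / (8 * pi * L))) \<le> p (8 * pi) * K (chord x y / (8 * pi * L))"
        using ch L by (intro K_le_p) auto
      also have "\<dots> \<le> p (8 * pi) * K (mchord a x y / 2)"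
        using p_nonneg monoD[OF mono t] by (intro mult_left_mono)
      finally have "K (chord x y / L) \<le> p (8 * pi) * K (mchord a x y / 2)" by simp
      then have "osc x y / (chord x y)\<^sup>2 * K (chord x y / L)
        \<le> osc x y / (chord x y)\<^sup>2 * (p (8 * pi) * K (mchord a x y / 2))"
        by (intro mult_left_mono) auto
      also have "\<dots> = p (8 * pi) * (osc x y * (K (mchord a x y / 2) / (chord x y)\<^sup>2))" by simp
      finally show ?thesis using p_nonneg nonneg by (simp only: ennreal_mult'[symmetric] ennreal_leI)
    qed
  qed
  also have "\<dots> = ennreal (p (8 * pi)) * rect_integral {\<alpha>..\<alpha>+L} {\<alpha>..\<alpha>+L}
     (\<lambda>x y. ennreal (osc x y * (K (mchord a x y / 2) / (chord x y)\<^sup>2)))"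
    by (rule rect_integral_cmult) measurable
  also have "\<dots> \<le> ennreal (p (8 * pi)) * circle_energy a"
    unfolding circle_energy_eq[of a \<alpha>] using L by (intro mult_left_mono rect_integral_subset) auto
  finally show "QK_arc_integral K f \<alpha> L \<le> ennreal (p (8 * pi)) * circle_energy a" .
qed

text \<open>With \<open>t = chord x y / L\<close> the bound \<open>K t \<ge> c * t^2\<close> cancels
  the squared chord and leaves \<open>osc x y / L^2\<close>.\<close>

lemma osc_arc_le:
  "\<exists>B\<ge>0. \<forall>\<alpha> L. 0 < L \<longrightarrow> rect_integral {\<alpha>..\<alpha>+L} {\<alpha>..\<alpha>+L} (\<lambda>x y. ennreal (osc x y))
     \<le> ennreal (B * L\<^sup>2) * QK_arc_integral K f \<alpha> L"
proof -
  obtain c where c: "c > 0" "\<And>t. 0 < t \<Longrightarrow> t \<le> 1 \<Longrightarrow> c * t\<^sup>2 \<le> K t" using K_ge_square by blast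
  have "rect_integral {\<alpha>..\<alpha>+L} {\<alpha>..\<alpha>+L} (\<lambda>x y. ennreal (osc x y))
     \<le> ennreal (1 / c * L\<^sup>2) * QK_arc_integral K f \<alpha> L" if L: "0 < L" for \<alpha> L
  proof -
    have "rect_integral {\<alpha>..\<alpha>+L} {\<alpha>..\<alpha>+L} (\<lambda>x y. ennreal (osc x y))
      \<le> rect_integral {\<alpha>..\<alpha>+L} {\<alpha>..\<alpha>+L} (\<lambda>x y. ennreal (1 / c * L\<^sup>2) *
           ennreal (osc x y / (chord x y)\<^sup>2 * K (chord x y / L)))"
    proof (rule rect_integral_mono)
      fix x y assume xy: "x \<in> {\<alpha>..\<alpha>+L}" "y \<in> {\<alpha>..\<alpha>+L}"
      show "ennreal (osc x y) \<le> ennreal (1 / c * L\<^sup>2) * ennreal (osc x y / (chord x y)\<^sup>2 * K (chord x y / L))"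
      proof (cases "chord x y = 0")
        case True then show ?thesis by (simp add: osc_eq_0)
      next
        case False
        then have ch: "0 < chord x y" by (simp add: order_less_le)
        have "chord x y \<le> L" using cmod_cis_diff_le[of x y] xy by (auto simp: chord_def abs_le_iff)
        then have "c * (chord x y / L)\<^sup>2 \<le> K (chord x y / L)" using ch L by (intro c(2)) auto
        then have "1 / c * L\<^sup>2 * (osc x y / (chord x y)\<^sup>2) * (c * (chord x y / L)\<^sup>2)
          \<le> 1 / c * L\<^sup>2 * (osc x y / (chord x y)\<^sup>2) * K (chord x y / L)"
          using c(1) by (intro mult_left_mono) auto
        moreover have "1 / c * L\<^sup>2 * (osc x y / (chord x y)\<^sup>2) * (c * (chord x y / L)\<^sup>2) = osc x y"
          using c(1) ch L by (simp add: power_divide)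
        ultimately show ?thesis
          using c(1) by (subst ennreal_mult'[symmetric]) (auto intro!: ennreal_leI simp: mult.assoc)
      qed
    qed
    also have "\<dots> = ennreal (1 / c * L\<^sup>2) * QK_arc_integral K f \<alpha> L"
      unfolding QK_arc_integral_eq by (rule rect_integral_cmult) measurable
    finally show ?thesis .
  qed
  then show ?thesis using c(1) by (intro exI[of _ "1 / c"]) auto
qed

text \<open>\<open>osc_triangle\<close> integrated over \<open>x\<close> in \<open>A\<close>,
  \<open>y\<close> in \<open>B\<close> and the intermediate point \<open>t\<close> in
  \<open>C\<close>; in each term the variable that does not occur contributes the measure of its
  set.\<close>

lemma osc_rect_chain:
  assumes [measurable]: "A \<in> sets borel" "B \<in> sets borel" "C \<in> sets borel"
  shows "emeasure lborel C * rect_integral A B (\<lambda>x y. ennreal (osc x y))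
    \<le> ennreal (3/2) * emeasure lborel B * rect_integral A C (\<lambda>x y. ennreal (osc x y))
      + ennreal 3 * emeasure lborel A * rect_integral C B (\<lambda>x y. ennreal (osc x y))"
proof -
  let ?I = "\<lambda>x y t. indicator A x * indicator B y * indicator C t :: ennreal"
  have "emeasure lborel C * rect_integral A B (\<lambda>x y. ennreal (osc x y))
    = (\<integral>\<^sup>+x. \<integral>\<^sup>+y. \<integral>\<^sup>+t. ?I x y t * ennreal (osc x y) \<partial>lborel \<partial>lborel \<partial>lborel)"
  proof -
    have "(\<integral>\<^sup>+t. ?I x y t * ennreal (osc x y) \<partial>lborel) = emeasure lborel C * (indicator A x * indicator B y * ennreal (osc x y))" for x y
    proof -
      have "(\<integral>\<^sup>+t. ?I x y t * ennreal (osc x y) \<partial>lborel) = (\<integral>\<^sup>+t. (indicator A x * indicator B y * ennreal (osc x y)) * indicator C t \<partial>lborel)"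
        by (intro nn_integral_cong) (simp add: mult_ac)
      also have "\<dots> = (indicator A x * indicator B y * ennreal (osc x y)) * emeasure lborel C"
        by (rule nn_integral_cmult_indicator) simp
      finally show ?thesis by (simp add: mult.commute)
    qed
    then show ?thesis unfolding rect_integral_def by (simp add: nn_integral_cmult)
  qed
  also have "\<dots> \<le> (\<integral>\<^sup>+x. \<integral>\<^sup>+y. \<integral>\<^sup>+t. ennreal (3/2) * (?I x y t * ennreal (osc x t))
      + ennreal 3 * (?I x y t * ennreal (osc t y)) \<partial>lborel \<partial>lborel \<partial>lborel)"
  proof (intro nn_integral_mono)
    fix x y t
    have "ennreal (osc x y) \<le> ennreal (3/2 * osc x t + 3 * osc t y)"
      by (rule ennreal_leI[OF osc_triangle])
    also have "\<dots> = ennreal (3/2) * ennreal (osc x t) + ennreal 3 * ennreal (osc t y)"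
      by (simp only: ennreal_plus[OF mult_nonneg_nonneg mult_nonneg_nonneg] ennreal_mult' osc_nonneg
        zero_le_numeral zero_le_divide_iff simp_thms)
    finally show "?I x y t * ennreal (osc x y) \<le> ennreal (3/2) * (?I x y t * ennreal (osc x t))
      + ennreal 3 * (?I x y t * ennreal (osc t y))"
      by (auto split: split_indicator)
  qed
  also have "\<dots> = ennreal (3/2) * (\<integral>\<^sup>+x. \<integral>\<^sup>+y. \<integral>\<^sup>+t. ?I x y t * ennreal (osc x t) \<partial>lborel \<partial>lborel \<partial>lborel)
      + ennreal 3 * (\<integral>\<^sup>+x. \<integral>\<^sup>+y. \<integral>\<^sup>+t. ?I x y t * ennreal (osc t y) \<partial>lborel \<partial>lborel \<partial>lborel)"
    by (simp add: nn_integral_add nn_integral_cmult del: ennreal_numeral)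
  also have "(\<integral>\<^sup>+x. \<integral>\<^sup>+y. \<integral>\<^sup>+t. ?I x y t * ennreal (osc x t) \<partial>lborel \<partial>lborel \<partial>lborel)
    = emeasure lborel B * rect_integral A C (\<lambda>x y. ennreal (osc x y))"
  proof -
    have "(\<integral>\<^sup>+y. \<integral>\<^sup>+t. ?I x y t * ennreal (osc x t) \<partial>lborel \<partial>lborel)
      = emeasure lborel B * (\<integral>\<^sup>+t. indicator A x * indicator C t * ennreal (osc x t) \<partial>lborel)" for x
    proof -
      have "(\<integral>\<^sup>+y. \<integral>\<^sup>+t. ?I x y t * ennreal (osc x t) \<partial>lborel \<partial>lborel)
        = (\<integral>\<^sup>+y. \<integral>\<^sup>+t. indicator B y * (indicator A x * indicator C t * ennreal (osc x t)) \<partial>lborel \<partial>lborel)"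
        by (intro nn_integral_cong) (simp add: mult_ac)
      also have "\<dots> = (\<integral>\<^sup>+y. (\<integral>\<^sup>+t. indicator A x * indicator C t * ennreal (osc x t) \<partial>lborel) * indicator B y \<partial>lborel)"
        by (subst nn_integral_cmult) (auto simp: mult.commute)
      also have "\<dots> = (\<integral>\<^sup>+t. indicator A x * indicator C t * ennreal (osc x t) \<partial>lborel) * emeasure lborel B"
        by (rule nn_integral_cmult_indicator) simp
      finally show ?thesis by (simp add: mult.commute)
    qed
    then show ?thesis unfolding rect_integral_def by (simp add: nn_integral_cmult)
  qed
  also have "(\<integral>\<^sup>+x. \<integral>\<^sup>+y. \<integral>\<^sup>+t. ?I x y t * ennreal (osc t y) \<partial>lborel \<partial>lborel \<partial>lborel)
    = emeasure lborel A * rect_integral C B (\<lambda>x y. ennreal (osc x y))"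
  proof -
    have "(\<integral>\<^sup>+x. \<integral>\<^sup>+y. \<integral>\<^sup>+t. ?I x y t * ennreal (osc t y) \<partial>lborel \<partial>lborel \<partial>lborel)
      = (\<integral>\<^sup>+x. (\<integral>\<^sup>+y. \<integral>\<^sup>+t. indicator B y * indicator C t * ennreal (osc t y) \<partial>lborel \<partial>lborel) * indicator A x \<partial>lborel)"
      by (subst nn_integral_multc[symmetric], measurable, subst nn_integral_multc[symmetric], measurable)
         (intro nn_integral_cong, simp add: mult_ac)
    also have "\<dots> = (\<integral>\<^sup>+y. \<integral>\<^sup>+t. indicator B y * indicator C t * ennreal (osc t y) \<partial>lborel \<partial>lborel) * emeasure lborel A"
      by (rule nn_integral_cmult_indicator) simp
    also have "(\<integral>\<^sup>+y. \<integral>\<^sup>+t. indicator B y * indicator C t * ennreal (osc t y) \<partial>lborel \<partial>lborel)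
      = rect_integral C B (\<lambda>x y. ennreal (osc x y))"
      using rect_integral_swap[of "\<lambda>x y. ennreal (osc x y)" C B] by (simp add: rect_integral_def)
    finally show ?thesis by (simp add: mult.commute)
  qed
  finally show ?thesis by (simp add: mult.assoc)
qed

end

section \<open>Dyadic rings and the bound of the energy by arc integrals\<close>

lemma exists_dyadic_scale:
  fixes u :: real assumes "0 < u" "u \<le> 1"
  obtains N where "(1/2) ^ Suc N < u" "u \<le> (1/2) ^ N"
proof -
  obtain m where m: "(1/2::real) ^ m < u" using real_arch_pow_inv[OF assms(1), of "1/2"] by auto
  define n where "n = (LEAST n. (1/2::real) ^ n < u)"
  have n: "(1/2::real) ^ n < u" unfolding n_def using m by (rule LeastI)
  then have "n \<noteq> 0" using assms by (intro notI) simp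
  then obtain N where N: "n = Suc N" by (cases n) auto
  have "\<not> (1/2::real) ^ N < u" using not_less_Least[of N] N unfolding n_def[symmetric] by (metis lessI n_def not_less_Least)
  then show ?thesis using that n N by simp
qed

text \<open>Assigns a point its ring. The index \<open>N\<close> is the innermost arc, of size
  comparable to \<open>1 - |a|\<close>, which is not subdivided further.\<close>

lemma exists_last_index:
  assumes "x \<in> J (0::nat)"
  obtains k where "k \<le> N" "x \<in> J k" "k = N \<or> x \<notin> J (Suc k)"
proof -
  have "\<exists>k\<le>N. x \<in> J k \<and> (k = N \<or> x \<notin> J (Suc k))"
  proof (induction N)
    case (Suc N)
    then obtain k where k: "k \<le> N" "x \<in> J k" "k = N \<or> x \<notin> J (Suc k)" by blast
    show ?case
    proof (cases "x \<in> J (Suc k)")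
      case True
      then show ?thesis using k by blast
    next
      case False
      then show ?thesis using k by (intro exI[of _ k]) auto
    qed
  qed (use assms in auto)
  then show ?thesis using that by blast
qed

text \<open>Level 0 is a full window centred at \<phi>, and deeper levels are smaller. The endpoints
  have the shape \<alpha> and \<alpha> + L of the arc integrals, with L equal to
  \<open>2 * pi * (1/2)^k\<close>.\<close>

definition dyadic_arc :: "real \<Rightarrow> nat \<Rightarrow> real set" where
  "dyadic_arc \<phi> k = {\<phi> - pi * (1/2) ^ k .. \<phi> - pi * (1/2) ^ k + 2 * pi * (1/2) ^ k}"

lemma mem_dyadic_arc: "x \<in> dyadic_arc \<phi> k \<longleftrightarrow> \<bar>x - \<phi>\<bar> \<le> pi * (1/2) ^ k"
  by (auto simp: dyadic_arc_def)

lemma dyadic_arc_subset: "k \<le> l \<Longrightarrow> dyadic_arc \<phi> l \<subseteq> dyadic_arc \<phi> k"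
proof
  fix x assume "k \<le> l" "x \<in> dyadic_arc \<phi> l"
  then have "\<bar>x - \<phi>\<bar> \<le> pi * (1/2) ^ l" "pi * (1/2) ^ l \<le> pi * (1/2) ^ k"
    by (auto simp: mem_dyadic_arc intro!: mult_left_mono power_decreasing)
  then show "x \<in> dyadic_arc \<phi> k" unfolding mem_dyadic_arc by linarith
qed

lemma sets_dyadic_arc [measurable]: "dyadic_arc \<phi> k \<in> sets borel"
  by (simp add: dyadic_arc_def)

lemma emeasure_dyadic_arc: "emeasure lborel (dyadic_arc \<phi> k) = ennreal (2 * pi * (1/2) ^ k)"
  by (simp add: dyadic_arc_def)

text \<open>The point \<open>cis \<phi>\<close> is at distance \<open>1 - cmod a\<close> from
  \<open>a\<close>, which no other point of the circle undercuts. So the chord from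
  \<open>cis x\<close> to \<open>cis \<phi>\<close> is at most twice the distance from
  \<open>cis x\<close> to \<open>a\<close>.\<close>

lemma dist_circle_ge:
  assumes "cmod a < 1" "a = of_real (cmod a) * cis \<phi>"
  shows "1 - cmod a \<le> cmod (cis x - a)"
    and "\<bar>x - \<phi>\<bar> \<le> pi \<Longrightarrow> \<bar>x - \<phi>\<bar> / pi \<le> cmod (cis x - a)"
proof -
  show 1: "1 - cmod a \<le> cmod (cis x - a)"
    using norm_triangle_ineq2[of "cis x" a] by simp
  have "a - cis \<phi> = of_real (cmod a - 1) * cis \<phi>"
    by (subst assms(2)) (simp add: algebra_simps)
  then have "cmod (a - cis \<phi>) = \<bar>cmod a - 1\<bar>"
    by (simp only: norm_mult norm_of_real norm_cis mult_1_right)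
  then have "cmod (cis x - cis \<phi>) \<le> 2 * cmod (cis x - a)"
    using 1 norm_triangle_ineq[of "cis x - a" "a - cis \<phi>"] assms(1) by simp
  moreover assume "\<bar>x - \<phi>\<bar> \<le> pi"
  ultimately show "\<bar>x - \<phi>\<bar> / pi \<le> cmod (cis x - a)"
    using cmod_cis_diff_ge[of x \<phi>] by simp
qed

context QK_circle begin

text \<open>Induction on the gap, with the previous arc as intermediate set. In units of
  \<open>B\<close> times the two scales the constants satisfy
  \<open>e (d + 1) = 3/2 * e d + 6\<close> and \<open>e 0 = 1\<close>; the 6 is the 3 of
  \<open>osc_rect_chain\<close> doubled by the halved scale. The solution is
  \<open>13 * (3/2)^d - 12\<close>.\<close>

lemma osc_dyadic_chain:
  assumes B: "0 \<le> B"
    and diag: "\<And>k. rect_integral (dyadic_arc \<phi> k) (dyadic_arc \<phi> k) (\<lambda>x y. ennreal (osc x y))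
      \<le> ennreal (B * ((1/2) ^ k)\<^sup>2)"
  shows "rect_integral (dyadic_arc \<phi> k) (dyadic_arc \<phi> (k + d)) (\<lambda>x y. ennreal (osc x y))
      \<le> ennreal ((13 * (3/2) ^ d - 12) * B * ((1/2) ^ k * (1/2) ^ (k + d)))"
proof (induction d)
  case 0
  then show ?case using diag[of k] by (simp add: power2_eq_square)
next
  case (Suc d)
  let ?O = "\<lambda>x y. ennreal (osc x y)" and ?J = "dyadic_arc \<phi>" and ?h = "\<lambda>k. (1/2::real) ^ k"
  let ?l = "k + d"
  have e: "0 \<le> 13 * (3/2::real) ^ d - 12" using one_le_power[of "3/2::real" d] by linarith
  have "rect_integral (?J ?l) (?J (Suc ?l)) ?O \<le> rect_integral (?J ?l) (?J ?l) ?O"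
    by (intro rect_integral_subset dyadic_arc_subset) auto
  also note diag
  finally have 1: "rect_integral (?J ?l) (?J (Suc ?l)) ?O \<le> ennreal (B * (?h ?l)\<^sup>2)" .
  have "ennreal (2 * pi * ?h ?l) * rect_integral (?J k) (?J (Suc ?l)) ?O
    \<le> ennreal (3/2) * ennreal (2 * pi * ?h (Suc ?l)) * rect_integral (?J k) (?J ?l) ?O
      + ennreal 3 * ennreal (2 * pi * ?h k) * rect_integral (?J ?l) (?J (Suc ?l)) ?O"
    unfolding emeasure_dyadic_arc[of \<phi>, symmetric] by (rule osc_rect_chain) measurable
  also have "\<dots> \<le> ennreal (3/2) * ennreal (2 * pi * ?h (Suc ?l)) * ennreal ((13 * (3/2) ^ d - 12) * B * (?h k * ?h ?l))
      + ennreal 3 * ennreal (2 * pi * ?h k) * ennreal (B * (?h ?l)\<^sup>2)"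
    by (intro add_mono mult_left_mono Suc.IH 1) auto
  also have "\<dots> = ennreal (3/2 * (2 * pi * ?h (Suc ?l)) * ((13 * (3/2) ^ d - 12) * B * (?h k * ?h ?l))
      + 3 * (2 * pi * ?h k) * (B * (?h ?l)\<^sup>2))"
  proof -
    have *: "ennreal a * ennreal b * ennreal c + ennreal a' * ennreal b' * ennreal c' = ennreal (a * b * c + a' * b' * c')"
      if "0 \<le> a" "0 \<le> b" "0 \<le> c" "0 \<le> a'" "0 \<le> b'" "0 \<le> c'" for a b c a' b' c'
      using that by (simp add: ennreal_mult ennreal_plus)
    show ?thesis by (rule *) (use B e in auto)
  qed
  also have "3/2 * (2 * pi * ?h (Suc ?l)) * ((13 * (3/2) ^ d - 12) * B * (?h k * ?h ?l))
      + 3 * (2 * pi * ?h k) * (B * (?h ?l)\<^sup>2)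
    = (2 * pi * ?h ?l) * ((13 * (3/2) ^ Suc d - 12) * B * (?h k * ?h (Suc ?l)))"
    by (simp add: power2_eq_square algebra_simps)
  finally have "ennreal (2 * pi * ?h ?l) * rect_integral (?J k) (?J (Suc ?l)) ?O
    \<le> ennreal ((2 * pi * ?h ?l) * ((13 * (3/2) ^ Suc d - 12) * B * (?h k * ?h (Suc ?l))))" .
  also have "\<dots> = ennreal (2 * pi * ?h ?l) * ennreal ((13 * (3/2) ^ Suc d - 12) * B * (?h k * ?h (Suc ?l)))"
    by (rule ennreal_mult') simp
  finally have "rect_integral (?J k) (?J (Suc ?l)) ?O \<le> ennreal ((13 * (3/2) ^ Suc d - 12) * B * (?h k * ?h (Suc ?l)))"
    by (subst (asm) ennreal_mult_le_mult_iff) auto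
  then show ?case by simp
qed

text \<open>\<open>k\<close> and \<open>l\<close> index the dyadic rings around \<open>a\<close> that contain \<open>x\<close> and \<open>y\<close>. If the rings are
  comparable, the Moebius-invariant weight is controlled by the weight of the common arc; otherwise the chord
  is comparable to the larger ring, and only the oscillation remains.\<close>

lemma energy_density_le:
  assumes a: "cmod a < 1" "a = of_real (cmod a) * cis \<phi>"
    and N: "(1/2) ^ Suc N < 1 - cmod a" "1 - cmod a \<le> (1/2) ^ N"
    and kl: "k \<le> l" "l \<le> N"
    and x: "x \<in> dyadic_arc \<phi> k" "k = N \<or> x \<notin> dyadic_arc \<phi> (Suc k)"
    and y: "y \<in> dyadic_arc \<phi> l" "l = N \<or> y \<notin> dyadic_arc \<phi> (Suc l)"
  shows "(l \<le> k + 2 \<and> osc x y * (K (mchord a x y / 2) / (chord x y)\<^sup>2)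
        \<le> p (128 * (1/2) ^ (N - k)) * (osc x y / (chord x y)\<^sup>2 * K (chord x y / (2 * pi * (1/2) ^ k))))
    \<or> osc x y * (K (mchord a x y / 2) / (chord x y)\<^sup>2) \<le> 4 * 4 ^ k * p (128 * (1/2) ^ (N - l)) * K 1 * osc x y"
proof (cases "chord x y = 0")
  case True
  have "0 \<le> K 1" by (rule nonneg)
  then show ?thesis using osc_eq_0[OF True] by simp
next
  case False
  let ?h = "\<lambda>k. (1/2::real) ^ k"
  have ch: "0 < chord x y" using False by (simp add: order_less_le)
  \<comment> \<open>In the innermost arc the depth \<open>1 - cmod a\<close> gives the bound,
    outside it the angular distance from \<phi>.\<close>
  have ring: "?h (Suc j) \<le> cmod (cis z - a)"
    if "z \<in> dyadic_arc \<phi> j" "j = N \<or> z \<notin> dyadic_arc \<phi> (Suc j)" for z j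
  proof (cases "j = N")
    case True
    then show ?thesis using dist_circle_ge(1)[OF a, of z] N(1) by simp
  next
    case False
    then have "pi * ?h (Suc j) < \<bar>z - \<phi>\<bar>" using that by (simp add: mem_dyadic_arc)
    then have "?h (Suc j) \<le> \<bar>z - \<phi>\<bar> / pi" by (simp add: pos_le_divide_eq mult.commute)
    moreover have "\<bar>z - \<phi>\<bar> \<le> pi" using that(1) dyadic_arc_subset[of 0 j \<phi>] by (auto simp: mem_dyadic_arc)
    ultimately show ?thesis using dist_circle_ge(2)[OF a, of z] by linarith
  qed
  define A B where "A = cmod (cis x - a)" and "B = cmod (cis y - a)"
  have AB: "?h (Suc k) \<le> A" "?h (Suc l) \<le> B" unfolding A_def B_def using ring x y by blast+
  have "1 - (cmod a)\<^sup>2 = (1 - cmod a) * (1 + cmod a)" by (simp add: power2_eq_square algebra_simps)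
  also have "\<dots> \<le> ?h N * 2" using a(1) N(2) by (intro mult_mono) auto
  finally have h: "1 - (cmod a)\<^sup>2 \<le> 2 * ?h N" by simp
  have h0: "0 \<le> 1 - (cmod a)\<^sup>2" using a(1) by (simp add: abs_square_le_1)
  have AB0: "0 < ?h (Suc k) * ?h (Suc l)" by simp
  have "mchord a x y \<le> 2 * ?h N * chord x y / (?h (Suc k) * ?h (Suc l))"
    unfolding mchord_eq[OF a(1)] A_def[symmetric] B_def[symmetric]
    using h h0 AB AB0 by (intro frac_le mult_mono) (auto simp: A_def)
  \<comment> \<open>The factor 4 is the 2 bounding \<open>1 + cmod a\<close>, doubled by each
    \<open>Suc\<close> of the ring bounds, and halved.\<close>
  then have t: "mchord a x y / 2 \<le> 4 * ?h N * 2 ^ k * 2 ^ l * chord x y"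
    by (simp add: power_one_over field_simps)
  have hN: "?h (N - j) = ?h N * 2 ^ j" if "j \<le> N" for j
    using that by (simp add: power_diff power_one_over field_simps)
  have rl: "pi * ?h l \<le> pi * ?h k" using kl by (intro mult_left_mono power_decreasing) auto
  have xy: "\<bar>x - y\<bar> \<le> 2 * pi * ?h k"
    using x(1) y(1) rl unfolding mem_dyadic_arc by linarith
  then have chk: "chord x y \<le> 2 * pi * ?h k"
    using cmod_cis_diff_le[of x y] by (simp add: chord_def)
  have pi4: "pi \<le> 4" using pi_less_4 by simp
  show ?thesis
  proof (cases "l \<le> k + 2")
    case True
    then have "(2::real) ^ l \<le> 2 ^ (k + 2)" by (intro power_increasing) auto
    then have "4 * ?h N * 2 ^ k * 2 ^ l * chord x y \<le> 4 * ?h N * 2 ^ k * 2 ^ (k + 2) * chord x y"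
      by (intro mult_left_mono mult_right_mono) auto
    also have "\<dots> = 16 * (?h N * 2 ^ k * 2 ^ k * chord x y)" by simp
    \<comment> \<open>Enlarging 16 to \<open>64 / pi\<close> lets the chord be divided by the arc
      length \<open>2 * pi * ?h k\<close>; this is the origin of 128.\<close>
    also have "\<dots> \<le> 64 / pi * (?h N * 2 ^ k * 2 ^ k * chord x y)"
      using pi4 by (intro mult_right_mono) (auto simp: field_simps)
    also have "\<dots> = 128 * ?h (N - k) * (chord x y / (2 * pi * ?h k))"
      unfolding hN[OF order_trans[OF kl]] by (simp add: power_one_over field_simps)
    finally have "mchord a x y / 2 \<le> 128 * ?h (N - k) * (chord x y / (2 * pi * ?h k))" using t by simp
    then have "K (mchord a x y / 2) \<le> K (128 * ?h (N - k) * (chord x y / (2 * pi * ?h k)))"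
      by (rule monoD[OF mono])
    also have "\<dots> \<le> p (128 * ?h (N - k)) * K (chord x y / (2 * pi * ?h k))"
      using ch chk by (intro K_le_p) (auto simp: pos_divide_le_eq)
    finally have "osc x y / (chord x y)\<^sup>2 * K (mchord a x y / 2)
      \<le> osc x y / (chord x y)\<^sup>2 * (p (128 * ?h (N - k)) * K (chord x y / (2 * pi * ?h k)))"
      by (intro mult_left_mono) auto
    then show ?thesis using True by (simp add: mult_ac)
  next
    case False
    \<comment> \<open>Three levels of gap suffice: \<open>cis x\<close> is at least
      \<open>?h k\<close> away from \<open>cis \<phi>\<close>, and \<open>cis y\<close> at most
      \<open>pi * ?h k / 8\<close>, which is below half of it.\<close>
    have kN: "k \<noteq> N" and kl3: "k + 3 \<le> l" using False kl by auto
    have "pi * ?h (Suc k) < \<bar>x - \<phi>\<bar>" using x(2) kN by (simp add: mem_dyadic_arc)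
    then have "?h k \<le> 2 * \<bar>x - \<phi>\<bar> / pi" by (simp add: field_simps)
    also have "\<dots> \<le> cmod (cis x - cis \<phi>)"
      using x(1) dyadic_arc_subset[of 0 k \<phi>] by (intro cmod_cis_diff_ge) (auto simp: mem_dyadic_arc)
    finally have 1: "?h k \<le> cmod (cis x - cis \<phi>)" .
    have "cmod (cis y - cis \<phi>) \<le> pi * ?h l"
      using cmod_cis_diff_le[of y \<phi>] y(1) by (simp add: mem_dyadic_arc)
    also have "\<dots> \<le> pi * ?h (k + 3)" using kl3 by (intro mult_left_mono power_decreasing) auto
    also have "\<dots> \<le> ?h k / 2" using pi4 by (simp add: power_add field_simps)
    finally have 2: "?h k / 2 \<le> chord x y"
      using 1 norm_triangle_ineq[of "cis x - cis y" "cis y - cis \<phi>"] by (simp add: chord_def)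
    \<comment> \<open>The chord is estimated by the arc length of level \<open>k\<close>, which
      cancels \<open>2^k\<close> and leaves the scale of the deeper ring \<open>l\<close>. The
      constant \<open>8 * pi\<close> is raised to 128 to match the other case.\<close>
    have "K (mchord a x y / 2) \<le> K (128 * ?h (N - l) * 1)"
    proof (rule monoD[OF mono])
      have "4 * ?h N * 2 ^ k * 2 ^ l * chord x y \<le> 4 * ?h N * 2 ^ k * 2 ^ l * (2 * pi * ?h k)"
        using chk by (intro mult_left_mono) auto
      also have "\<dots> = 8 * pi * ?h (N - l)" unfolding hN[OF kl(2)] by (simp add: power_one_over field_simps)
      also have "\<dots> \<le> 128 * ?h (N - l)" using pi4 by (intro mult_right_mono) auto
      finally show "mchord a x y / 2 \<le> 128 * ?h (N - l) * 1" using t by linarith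
    qed
    also have "\<dots> \<le> p (128 * ?h (N - l)) * K 1" by (rule K_le_p) auto
    finally have k: "K (mchord a x y / 2) \<le> p (128 * ?h (N - l)) * K 1" .
    have "(?h k / 2)\<^sup>2 \<le> (chord x y)\<^sup>2" using 2 by (intro power_mono) auto
    then have "K (mchord a x y / 2) / (chord x y)\<^sup>2 \<le> p (128 * ?h (N - l)) * K 1 / (?h k / 2)\<^sup>2"
      using k nonneg p_nonneg by (intro frac_le) auto
    also have "\<dots> = 4 * 4 ^ k * p (128 * ?h (N - l)) * K 1"
    proof -
      have "(?h k / 2)\<^sup>2 = 1 / (4 * 4 ^ k)"
        by (simp add: power_divide power_mult[symmetric] mult.commute[of k 2] power_one_over) (simp add: power_mult)
      then show ?thesis by simp
    qed
    finally have "osc x y * (K (mchord a x y / 2) / (chord x y)\<^sup>2)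
      \<le> osc x y * (4 * 4 ^ k * p (128 * ?h (N - l)) * K 1)"
      by (intro mult_left_mono) auto
    then show ?thesis by (simp add: mult_ac)
  qed
qed

end

lemma sum_three_quarters_power_le: "(\<Sum>k\<le>l. (3/4::real) ^ (l - k)) \<le> 4"
proof (induction l)
  case (Suc l)
  have "(\<Sum>k\<le>Suc l. (3/4::real) ^ (Suc l - k)) = 3/4 * (\<Sum>k\<le>l. (3/4) ^ (l - k)) + 1"
    by (simp add: sum_distrib_left Suc_diff_le)
  then show ?case using Suc by simp
qed simp

context QK_circle begin

text \<open>Each pair of points belongs to one pair of rings, where a single term bounds the
  density; as the terms are nonnegative, their sum over all levels bounds it everywhere. The terms
  live on full arcs instead of rings, so that arc integrals appear.\<close>

lemma energy_le_dyadic_sum: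
  assumes a: "cmod a < 1" "a = of_real (cmod a) * cis \<phi>"
    and N: "(1/2) ^ Suc N < 1 - cmod a" "1 - cmod a \<le> (1/2) ^ N"
  defines "P \<equiv> \<lambda>l. p (128 * (1/2) ^ (N - l))"
  shows "circle_energy a
    \<le> (\<Sum>k\<le>N. ennreal (P k) * QK_arc_integral K f (\<phi> - pi * (1/2) ^ k) (2 * pi * (1/2) ^ k))
     + ennreal 2 * (\<Sum>l\<le>N. \<Sum>k\<le>l. ennreal (4 * 4 ^ k * P l * K 1)
         * rect_integral (dyadic_arc \<phi> k) (dyadic_arc \<phi> l) (\<lambda>x y. ennreal (osc x y)))"
proof -
  let ?J = "dyadic_arc \<phi>"
  define e where "e x y = osc x y * (K (mchord a x y / 2) / (chord x y)\<^sup>2)" for x y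
  define q where "q k x y = osc x y / (chord x y)\<^sup>2 * K (chord x y / (2 * pi * (1/2) ^ k))" for k :: nat and x y
  define c where "c k l = 4 * 4 ^ k * P l * K 1" for k l :: nat
  define T1 where "T1 k x y = indicator (?J k) x * indicator (?J k) y * (ennreal (P k) * ennreal (q k x y))" for k x y
  define T2 where "T2 k l x y = indicator (?J k) x * indicator (?J l) y * (ennreal (c k l) * ennreal (osc x y))" for k l x y
  have [measurable]: "case_prod (T1 k) \<in> borel_measurable (borel \<Otimes>\<^sub>M borel)"
     "case_prod (T2 k l) \<in> borel_measurable (borel \<Otimes>\<^sub>M borel)" for k l
    unfolding T1_def T2_def q_def by measurable
  have J0: "?J 0 = {\<phi> - pi..\<phi> - pi + 2 * pi}" by (simp add: dyadic_arc_def)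
  have P0: "0 \<le> P l" for l by (simp add: P_def p_nonneg)
  have c0: "0 \<le> c k l" for k l using P0 nonneg by (simp add: c_def)
  have sym: "e x y = e y x" "q k x y = q k y x" for k x y
    by (simp_all add: e_def q_def osc_commute[of x] chord_commute[of x] mchord_commute[of a x])
  have ordered: "ennreal (e x y) \<le> T1 k x y \<or> ennreal (e x y) \<le> T2 k l x y"
    if kl: "k \<le> l" "l \<le> N" and x: "x \<in> ?J k" "k = N \<or> x \<notin> ?J (Suc k)"
      and y: "y \<in> ?J l" "l = N \<or> y \<notin> ?J (Suc l)" for x y k l
  proof -
    have yk: "y \<in> ?J k" using y(1) dyadic_arc_subset[OF kl(1)] by blast
    from energy_density_le[OF a N kl x y]
    consider "e x y \<le> P k * q k x y" | "e x y \<le> c k l * osc x y"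
      unfolding e_def q_def c_def P_def by blast
    then show ?thesis
    proof cases
      case 1
      then have "ennreal (e x y) \<le> ennreal (P k) * ennreal (q k x y)"
        using P0 by (simp add: ennreal_mult'[symmetric] ennreal_leI)
      then show ?thesis using x(1) yk by (simp add: T1_def)
    next
      case 2
      then have "ennreal (e x y) \<le> ennreal (c k l) * ennreal (osc x y)"
        using c0 by (simp add: ennreal_mult'[symmetric] ennreal_leI)
      then show ?thesis using x(1) y(1) by (simp add: T2_def)
    qed
  qed
  \<comment> \<open>\<open>T2\<close> enters in both orders since either point may lie in the deeper
    ring; \<open>T1\<close> is symmetric.\<close>
  define W where "W x y = (\<Sum>k\<le>N. T1 k x y) + ((\<Sum>l\<le>N. \<Sum>k\<le>l. T2 k l x y) + (\<Sum>l\<le>N. \<Sum>k\<le>l. T2 k l y x))" for x y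
  have W1: "T1 k x y \<le> W x y" if "k \<le> N" for k x y
  proof -
    have "T1 k x y \<le> (\<Sum>k\<le>N. T1 k x y)" using that by (intro member_le_sum) auto
    then show ?thesis unfolding W_def by (rule order_trans) simp
  qed
  have W2: "T2 k l x y \<le> (\<Sum>l\<le>N. \<Sum>k\<le>l. T2 k l x y)" if "k \<le> l" "l \<le> N" for k l x y
  proof -
    have "T2 k l x y \<le> (\<Sum>k\<le>l. T2 k l x y)" using that by (intro member_le_sum) auto
    also have "\<dots> \<le> (\<Sum>l\<le>N. \<Sum>k\<le>l. T2 k l x y)"
      using that by (intro member_le_sum[where f = "\<lambda>l. \<Sum>k\<le>l. T2 k l x y"]) auto
    finally show ?thesis .
  qed
  have T1sym: "T1 k x y = T1 k y x" for k x y by (simp add: T1_def sym(2)[of k x] mult.commute)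
  have "circle_energy a = rect_integral (?J 0) (?J 0) (\<lambda>x y. ennreal (e x y))"
    unfolding circle_energy_eq[of a "\<phi> - pi"] J0 e_def ..
  also have "\<dots> \<le> rect_integral (?J 0) (?J 0) W"
  proof (rule rect_integral_mono)
    fix x y assume xy: "x \<in> ?J 0" "y \<in> ?J 0"
    obtain k where k: "k \<le> N" "x \<in> ?J k" "k = N \<or> x \<notin> ?J (Suc k)" using exists_last_index[of x ?J N] xy by blast
    obtain l where l: "l \<le> N" "y \<in> ?J l" "l = N \<or> y \<notin> ?J (Suc l)" using exists_last_index[of y ?J N] xy by blast
    show "ennreal (e x y) \<le> W x y"
    proof (cases "k \<le> l")
      case True
      then show ?thesis
        using ordered[OF True l(1) k(2,3) l(2,3)] W1[OF k(1), of x y] W2[OF True l(1), of x y]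
        unfolding W_def by (meson add_increasing add_increasing2 le_add_same_cancel1 order_trans zero_le)
    next
      case False
      then have lk: "l \<le> k" by simp
      have "T2 l k y x \<le> W x y"
        unfolding W_def using W2[OF lk k(1), of y x] by (intro add_increasing) auto
      then show ?thesis
        using ordered[OF lk k(1) l(2,3) k(2,3)] W1[OF l(1), of x y] unfolding sym(1)[of x y] T1sym[of l x y]
        by (meson order_trans)
    qed
  qed
  also have "\<dots> = (\<Sum>k\<le>N. rect_integral (?J 0) (?J 0) (T1 k))
      + ((\<Sum>l\<le>N. \<Sum>k\<le>l. rect_integral (?J 0) (?J 0) (T2 k l))
       + (\<Sum>l\<le>N. \<Sum>k\<le>l. rect_integral (?J 0) (?J 0) (\<lambda>x y. T2 k l y x)))"
  proof -
    have T2': "(\<lambda>(x, y). T2 k l y x) \<in> borel_measurable (borel \<Otimes>\<^sub>M borel)" for k l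
      unfolding T2_def by measurable
    have m: "case_prod (\<lambda>x y. \<Sum>i\<in>S. w i x y) \<in> borel_measurable (borel \<Otimes>\<^sub>M borel)"
      if "\<And>i. case_prod (w i) \<in> borel_measurable (borel \<Otimes>\<^sub>M borel)" for S :: "nat set" and w :: "nat \<Rightarrow> real \<Rightarrow> real \<Rightarrow> ennreal"
      using borel_measurable_sum[of S "\<lambda>i. case_prod (w i)", OF that] by (simp add: split_beta')
    have m1: "case_prod (\<lambda>x y. \<Sum>k\<le>N. T1 k x y) \<in> borel_measurable (borel \<Otimes>\<^sub>M borel)"
      by (rule m) measurable
    have m2: "case_prod (\<lambda>x y. \<Sum>k\<le>l. T2 k l x y) \<in> borel_measurable (borel \<Otimes>\<^sub>M borel)" for l
      by (rule m) measurable
    have m2': "case_prod (\<lambda>x y. \<Sum>k\<le>l. T2 k l y x) \<in> borel_measurable (borel \<Otimes>\<^sub>M borel)" for l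
      by (rule m) (rule T2')
    have m3: "case_prod (\<lambda>x y. \<Sum>l\<le>N. \<Sum>k\<le>l. T2 k l x y) \<in> borel_measurable (borel \<Otimes>\<^sub>M borel)"
      by (rule m) (rule m2)
    have m3': "case_prod (\<lambda>x y. \<Sum>l\<le>N. \<Sum>k\<le>l. T2 k l y x) \<in> borel_measurable (borel \<Otimes>\<^sub>M borel)"
      by (rule m) (rule m2')
    have m4: "case_prod (\<lambda>x y. (\<Sum>l\<le>N. \<Sum>k\<le>l. T2 k l x y) + (\<Sum>l\<le>N. \<Sum>k\<le>l. T2 k l y x)) \<in> borel_measurable (borel \<Otimes>\<^sub>M borel)"
      using borel_measurable_add[OF m3 m3'] by (simp add: split_beta')
    show ?thesis
      unfolding W_def
      by (simp add: rect_integral_add m1 m3 m3' m4 rect_integral_sum m2 m2' T2')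
  qed
  also have "(\<Sum>l\<le>N. \<Sum>k\<le>l. rect_integral (?J 0) (?J 0) (\<lambda>x y. T2 k l y x))
     = (\<Sum>l\<le>N. \<Sum>k\<le>l. rect_integral (?J 0) (?J 0) (T2 k l))"
  proof -
    have "rect_integral (?J 0) (?J 0) (T2 k l) = rect_integral (?J 0) (?J 0) (\<lambda>x y. T2 k l y x)" for k l
      by (rule rect_integral_swap) measurable
    then show ?thesis by simp
  qed
  also have "(\<Sum>l\<le>N. \<Sum>k\<le>l. rect_integral (?J 0) (?J 0) (T2 k l))
     = (\<Sum>l\<le>N. \<Sum>k\<le>l. ennreal (c k l) * rect_integral (?J k) (?J l) (\<lambda>x y. ennreal (osc x y)))"
  proof (intro sum.cong refl)
    fix k l
    have "rect_integral (?J 0) (?J 0) (T2 k l) = rect_integral (?J k) (?J l) (\<lambda>x y. ennreal (c k l) * ennreal (osc x y))"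
      unfolding T2_def by (intro rect_integral_indicator dyadic_arc_subset) auto
    also have "\<dots> = ennreal (c k l) * rect_integral (?J k) (?J l) (\<lambda>x y. ennreal (osc x y))"
      by (rule rect_integral_cmult) measurable
    finally show "rect_integral (?J 0) (?J 0) (T2 k l) = ennreal (c k l) * rect_integral (?J k) (?J l) (\<lambda>x y. ennreal (osc x y))" .
  qed
  also have "(\<Sum>k\<le>N. rect_integral (?J 0) (?J 0) (T1 k))
     = (\<Sum>k\<le>N. ennreal (P k) * QK_arc_integral K f (\<phi> - pi * (1/2) ^ k) (2 * pi * (1/2) ^ k))"
  proof (intro sum.cong refl)
    fix k
    have "rect_integral (?J 0) (?J 0) (T1 k) = rect_integral (?J k) (?J k) (\<lambda>x y. ennreal (P k) * ennreal (q k x y))"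
      unfolding T1_def by (intro rect_integral_indicator dyadic_arc_subset) auto
    also have "\<dots> = ennreal (P k) * rect_integral (?J k) (?J k) (\<lambda>x y. ennreal (q k x y))"
      unfolding q_def by (rule rect_integral_cmult) measurable
    also have "rect_integral (?J k) (?J k) (\<lambda>x y. ennreal (q k x y))
      = QK_arc_integral K f (\<phi> - pi * (1/2) ^ k) (2 * pi * (1/2) ^ k)"
      unfolding QK_arc_integral_eq q_def dyadic_arc_def ..
    finally show "rect_integral (?J 0) (?J 0) (T1 k) = ennreal (P k) * QK_arc_integral K f (\<phi> - pi * (1/2) ^ k) (2 * pi * (1/2) ^ k)" .
  qed
  also have "s + s = ennreal 2 * s" for s :: ennreal by (simp add: mult_2)
  finally show ?thesis unfolding c_def .
qed

text \<open>The weight \<open>4^k\<close>, the scales \<open>2^-k\<close> and \<open>2^-l\<close>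
  and the chain constant \<open>(3/2)^(l - k)\<close> multiply to \<open>(3/4)^(l - k)\<close>.
  Summing over \<open>k\<close> first leaves the sum of \<open>P l\<close>.\<close>

lemma energy_le_arcs:
  "\<exists>C\<ge>0. \<forall>M\<ge>0. (\<forall>\<alpha> L. 0 < L \<longrightarrow> L \<le> 2 * pi \<longrightarrow> QK_arc_integral K f \<alpha> L \<le> ennreal M)
     \<longrightarrow> (\<forall>a. cmod a < 1 \<longrightarrow> circle_energy a \<le> ennreal (C * M))"
proof -
  obtain S where S: "S \<ge> 0" "\<And>N. (\<Sum>j\<le>N. p (128 * (1/2) ^ j)) \<le> S" using p_dyadic_sum[of 128] by blast
  obtain B where B: "B \<ge> 0" "\<And>\<alpha> L. 0 < L \<Longrightarrow> rect_integral {\<alpha>..\<alpha>+L} {\<alpha>..\<alpha>+L} (\<lambda>x y. ennreal (osc x y))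
     \<le> ennreal (B * L\<^sup>2) * QK_arc_integral K f \<alpha> L" using osc_arc_le by blast
  define D where "D = B * (2 * pi)\<^sup>2"
  \<comment> \<open>\<open>S\<close> accounts for comparable rings. In the second summand 2 counts
    the two orders, 52 is \<open>4 * 13\<close>, \<open>D\<close> converts arc integrals to
    oscillation, and 4 bounds the geometric sum.\<close>
  define C where "C = S + 2 * (52 * K 1 * D * 4 * S)"
  have D0: "0 \<le> D" using B(1) by (simp add: D_def)
  have C0: "0 \<le> C" using S(1) D0 nonneg[of 1] by (simp add: C_def)
  have "circle_energy a \<le> ennreal (C * M)"
    if M: "0 \<le> M" and arcs: "\<And>\<alpha> L. 0 < L \<Longrightarrow> L \<le> 2 * pi \<Longrightarrow> QK_arc_integral K f \<alpha> L \<le> ennreal M"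
      and a: "cmod a < 1" for M a
  proof -
    let ?h = "\<lambda>k. (1/2::real) ^ k"
    define \<phi> where "\<phi> = Arg a"
    have a\<phi>: "a = of_real (cmod a) * cis \<phi>" using rcis_cmod_Arg[of a] by (simp add: rcis_def \<phi>_def)
    obtain N where N: "?h (Suc N) < 1 - cmod a" "1 - cmod a \<le> ?h N"
      using exists_dyadic_scale[of "1 - cmod a"] a by auto
    define P where "P l = p (128 * ?h (N - l))" for l
    have P0: "0 \<le> P l" for l by (simp add: P_def p_nonneg)
    \<comment> \<open>Counting levels from the innermost arc outwards makes the bound independent of
      \<open>N\<close>, hence of \<open>a\<close>.\<close>
    have "(\<Sum>l\<le>N. P l) = (\<Sum>j\<le>N. p (128 * ?h j))"
      unfolding P_def by (rule sum.reindex_bij_witness[of _ "\<lambda>i. N - i" "\<lambda>i. N - i"]) auto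
    then have PS: "(\<Sum>l\<le>N. P l) \<le> S" using S(2) by simp
    have arc: "QK_arc_integral K f (\<phi> - pi * ?h k) (2 * pi * ?h k) \<le> ennreal M" for k
      by (rule arcs) (auto simp: power_le_one)
    have diag: "rect_integral (dyadic_arc \<phi> k) (dyadic_arc \<phi> k) (\<lambda>x y. ennreal (osc x y)) \<le> ennreal (D * M * (?h k)\<^sup>2)" for k
    proof -
      have "rect_integral (dyadic_arc \<phi> k) (dyadic_arc \<phi> k) (\<lambda>x y. ennreal (osc x y))
        \<le> ennreal (B * (2 * pi * ?h k)\<^sup>2) * QK_arc_integral K f (\<phi> - pi * ?h k) (2 * pi * ?h k)"
        unfolding dyadic_arc_def by (rule B(2)) simp
      also have "\<dots> \<le> ennreal (B * (2 * pi * ?h k)\<^sup>2) * ennreal M"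
        by (intro mult_left_mono arc) auto
      also have "\<dots> = ennreal (D * M * (?h k)\<^sup>2)"
        using B(1) M by (simp add: ennreal_mult'[symmetric] D_def power_mult_distrib mult_ac)
      finally show ?thesis .
    qed
    have off: "ennreal (4 * 4 ^ k * P l * K 1) * rect_integral (dyadic_arc \<phi> k) (dyadic_arc \<phi> l) (\<lambda>x y. ennreal (osc x y))
      \<le> ennreal (52 * K 1 * (D * M) * P l * (3/4) ^ (l - k))" if "k \<le> l" for k l
    proof -
      have pos: "0 \<le> 4 * 4 ^ k * P l * K 1" using P0 nonneg[of 1] by simp
      have lk: "l = k + (l - k)" using that by simp
      have "rect_integral (dyadic_arc \<phi> k) (dyadic_arc \<phi> (k + (l - k))) (\<lambda>x y. ennreal (osc x y))
        \<le> ennreal ((13 * (3/2) ^ (l - k) - 12) * (D * M) * (?h k * ?h (k + (l - k))))"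
        using D0 M diag by (intro osc_dyadic_chain) auto
      \<comment> \<open>The summand -12, which made the induction close, is dropped.\<close>
      also have "\<dots> \<le> ennreal (13 * (3/2) ^ (l - k) * (D * M) * (?h k * ?h (k + (l - k))))"
        using D0 M by (intro ennreal_leI mult_right_mono) auto
      finally have "ennreal (4 * 4 ^ k * P l * K 1) * rect_integral (dyadic_arc \<phi> k) (dyadic_arc \<phi> l) (\<lambda>x y. ennreal (osc x y))
        \<le> ennreal (4 * 4 ^ k * P l * K 1) * ennreal (13 * (3/2) ^ (l - k) * (D * M) * (?h k * ?h (k + (l - k))))"
        unfolding lk[symmetric] by (rule mult_left_mono) simp
      also have "\<dots> = ennreal (4 * 4 ^ k * P l * K 1 * (13 * (3/2) ^ (l - k) * (D * M) * (?h k * ?h (k + (l - k)))))"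
        by (rule ennreal_mult'[symmetric]) (rule pos)
      also have "4 * 4 ^ k * P l * K 1 * (13 * (3/2) ^ (l - k) * (D * M) * (?h k * ?h (k + (l - k))))
        = 52 * K 1 * (D * M) * P l * (3/4) ^ (l - k)"
      proof -
        have "(4::real) ^ k * ((3/2) ^ d * (?h k * ?h (k + d))) = (3/4) ^ d" for d
        proof -
          have "(4::real) ^ k * ((3/2) ^ d * (?h k * ?h (k + d))) = (4 * (1/2) * (1/2)) ^ k * ((3/2) * (1/2)) ^ d"
            by (simp only: power_mult_distrib power_add mult_ac)
          then show ?thesis by simp
        qed
        from this[of "l - k"] show ?thesis by (simp add: mult_ac)
      qed
      finally show ?thesis .
    qed
    have "circle_energy a
      \<le> (\<Sum>k\<le>N. ennreal (P k) * QK_arc_integral K f (\<phi> - pi * ?h k) (2 * pi * ?h k))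
       + ennreal 2 * (\<Sum>l\<le>N. \<Sum>k\<le>l. ennreal (4 * 4 ^ k * P l * K 1)
         * rect_integral (dyadic_arc \<phi> k) (dyadic_arc \<phi> l) (\<lambda>x y. ennreal (osc x y)))"
      unfolding P_def by (rule energy_le_dyadic_sum[OF a a\<phi> N])
    also have "\<dots> \<le> (\<Sum>k\<le>N. ennreal (P k) * ennreal M)
       + ennreal 2 * (\<Sum>l\<le>N. \<Sum>k\<le>l. ennreal (52 * K 1 * (D * M) * P l * (3/4) ^ (l - k)))"
      by (intro add_mono sum_mono mult_left_mono arc off) auto
    also have "\<dots> = ennreal ((\<Sum>k\<le>N. P k * M) + 2 * (\<Sum>l\<le>N. \<Sum>k\<le>l. 52 * K 1 * (D * M) * P l * (3/4) ^ (l - k)))"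
    proof -
      have "ennreal (P k) * ennreal M = ennreal (P k * M)" for k using P0 by (simp add: ennreal_mult')
      moreover have nn: "0 \<le> 52 * K 1 * (D * M) * P l * (3/4) ^ (l - k)" for k l
        using nonneg[of 1] D0 M P0 by simp
      moreover have "ennreal x + ennreal 2 * ennreal y = ennreal (x + 2 * y)" if "0 \<le> x" "0 \<le> y" for x y
        using that by (simp add: ennreal_mult' ennreal_plus)
      ultimately show ?thesis using P0 M by (simp only: sum_ennreal sum_nonneg mult_nonneg_nonneg)
    qed
    also have "\<dots> \<le> ennreal (C * M)"
    proof (rule ennreal_leI)
      have "(\<Sum>k\<le>N. P k * M) \<le> S * M" using PS M by (simp add: sum_distrib_right[symmetric] mult_right_mono)
      moreover have "(\<Sum>l\<le>N. \<Sum>k\<le>l. 52 * K 1 * (D * M) * P l * (3/4) ^ (l - k)) \<le> 52 * K 1 * (D * M) * (4 * S)"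
      proof -
        have "(\<Sum>k\<le>l. 52 * K 1 * (D * M) * P l * (3/4) ^ (l - k)) \<le> 52 * K 1 * (D * M) * P l * 4" for l
          unfolding sum_distrib_left[symmetric] using sum_three_quarters_power_le nonneg[of 1] D0 M P0
          by (intro mult_left_mono) auto
        then have "(\<Sum>l\<le>N. \<Sum>k\<le>l. 52 * K 1 * (D * M) * P l * (3/4) ^ (l - k)) \<le> (\<Sum>l\<le>N. 52 * K 1 * (D * M) * P l * 4)"
          by (intro sum_mono)
        also have "\<dots> = 52 * K 1 * (D * M) * (4 * (\<Sum>l\<le>N. P l))"
          by (simp add: sum_distrib_left sum_distrib_right mult_ac)
        also have "\<dots> \<le> 52 * K 1 * (D * M) * (4 * S)"
          using PS nonneg[of 1] D0 M by (intro mult_left_mono) auto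
        finally show ?thesis .
      qed
      ultimately show "(\<Sum>k\<le>N. P k * M) + 2 * (\<Sum>l\<le>N. \<Sum>k\<le>l. 52 * K 1 * (D * M) * P l * (3/4) ^ (l - k)) \<le> C * M"
        unfolding C_def by (simp add: algebra_simps)
    qed
    finally show ?thesis .
  qed
  then show ?thesis using C0 by blast
qed

end

section \<open>The disk integral as an energy on the circle\<close>

context QK_circle begin

text \<open>The constant is the 1/2 of the variance identity times a factor
  \<open>1 / (2 * pi)\<close> from each of the two Poisson kernels.\<close>

lemma disk_energy_eq:
  assumes L2: "circle_L2 f" and a: "cmod a < 1"
  shows "(\<integral>\<^sup>+z\<in>ball 0 1. ennreal ((poisson_sq f z - (cmod (poisson_ext f z))\<^sup>2)
      * K (1 - (cmod (mobius a z))\<^sup>2) / (1 - (cmod z)\<^sup>2)\<^sup>2) \<partial>lborel)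
    = ennreal (1 / (8 * pi\<^sup>2)) *
      rect_integral {0..2*pi} {0..2*pi} (\<lambda>x y. ennreal (osc x y) * disk_kernel K a (cis x) (cis y))"
proof -
  have [measurable]: "ball (0::complex) 1 \<in> sets borel" by simp
  let ?I = "indicator {0..2*pi} :: real \<Rightarrow> ennreal"
  define k where "k z = K (1 - (cmod (mobius a z))\<^sup>2)" for z
  define G where "G z x y = ennreal (k z / ((cmod (cis x - z))\<^sup>2 * (cmod (cis y - z))\<^sup>2)) * indicator (ball 0 1) z" for z x y
  define c where "c x y = ennreal (1 / (8 * pi\<^sup>2)) * (?I x * ?I y * ennreal (osc x y))" for x y
  have k0: "0 \<le> k z" for z by (simp add: k_def nonneg)
  have [measurable]: "k \<in> borel_measurable borel" unfolding k_def by measurable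
  have [measurable]: "(\<lambda>p. c (g p) (h p)) \<in> borel_measurable M"
    if [measurable]: "g \<in> borel_measurable M" "h \<in> borel_measurable M" for g h and M :: "'z measure"
    unfolding c_def by measurable
  have [measurable]: "(\<lambda>p. G (u p) (g p) (h p)) \<in> borel_measurable M"
    if [measurable]: "u \<in> borel_measurable M" "g \<in> borel_measurable M" "h \<in> borel_measurable M" for u g h and M :: "'z measure"
    unfolding G_def by measurable
  have "ennreal ((poisson_sq f z - (cmod (poisson_ext f z))\<^sup>2) * k z / (1 - (cmod z)\<^sup>2)\<^sup>2) * indicator (ball 0 1) z
    = (\<integral>\<^sup>+x. \<integral>\<^sup>+y. c x y * G z x y \<partial>lborel \<partial>lborel)" for z
  proof (cases "z \<in> ball 0 1")
    case True
    then have z: "cmod z < 1" by simp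
    let ?h = "1 - (cmod z)\<^sup>2" and ?P = "poisson_kernel z"
    have h: "0 < ?h" using z by (simp add: abs_square_less_1)
    have P0: "0 \<le> ?P x" for x by (rule poisson_kernel_nonneg[OF z])
    have "ennreal ((poisson_sq f z - (cmod (poisson_ext f z))\<^sup>2) * k z / ?h\<^sup>2)
      = ennreal (poisson_sq f z - (cmod (poisson_ext f z))\<^sup>2) * ennreal (k z / ?h\<^sup>2)"
      unfolding times_divide_eq_right[symmetric] by (rule ennreal_mult'') (simp add: k0)
    also have "\<dots> = ennreal (1/2) * (\<integral>\<^sup>+x\<in>{0..2*pi}. \<integral>\<^sup>+y\<in>{0..2*pi}. ennreal (?P x * ?P y * osc x y) \<partial>lborel \<partial>lborel) * ennreal (k z / ?h\<^sup>2)"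
      unfolding poisson_variance[OF z L2 f_cis] osc_def F_def ..
    also have "\<dots> = (ennreal (1/2) * ennreal (k z / ?h\<^sup>2)) * (\<integral>\<^sup>+x\<in>{0..2*pi}. \<integral>\<^sup>+y\<in>{0..2*pi}. ennreal (?P x * ?P y * osc x y) \<partial>lborel \<partial>lborel)"
      by (simp only: mult_ac)
    also have "\<dots> = (\<integral>\<^sup>+x. \<integral>\<^sup>+y. (ennreal (1/2) * ennreal (k z / ?h\<^sup>2)) * (?I x * ?I y * ennreal (?P x * ?P y * osc x y)) \<partial>lborel \<partial>lborel)"
    proof -
      have "rect_integral {0..2*pi} {0..2*pi} (\<lambda>x y. ennreal (?P x * ?P y * osc x y))
        = (\<integral>\<^sup>+x\<in>{0..2*pi}. \<integral>\<^sup>+y\<in>{0..2*pi}. ennreal (?P x * ?P y * osc x y) \<partial>lborel \<partial>lborel)"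
        unfolding rect_integral_def
        by (intro nn_integral_cong, subst nn_integral_multc[symmetric]) (auto simp: mult_ac)
      moreover have "(ennreal (1/2) * ennreal (k z / ?h\<^sup>2)) * rect_integral {0..2*pi} {0..2*pi} (\<lambda>x y. ennreal (?P x * ?P y * osc x y))
        = rect_integral {0..2*pi} {0..2*pi} (\<lambda>x y. (ennreal (1/2) * ennreal (k z / ?h\<^sup>2)) * ennreal (?P x * ?P y * osc x y))"
        by (rule rect_integral_cmult[symmetric]) measurable
      ultimately show ?thesis unfolding rect_integral_def by (simp add: mult_ac)
    qed
    also have "\<dots> = (\<integral>\<^sup>+x. \<integral>\<^sup>+y. c x y * G z x y \<partial>lborel \<partial>lborel)"
    proof (intro nn_integral_cong)
      fix x y
      have pos: "0 < cmod (cis x - z)" "0 < cmod (cis y - z)" using cis_diff_pos[OF z] by auto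
      have "1/2 * (k z / ?h\<^sup>2) * (?P x * ?P y * osc x y)
        = 1 / (8 * pi\<^sup>2) * osc x y * (k z / ((cmod (cis x - z))\<^sup>2 * (cmod (cis y - z))\<^sup>2))"
      proof -
        have "1/2 * (m / h\<^sup>2) * ((h / (2 * pi * A)) * (h / (2 * pi * B)) * w) = 1 / (8 * pi\<^sup>2) * w * (m / (A * B))"
          if "h > 0" "A > 0" "B > 0" for m h A B w :: real
          using that by (simp add: field_simps power2_eq_square)
        then show ?thesis unfolding poisson_kernel_def using h pos by simp
      qed
      then have "ennreal (1/2) * ennreal (k z / ?h\<^sup>2) * ennreal (?P x * ?P y * osc x y)
        = ennreal (1 / (8 * pi\<^sup>2)) * ennreal (osc x y) * ennreal (k z / ((cmod (cis x - z))\<^sup>2 * (cmod (cis y - z))\<^sup>2))"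
        using k0[of z] P0 by (simp only: ennreal_mult'[symmetric] mult_nonneg_nonneg divide_nonneg_nonneg osc_nonneg
          zero_le_power2 zero_le_one zero_le_numeral)
      then show "ennreal (1/2) * ennreal (k z / ?h\<^sup>2) * (?I x * ?I y * ennreal (?P x * ?P y * osc x y)) = c x y * G z x y"
        using True unfolding c_def G_def by (auto split: split_indicator)
    qed
    finally show ?thesis using True by simp
  next
    case False
    then show ?thesis by (simp add: G_def)
  qed
  then have "(\<integral>\<^sup>+z\<in>ball 0 1. ennreal ((poisson_sq f z - (cmod (poisson_ext f z))\<^sup>2) * k z / (1 - (cmod z)\<^sup>2)\<^sup>2) \<partial>lborel)
    = (\<integral>\<^sup>+z. \<integral>\<^sup>+x. \<integral>\<^sup>+y. c x y * G z x y \<partial>lborel \<partial>lborel \<partial>lborel)"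
    by simp
  \<comment> \<open>Two applications of Tonelli move \<open>z\<close> innermost, past
    \<open>x\<close> and then past \<open>y\<close>.\<close>
  also have "\<dots> = (\<integral>\<^sup>+x. \<integral>\<^sup>+z. \<integral>\<^sup>+y. c x y * G z x y \<partial>lborel \<partial>lborel \<partial>lborel)"
    by (rule lborel_pair.Fubini'[symmetric]) measurable
  also have "\<dots> = (\<integral>\<^sup>+x. \<integral>\<^sup>+y. \<integral>\<^sup>+z. c x y * G z x y \<partial>lborel \<partial>lborel \<partial>lborel)"
    by (intro nn_integral_cong lborel_pair.Fubini'[symmetric]) measurable
  also have "\<dots> = (\<integral>\<^sup>+x. \<integral>\<^sup>+y. ennreal (1 / (8 * pi\<^sup>2)) * (?I x * ?I y * (ennreal (osc x y) * disk_kernel K a (cis x) (cis y))) \<partial>lborel \<partial>lborel)"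
  proof (intro nn_integral_cong)
    fix x y
    have "(\<integral>\<^sup>+z. c x y * G z x y \<partial>lborel) = c x y * (\<integral>\<^sup>+z. G z x y \<partial>lborel)"
      by (rule nn_integral_cmult) measurable
    then show "(\<integral>\<^sup>+z. c x y * G z x y \<partial>lborel) = ennreal (1 / (8 * pi\<^sup>2)) * (?I x * ?I y * (ennreal (osc x y) * disk_kernel K a (cis x) (cis y)))"
      unfolding c_def G_def disk_kernel_def k_def by (simp add: mult.assoc)
  qed
  also have "\<dots> = ennreal (1 / (8 * pi\<^sup>2)) *
      rect_integral {0..2*pi} {0..2*pi} (\<lambda>x y. ennreal (osc x y) * disk_kernel K a (cis x) (cis y))"
  proof -
    have "(\<lambda>p. \<integral>\<^sup>+z. G z (fst p) (snd p) \<partial>lborel) \<in> borel_measurable (borel \<Otimes>\<^sub>M borel)"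
      by measurable
    then have [measurable]: "(\<lambda>p. disk_kernel K a (cis (fst p)) (cis (snd p))) \<in> borel_measurable (borel \<Otimes>\<^sub>M borel)"
      unfolding G_def disk_kernel_def k_def .
    have "(\<lambda>p. ennreal (osc (fst p) (snd p)) * disk_kernel K a (cis (fst p)) (cis (snd p))) \<in> borel_measurable (borel \<Otimes>\<^sub>M borel)"
      by measurable
    then have "case_prod (\<lambda>x y. ennreal (osc x y) * disk_kernel K a (cis x) (cis y)) \<in> borel_measurable (borel \<Otimes>\<^sub>M borel)"
      by (simp add: split_beta')
    from rect_integral_cmult[OF this, of "{0..2*pi}" "{0..2*pi}" "ennreal (1 / (8 * pi\<^sup>2))"]
    show ?thesis unfolding rect_integral_def by (simp add: mult.left_commute)
  qed
  finally show ?thesis unfolding k_def .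
qed

lemma disk_energy_bounds:
  assumes L2: "circle_L2 f"
  obtains c C where "0 < c" "0 < C"
    "\<And>a. cmod a < 1 \<Longrightarrow> ennreal c * circle_energy a
      \<le> (\<integral>\<^sup>+z\<in>ball 0 1. ennreal ((poisson_sq f z - (cmod (poisson_ext f z))\<^sup>2)
        * K (1 - (cmod (mobius a z))\<^sup>2) / (1 - (cmod z)\<^sup>2)\<^sup>2) \<partial>lborel)"
    "\<And>a. cmod a < 1 \<Longrightarrow>
      (\<integral>\<^sup>+z\<in>ball 0 1. ennreal ((poisson_sq f z - (cmod (poisson_ext f z))\<^sup>2)
        * K (1 - (cmod (mobius a z))\<^sup>2) / (1 - (cmod z)\<^sup>2)\<^sup>2) \<partial>lborel) \<le> ennreal C * circle_energy a"
proof -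
  obtain c C where c: "0 < c" and C: "0 < C" and lower: "\<And>a u v. cmod a < 1 \<Longrightarrow> cmod u = 1 \<Longrightarrow> cmod v = 1 \<Longrightarrow> u \<noteq> v \<Longrightarrow>
      ennreal (c * (K (cmod (mobius a u - mobius a v) / 2) / (cmod (u - v))\<^sup>2)) \<le> disk_kernel K a u v"
    and upper: "\<And>a u v. cmod a < 1 \<Longrightarrow> cmod u = 1 \<Longrightarrow> cmod v = 1 \<Longrightarrow> u \<noteq> v \<Longrightarrow>
      disk_kernel K a u v \<le> ennreal (C * (K (cmod (mobius a u - mobius a v) / 2) / (cmod (u - v))\<^sup>2))"
    using disk_kernel_bounds by metis
  let ?m = "1 / (8 * pi\<^sup>2)" and ?J = "{0..2*pi}"
  let ?R = "\<lambda>a. rect_integral ?J ?J (\<lambda>x y. ennreal (osc x y) * disk_kernel K a (cis x) (cis y))"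
  have scale: "rect_integral ?J ?J (\<lambda>x y. ennreal s * ennreal (osc x y * (K (mchord a x y / 2) / (chord x y)\<^sup>2)))
    = ennreal s * circle_energy a" for s a
    unfolding circle_energy_def by (rule rect_integral_cmult) measurable
  have rearr: "ennreal s * ennreal (osc x y * (K (mchord a x y / 2) / (chord x y)\<^sup>2))
      = ennreal (osc x y) * ennreal (s * (K (mchord a x y / 2) / (chord x y)\<^sup>2))" if "0 < s" for s a x y
    using that nonneg by (simp add: ennreal_mult'[symmetric] mult_ac)
  have low: "ennreal c * circle_energy a \<le> ?R a" if a: "cmod a < 1" for a
    unfolding scale[symmetric]
  proof (rule rect_integral_mono)
    fix x y
    show "ennreal c * ennreal (osc x y * (K (mchord a x y / 2) / (chord x y)\<^sup>2)) \<le> ennreal (osc x y) * disk_kernel K a (cis x) (cis y)"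
    proof (cases "cis x = cis y")
      \<comment> \<open>At coinciding points the kernel may be infinite, but the oscillation is 0
        and 0 times \<infinity> is 0.\<close>
      case True then show ?thesis by (simp add: osc_eq_0 chord_def)
    next
      case False
      then show ?thesis unfolding rearr[OF c] unfolding mchord_def chord_def by (intro mult_left_mono lower a) auto
    qed
  qed
  have up: "?R a \<le> ennreal C * circle_energy a" if a: "cmod a < 1" for a
    unfolding scale[symmetric]
  proof (rule rect_integral_mono)
    fix x y
    show "ennreal (osc x y) * disk_kernel K a (cis x) (cis y) \<le> ennreal C * ennreal (osc x y * (K (mchord a x y / 2) / (chord x y)\<^sup>2))"
    proof (cases "cis x = cis y")
      case True then show ?thesis by (simp add: osc_eq_0 chord_def)
    next
      case False
      then show ?thesis unfolding rearr[OF C] unfolding mchord_def chord_def by (intro mult_left_mono upper a) auto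
    qed
  qed
  show ?thesis
  proof (rule that[of "?m * c" "?m * C"])
    fix a :: complex assume a: "cmod a < 1"
    have m: "ennreal (?m * s) * E = ennreal ?m * (ennreal s * E)" for s E
      by (subst ennreal_mult') (simp_all add: mult.assoc)
    show "ennreal (?m * c) * circle_energy a \<le> (\<integral>\<^sup>+z\<in>ball 0 1. ennreal ((poisson_sq f z - (cmod (poisson_ext f z))\<^sup>2)
        * K (1 - (cmod (mobius a z))\<^sup>2) / (1 - (cmod z)\<^sup>2)\<^sup>2) \<partial>lborel)"
      unfolding disk_energy_eq[OF L2 a] m by (rule mult_left_mono[OF low[OF a]]) simp
    show "(\<integral>\<^sup>+z\<in>ball 0 1. ennreal ((poisson_sq f z - (cmod (poisson_ext f z))\<^sup>2)
        * K (1 - (cmod (mobius a z))\<^sup>2) / (1 - (cmod z)\<^sup>2)\<^sup>2) \<partial>lborel) \<le> ennreal (?m * C) * circle_energy a"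
      unfolding disk_energy_eq[OF L2 a] m by (rule mult_left_mono[OF up[OF a]]) simp
  qed (use c C in auto)
qed

text \<open>All comparison constants are independent of the arc and of \<open>a\<close>, so
  finiteness passes between the two suprema through \<open>circle_energy\<close>.\<close>

lemma QK_iff_disk_energy:
  assumes L2: "circle_L2 f"
  shows "in_QK K f \<longleftrightarrow>
    (SUP a\<in>ball 0 1. \<integral>\<^sup>+ z\<in>ball 0 1.
        ennreal ((poisson_sq f z - (cmod (poisson_ext f z))\<^sup>2)
                 * K (1 - (cmod (mobius a z))\<^sup>2) / (1 - (cmod z)\<^sup>2)\<^sup>2) \<partial>lborel) < \<infinity>"
    (is "_ \<longleftrightarrow> (SUP a\<in>_. ?R a) < \<infinity>")
proof -
  let ?Q = "SUP q\<in>(UNIV :: real set) \<times> {0<..2*pi}. QK_arc_integral K f (fst q) (snd q)"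
  obtain c C where c: "0 < c" "0 < C" "\<And>a. cmod a < 1 \<Longrightarrow> ennreal c * circle_energy a \<le> ?R a"
    "\<And>a. cmod a < 1 \<Longrightarrow> ?R a \<le> ennreal C * circle_energy a"
    using disk_energy_bounds[OF L2] by blast
  obtain C' where C': "C' \<ge> 0" "\<And>M a. 0 \<le> M \<Longrightarrow> (\<And>\<alpha> L. 0 < L \<Longrightarrow> L \<le> 2 * pi \<Longrightarrow> QK_arc_integral K f \<alpha> L \<le> ennreal M)
     \<Longrightarrow> cmod a < 1 \<Longrightarrow> circle_energy a \<le> ennreal (C' * M)"
    using energy_le_arcs by blast
  have "(SUP a\<in>ball 0 1. ?R a) < \<infinity>" if Q: "?Q < \<infinity>"
  proof -
    define M where "M = enn2real ?Q"
    have QM: "?Q = ennreal M" using Q by (simp add: M_def ennreal_enn2real)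
    have arcs: "QK_arc_integral K f \<alpha> L \<le> ennreal M" if "0 < L" "L \<le> 2 * pi" for \<alpha> L
      unfolding QM[symmetric] using that by (intro SUP_upper2[of "(\<alpha>, L)"]) auto
    have M0: "0 \<le> M" by (simp add: M_def)
    have "?R a \<le> ennreal C * ennreal (C' * M)" if "a \<in> ball 0 1" for a
    proof -
      have a: "cmod a < 1" using that by simp
      show ?thesis using c(4)[OF a] mult_left_mono[OF C'(2)[OF M0 arcs a], of "ennreal C"] by (meson order_trans zero_le)
    qed
    then have "(SUP a\<in>ball 0 1. ?R a) \<le> ennreal C * ennreal (C' * M)" by (rule SUP_least)
    also have "\<dots> < \<infinity>" by (simp add: ennreal_mult_less_top)
    finally show ?thesis .
  qed
  moreover have "?Q < \<infinity>" if R: "(SUP a\<in>ball 0 1. ?R a) < \<infinity>"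
  proof -
    let ?S = "SUP a\<in>ball 0 1. ?R a"
    have "QK_arc_integral K f \<alpha> L \<le> ennreal (p (8 * pi)) * (ennreal (1 / c) * ?S)" if L: "0 < L" "L \<le> 2 * pi" for \<alpha> L
    proof -
      define a where "a = (1 - L / (4 * pi)) *\<^sub>R cis (\<alpha> + L / 2)"
      note al = arc_le_energy[OF L, of \<alpha>, folded a_def]
      have "ennreal c * circle_energy a \<le> ?S"
        using c(3)[OF al(1)] al(1) by (intro SUP_upper2[of a]) auto
      then have "ennreal (1 / c) * (ennreal c * circle_energy a) \<le> ennreal (1 / c) * ?S"
        by (rule mult_left_mono) simp
      moreover have "ennreal (1 / c) * (ennreal c * circle_energy a) = circle_energy a"
        using c(1) by (simp add: mult.assoc[symmetric] ennreal_mult'[symmetric])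
      ultimately have "circle_energy a \<le> ennreal (1 / c) * ?S" by simp
      then show ?thesis using al(2) by (meson mult_left_mono order_trans zero_le)
    qed
    then have "?Q \<le> ennreal (p (8 * pi)) * (ennreal (1 / c) * ?S)"
      by (intro SUP_least) auto
    also have "\<dots> < \<infinity>" using R by (simp add: ennreal_mult_less_top)
    finally show ?thesis .
  qed
  ultimately show ?thesis using L2 unfolding in_QK_def by blast
qed

end

section \<open>Reduction of the theorem to positive weights that increase on the whole line\<close>

lemma measurable_of_circle_L2:
  assumes "circle_L2 f" shows "(\<lambda>x. f (cis x)) \<in> borel_measurable borel"
proof -
  define g where "g x = indicator {0..2*pi} x *\<^sub>R f (cis x)" for x :: real
  have [measurable]: "g \<in> borel_measurable borel"
    using assms unfolding circle_L2_def set_borel_measurable_def g_def by simp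
  define k where "k x = \<lfloor>x / (2 * pi)\<rfloor>" for x :: real
  \<comment> \<open>Reducing \<open>x\<close> modulo the period is a Borel map into the interval on
    which measurability is given.\<close>
  have "f (cis x) = g (x - 2 * pi * of_int (k x))" for x
  proof -
    have "of_int (k x) \<le> x / (2 * pi)" "x / (2 * pi) < of_int (k x) + 1" unfolding k_def by linarith+
    then have "x - 2 * pi * of_int (k x) \<in> {0..2*pi}" by (simp add: field_simps)
    moreover have "cis (x - 2 * pi * of_int (k x)) = cis x"
      using cis_add_2pi_int[of x "- k x"] by simp
    ultimately show ?thesis by (simp add: g_def)
  qed
  then show ?thesis unfolding k_def by simp
qed

text \<open>If \<open>K\<close> vanishes somewhere on \<open>(0,1]\<close> without being identically zero, then \<open>phiK K\<close> is infinite
  on a half-line.\<close>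

lemma weight_zero_or_positive:
  fixes K :: "real \<Rightarrow> real"
  assumes mono: "mono K" and nonneg: "\<And>x. 0 \<le> K x"
    and int1: "(\<integral>\<^sup>+ s\<in>{1..}. phiK K s / ennreal (s\<^sup>2) \<partial>lborel) < \<infinity>"
  shows "(\<forall>x. K x = 0) \<or> (\<forall>x>0. 0 < K x)"
proof (rule ccontr)
  assume neg: "\<not> ?thesis"
  then obtain t0 where "0 < t0" "\<not> 0 < K t0" by blast
  then have t0: "0 < t0" "K t0 = 0" using nonneg[of t0] by (auto simp: order_less_le)
  define t where "t = min t0 1"
  have "K t \<le> K t0" by (rule monoD[OF mono]) (simp add: t_def)
  then have t: "0 < t" "t \<le> 1" "K t = 0" using t0 nonneg[of t] by (auto simp: t_def)
  obtain x where "K x \<noteq> 0" using neg by blast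
  then have x: "0 < K x" using nonneg[of x] by (simp add: order_less_le)
  \<comment> \<open>For \<open>s \<ge> x / t\<close> the product \<open>s * t\<close> reaches
    \<open>x\<close>, where \<open>K\<close> is positive; the maximum with 1 stays in the domain of
    \<open>int1\<close>.\<close>
  define m where "m = max 1 (x / t)"
  have "phiK K s = top" if "m \<le> s" for s
  proof -
    have "x / t \<le> s" using that by (simp add: m_def)
    then have "x \<le> s * t" using t(1) by (simp add: field_simps)
    then have "0 < K (s * t)" using x monoD[OF mono, of x "s * t"] by linarith
    then have "ennreal (K (s * t)) / ennreal (K t) = top"
      using t(3) by (simp add: divide_ennreal_def ennreal_mult_eq_top_iff ennreal_mult_top)
    moreover have "ennreal (K (s * t)) / ennreal (K t) \<le> phiK K s"
      unfolding phiK_def using t by (intro SUP_upper) auto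
    ultimately show ?thesis by (simp add: top_unique)
  qed
  \<comment> \<open>Dividing by \<open>s^2\<close> keeps the value \<infinity>, and an infinite
    integrand on an interval of length 1 already exceeds \<open>int1\<close>.\<close>
  then have "(\<integral>\<^sup>+ s\<in>{m..m+1}. top \<partial>lborel) \<le> (\<integral>\<^sup>+ s\<in>{1..}. phiK K s / ennreal (s\<^sup>2) \<partial>lborel)"
    by (intro nn_integral_mono) (auto simp: m_def ennreal_top_divide split: split_indicator)
  moreover have "(\<integral>\<^sup>+ s\<in>{m..m+1}. top \<partial>lborel) = (top :: ennreal)"
    by (subst nn_integral_cmult_indicator) (auto simp: ennreal_top_mult)
  ultimately show False using int1 by simp
qed

theorem theorem2p1:
  fixes K :: "real \<Rightarrow> real" and f :: "complex \<Rightarrow> complex"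
  assumes K_nonneg: "\<And>t. t \<ge> 0 \<Longrightarrow> K t \<ge> 0"
    and K_mono: "mono_on {0..} K"
    and K_rcont: "\<And>t. t \<ge> 0 \<Longrightarrow> continuous (at_right t) K"
    and K_int0: "(\<integral>\<^sup>+ s\<in>{0<..1}. phiK K s / ennreal s \<partial>lborel) < \<infinity>"
    and K_int1: "(\<integral>\<^sup>+ s\<in>{1..}. phiK K s / ennreal (s\<^sup>2) \<partial>lborel) < \<infinity>"
    and f_L2: "circle_L2 f"
  shows "in_QK K f \<longleftrightarrow>
    (SUP a\<in>ball 0 1. \<integral>\<^sup>+ z\<in>ball 0 1.
        ennreal ((poisson_sq f z - (cmod (poisson_ext f z))\<^sup>2)
                 * K (1 - (cmod (mobius a z))\<^sup>2) / (1 - (cmod z)\<^sup>2)\<^sup>2) \<partial>lborel) < \<infinity>"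
proof -
  \<comment> \<open>The values of \<open>K\<close> at negative arguments are arbitrary; \<open>K'\<close> is monotone on the whole line.\<close>
  define K' where "K' x = K (max 0 x)" for x
  have eq: "K' x = K x" if "0 \<le> x" for x using that by (simp add: K'_def max_def)
  have mono': "mono K'"
    unfolding K'_def by (intro monoI mono_onD[OF K_mono]) auto
  have nonneg': "0 \<le> K' x" for x unfolding K'_def by (rule K_nonneg) simp
  have phi: "phiK K' s = phiK K s" if "0 < s" for s
    unfolding phiK_def using that by (intro SUP_cong refl) (simp add: eq)
  have int0': "(\<integral>\<^sup>+ s\<in>{0<..1}. phiK K' s / ennreal s \<partial>lborel) < \<infinity>"
  proof -
    have "(\<integral>\<^sup>+ s\<in>{0<..1}. phiK K' s / ennreal s \<partial>lborel) = (\<integral>\<^sup>+ s\<in>{0<..1}. phiK K s / ennreal s \<partial>lborel)"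
      by (intro nn_integral_cong) (auto simp: phi split: split_indicator)
    then show ?thesis using K_int0 by simp
  qed
  have int1': "(\<integral>\<^sup>+ s\<in>{1..}. phiK K' s / ennreal (s\<^sup>2) \<partial>lborel) < \<infinity>"
  proof -
    have "(\<integral>\<^sup>+ s\<in>{1..}. phiK K' s / ennreal (s\<^sup>2) \<partial>lborel) = (\<integral>\<^sup>+ s\<in>{1..}. phiK K s / ennreal (s\<^sup>2) \<partial>lborel)"
      by (intro nn_integral_cong) (auto simp: phi split: split_indicator)
    then show ?thesis using K_int1 by simp
  qed
  have arcs: "QK_arc_integral K f \<alpha> L = QK_arc_integral K' f \<alpha> L" if "0 < L" for \<alpha> L
    unfolding QK_arc_integral_def using that by (simp add: eq)
  have left: "in_QK K f \<longleftrightarrow> in_QK K' f"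
  proof -
    have "(SUP q\<in>(UNIV :: real set) \<times> {0<..2*pi}. QK_arc_integral K f (fst q) (snd q))
      = (SUP q\<in>(UNIV :: real set) \<times> {0<..2*pi}. QK_arc_integral K' f (fst q) (snd q))"
      using arcs by (intro SUP_cong refl) auto
    then show ?thesis unfolding in_QK_def by simp
  qed
  let ?R = "\<lambda>K a. \<integral>\<^sup>+ z\<in>ball 0 1.
        ennreal ((poisson_sq f z - (cmod (poisson_ext f z))\<^sup>2)
                 * K (1 - (cmod (mobius a z))\<^sup>2) / (1 - (cmod z)\<^sup>2)\<^sup>2) \<partial>lborel"
  have right: "(SUP a\<in>ball 0 1. ?R K a) = (SUP a\<in>ball 0 1. ?R K' a)"
  proof (rule SUP_cong[OF refl], rule nn_integral_cong)
    fix a z :: complex assume "a \<in> ball 0 1"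
    \<comment> \<open>Inside the disk the argument of \<open>K\<close> is nonnegative, where
      \<open>K\<close> and \<open>K'\<close> agree; outside, the indicator vanishes.\<close>
    then have "0 \<le> 1 - (cmod (mobius a z))\<^sup>2" if "z \<in> ball 0 1"
      using cmod_mobius_less_1[of a z] that by (simp add: abs_square_le_1)
    then show "ennreal ((poisson_sq f z - (cmod (poisson_ext f z))\<^sup>2)
          * K (1 - (cmod (mobius a z))\<^sup>2) / (1 - (cmod z)\<^sup>2)\<^sup>2) * indicator (ball 0 1) z
       = ennreal ((poisson_sq f z - (cmod (poisson_ext f z))\<^sup>2)
          * K' (1 - (cmod (mobius a z))\<^sup>2) / (1 - (cmod z)\<^sup>2)\<^sup>2) * indicator (ball 0 1) z"
      by (simp add: eq split: split_indicator)
  qed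
  show ?thesis
    unfolding left right
  proof (cases "\<forall>x. K' x = 0")
    \<comment> \<open>As 0/0 = 0 in \<open>phiK\<close>, the zero weight satisfies the hypotheses;
      both suprema are then 0.\<close>
    case True
    have "QK_arc_integral K' f \<alpha> L = 0" for \<alpha> L unfolding QK_arc_integral_def by (simp add: True)
    then have "in_QK K' f" using f_L2 by (simp add: in_QK_def)
    moreover have "(SUP a\<in>ball 0 1. ?R K' a) < \<infinity>" by (simp add: True)
    ultimately show "in_QK K' f \<longleftrightarrow> (SUP a\<in>ball 0 1. ?R K' a) < \<infinity>" by blast
  next
    case False
    then have "\<And>x. 0 < x \<Longrightarrow> 0 < K' x" using weight_zero_or_positive[OF mono' nonneg' int1'] by blast
    then interpret QK_circle K' f
      using mono' nonneg' int0' int1' measurable_of_circle_L2[OF f_L2] by unfold_locales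
    show "in_QK K' f \<longleftrightarrow> (SUP a\<in>ball 0 1. ?R K' a) < \<infinity>" by (rule QK_iff_disk_energy[OF f_L2])
  qed
qed

end
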